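(* Let $G$ be a discrete group having only countably many amenable subgroups. Then $G$ is C*-simple if and only if its amenable radical is trivial.
   Context: $G$ is C*-simple if its reduced group C*-algebra $\mathrm{C}^*_r(G)$ is simple. The amenable radical is the largest amenable normal subgroup of $G$. *)

theory Defs
  imports "HOL-Analysis.Analysis" "HOL-Algebra.Algebra"
begin

definition amenable_group :: "('a, 'b) monoid_scheme \<Rightarrow> bool" where
  "amenable_group G \<longleftrightarrow> (\<exists>\<mu> :: 'a set \<Rightarrow> real.
      (\<forall>A. A \<subseteq> carrier G \<longrightarrow> 0 \<le> \<mu> A) \<and>
      \<mu> (carrier G) = 1 \<and>
      (\<forall>A B. A \<subseteq> carrier G \<longrightarrow> B \<subseteq> carrier G \<longrightarrow> A \<inter> B = {} \<longrightarrow>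
              \<mu> (A \<union> B) = \<mu> A + \<mu> B) \<and>
      (\<forall>g A. g \<in> carrier G \<longrightarrow> A \<subseteq> carrier G \<longrightarrow> \<mu> (g <#\<^bsub>G\<^esub> A) = \<mu> A))"

definition amenable_subgroups :: "('a, 'b) monoid_scheme \<Rightarrow> 'a set set" where
  "amenable_subgroups G = {H. subgroup H G \<and> amenable_group (G\<lparr>carrier := H\<rparr>)}"

definition amenable_radical :: "('a, 'b) monoid_scheme \<Rightarrow> 'a set" where
  "amenable_radical G = (THE N. N \<lhd> G \<and> amenable_group (G\<lparr>carrier := N\<rparr>) \<and>
      (\<forall>M. M \<lhd> G \<and> amenable_group (G\<lparr>carrier := M\<rparr>) \<longrightarrow> M \<subseteq> N))"

definition l2 :: "('a, 'b) monoid_scheme \<Rightarrow> ('a \<Rightarrow> complex) set" where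
  "l2 G = {f. (\<forall>x. x \<notin> carrier G \<longrightarrow> f x = 0) \<and>
              (\<lambda>x. (cmod (f x))\<^sup>2) summable_on carrier G}"

definition l2norm :: "('a, 'b) monoid_scheme \<Rightarrow> ('a \<Rightarrow> complex) \<Rightarrow> real" where
  "l2norm G f = sqrt (\<Sum>\<^sub>\<infinity>x\<in>carrier G. (cmod (f x))\<^sup>2)"

type_synonym 'a op = "('a \<Rightarrow> complex) \<Rightarrow> ('a \<Rightarrow> complex)"

definition bounded_ops :: "('a, 'b) monoid_scheme \<Rightarrow> 'a op set" where
  "bounded_ops G = {T.
      (\<forall>f \<in> l2 G. T f \<in> l2 G) \<and>
      (\<forall>f. f \<notin> l2 G \<longrightarrow> T f = (\<lambda>_. 0)) \<and>
      (\<forall>f \<in> l2 G. \<forall>h \<in> l2 G. \<forall>a. T (\<lambda>x. a * f x + h x) = (\<lambda>x. a * T f x + T h x)) \<and>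
      (\<exists>K. \<forall>f \<in> l2 G. l2norm G (T f) \<le> K * l2norm G f)}"

definition opnorm :: "('a, 'b) monoid_scheme \<Rightarrow> 'a op \<Rightarrow> real" where
  "opnorm G T = Sup {l2norm G (T f) | f. f \<in> l2 G \<and> l2norm G f \<le> 1}"

definition left_reg :: "('a, 'b) monoid_scheme \<Rightarrow> 'a \<Rightarrow> 'a op" where
  "left_reg G g f = (if f \<in> l2 G then (\<lambda>x. if x \<in> carrier G then f (inv\<^bsub>G\<^esub> g \<otimes>\<^bsub>G\<^esub> x) else 0)
                     else (\<lambda>_. 0))"

definition group_ring_op :: "('a, 'b) monoid_scheme \<Rightarrow> 'a set \<Rightarrow> ('a \<Rightarrow> complex) \<Rightarrow> 'a op" where
  "group_ring_op G S c f = (\<lambda>x. \<Sum>g\<in>S. c g * left_reg G g f x)"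

definition reduced_cstar :: "('a, 'b) monoid_scheme \<Rightarrow> 'a op set" where
  "reduced_cstar G = {T \<in> bounded_ops G. \<forall>\<epsilon>>0. \<exists>S c. finite S \<and> S \<subseteq> carrier G \<and>
      opnorm G (\<lambda>f x. T f x - group_ring_op G S c f x) < \<epsilon>}"

definition closed_ideal :: "('a, 'b) monoid_scheme \<Rightarrow> 'a op set \<Rightarrow> 'a op set \<Rightarrow> bool" where
  "closed_ideal G A I \<longleftrightarrow> I \<subseteq> A \<and> (\<lambda>_ _. 0) \<in> I \<and>
     (\<forall>S\<in>I. \<forall>T\<in>I. (\<lambda>f x. S f x + T f x) \<in> I) \<and>
     (\<forall>S\<in>I. \<forall>a::complex. (\<lambda>f x. a * S f x) \<in> I) \<and>
     (\<forall>S\<in>I. \<forall>T\<in>A. T \<circ> S \<in> I \<and> S \<circ> T \<in> I) \<and>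
     (\<forall>T\<in>A. (\<forall>\<epsilon>>0. \<exists>S\<in>I. opnorm G (\<lambda>f x. T f x - S f x) < \<epsilon>) \<longrightarrow> T \<in> I)"

definition cstar_simple :: "('a, 'b) monoid_scheme \<Rightarrow> bool" where
  "cstar_simple G \<longleftrightarrow> (\<forall>I. closed_ideal G (reduced_cstar G) I \<longrightarrow>
      I = {\<lambda>_ _. 0} \<or> I = reduced_cstar G)"

end

theory Submission
  imports Defs "HOL-Library.Function_Algebras"
begin

text \<open>
  If \<open>N\<close> is an amenable normal subgroup, then by Day's and Namioka's arguments there are almost
  \<open>N\<close>-invariant unit vectors, and the operators that vanish asymptotically on them form a proper
  closed ideal containing \<open>\<lambda>\<^sub>n - 1\<close> for all \<open>n \<in> N\<close>.

  Conversely, let \<open>I\<close> be a proper closed ideal and let \<open>K\<close> be the compact convex set of (real parts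
  of) states on the bounded operators that vanish on \<open>I\<close>. The means on \<open>G\<close> act on \<open>K\<close> by
  convolution. Choose an extreme point \<open>w\<close> of a minimal closed left ideal of the semigroup of means.
  Some \<open>u \<in> K\<close> restricts to a mean \<open>m\<close> with \<open>m * w = w\<close>; extremality concentrates \<open>m\<close> on the
  points that move \<open>w\<close> only a little, which forces \<open>u \<lambda>\<^sub>h = 0\<close> whenever \<open>h\<close> does not fix \<open>w\<close>. The
  stabiliser of \<open>w\<close> is amenable. Hence the set of amenable subgroups supporting some \<open>u \<in> K\<close> is
  nonempty; it is conjugation invariant and compact in the Chabauty topology. As it is countable, a
  minimal invariant closed subset has an isolated point by Baire's theorem and is therefore finite. An
  amenable subgroup with finitely many conjugates is trivial if the amenable radical is, so some
  \<open>u \<in> K\<close> is the canonical trace, which is faithful, and \<open>I = 0\<close>.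
\<close>

section \<open>Sublinear functionals and compactness\<close>

text \<open>States are taken on all bounded operators and not just on the reduced algebra, because
  the former contain the diagonal copy of the bounded functions: there a state becomes a mean on
  \<open>G\<close>. State and mean are tied together by equivariance, since conjugation by
  \<open>left_reg G x\<close> translates the diagonal. Hence the diagonal restrictions of
  \<open>K\<close> form a closed left ideal, and minimality of the left ideal that contains
  \<open>w\<close> is what supplies a restriction \<open>m\<close> with \<open>m * w = w\<close>.
  Describing states by real-linear functionals below the operator norm turns the usual positivity
  arguments into one estimate: a term linear in \<open>t\<close> cannot stay below a quadratic one
  near \<open>t = 0\<close>. The price is that a real part must be controlled on all complex
  multiples of an operator. Countability excludes a perfect set of limits of conjugates. A finite
  conjugacy class is then handled through the kernel \<open>L\<close> of the action on it: an
  amenable \<open>H\<close> in the class meets \<open>L\<close> trivially, so it centralises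
  \<open>L\<close>, and the centraliser of \<open>L\<close> is finite and normal.\<close>

instantiation "fun" :: (type, real_vector) real_vector
begin

definition scaleR_fun_def: "r *\<^sub>R f = (\<lambda>x. r *\<^sub>R f x)"

instance
  by standard (auto simp: scaleR_fun_def fun_eq_iff algebra_simps)

end

section \<open>Separation axioms for the product topology on functions\<close>

lemma open_vimage_apply:
  fixes W :: "'b::topological_space set"
  shows "open W \<Longrightarrow> open ((\<lambda>h :: 'i \<Rightarrow> 'b. h i) -` W)"
  using continuous_on_product_then_coordinatewise[OF continuous_on_id] by (metis open_vimage)

instance "fun" :: (type, t0_space) t0_space
proof
  fix f g :: "'a \<Rightarrow> 'b"
  assume "f \<noteq> g"
  then obtain i where i: "f i \<noteq> g i" by auto
  obtain U where "open U" "(f i \<in> U) \<noteq> (g i \<in> U)"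
    using iffD1[OF separation_t0 i] by (elim exE conjE) simp
  then show "\<exists>U. open U \<and> \<not> (f \<in> U \<longleftrightarrow> g \<in> U)"
    using open_vimage_apply[of U i] by (intro exI[of _ "(\<lambda>h. h i) -` U"]) auto
qed

instance "fun" :: (type, t1_space) t1_space
proof
  fix f g :: "'a \<Rightarrow> 'b"
  assume "f \<noteq> g"
  then obtain i where "f i \<noteq> g i" by auto
  then obtain U where "open U" "f i \<in> U" "g i \<notin> U"
    using t1_space by metis
  then show "\<exists>U. open U \<and> f \<in> U \<and> g \<notin> U"
    using open_vimage_apply[of U i] by (intro exI[of _ "(\<lambda>h. h i) -` U"]) auto
qed

instance "fun" :: (type, t2_space) t2_space
proof
  fix f g :: "'a \<Rightarrow> 'b"
  assume "f \<noteq> g"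
  then obtain i where "f i \<noteq> g i" by auto
  then obtain U V where "open U" "open V" "f i \<in> U" "g i \<in> V" "U \<inter> V = {}"
    using hausdorff by metis
  then show "\<exists>U V. open U \<and> open V \<and> f \<in> U \<and> g \<in> V \<and> U \<inter> V = {}"
    using open_vimage_apply[of U i] open_vimage_apply[of V i]
    by (intro exI[of _ "(\<lambda>h. h i) -` U"] exI[of _ "(\<lambda>h. h i) -` V"]) auto
qed

lemma scaleR_fun_apply [simp]: "(r *\<^sub>R f) x = r *\<^sub>R f x"
  by (simp add: scaleR_fun_def)

section \<open>Hahn-Banach separation by sublinear functionals\<close>

definition sublinear_on :: "'v::real_vector set \<Rightarrow> ('v \<Rightarrow> real) \<Rightarrow> bool" where
  "sublinear_on E p \<longleftrightarrow>
     (\<forall>x\<in>E. \<forall>y\<in>E. p (x + y) \<le> p x + p y) \<and> (\<forall>x\<in>E. \<forall>c\<ge>0. p (c *\<^sub>R x) = c * p x)"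

text \<open>The value 0 off \<open>E\<close> makes a functional determined by its restriction to
  \<open>E\<close>, so the set sits in a product of compact intervals over the whole type.\<close>

definition dominated :: "'v::real_vector set \<Rightarrow> ('v \<Rightarrow> real) \<Rightarrow> ('v \<Rightarrow> real) set" where
  "dominated E p = {L. (\<forall>x\<in>E. \<forall>y\<in>E. L (x + y) = L x + L y) \<and>
     (\<forall>x\<in>E. \<forall>c. L (c *\<^sub>R x) = c * L x) \<and> (\<forall>x\<in>E. L x \<le> p x) \<and> (\<forall>x. x \<notin> E \<longrightarrow> L x = 0)}"

text \<open>The missing inequality \<open>c * p x \<le> p (c *\<^sub>R x)\<close> is the assumed one
  for the factor \<open>1 / c\<close>.\<close>

lemma sublinear_onI:
  assumes E: "subspace E" and zero: "p 0 = 0"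
    and add: "\<And>x y. x \<in> E \<Longrightarrow> y \<in> E \<Longrightarrow> p (x + y) \<le> p x + p y"
    and scale: "\<And>x c. x \<in> E \<Longrightarrow> c > 0 \<Longrightarrow> p (c *\<^sub>R x) \<le> c * p x"
  shows "sublinear_on E p"
proof -
  have "p (c *\<^sub>R x) = c * p x" if x: "x \<in> E" and c: "c \<ge> 0" for x c
  proof (cases "c = 0")
    case False
    with c have c: "c > 0" by simp
    have "p ((1 / c) *\<^sub>R (c *\<^sub>R x)) \<le> (1 / c) * p (c *\<^sub>R x)"
      using c x E by (intro scale) (auto simp: subspace_def)
    then have "c * p x \<le> p (c *\<^sub>R x)"
      using c by (simp add: field_simps)
    with scale[OF x c] show ?thesis by simp
  qed (simp add: zero)
  with add show ?thesis by (auto simp: sublinear_on_def)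
qed

lemma sublinear_on_zero: "sublinear_on E p \<Longrightarrow> subspace E \<Longrightarrow> p 0 = 0"
  unfolding sublinear_on_def by (metis mult_zero_left order_refl scaleR_zero_left subspace_0)

lemma sublinear_on_ge_neg:
  assumes "sublinear_on E p" "subspace E" "x \<in> E" "y \<in> E"
  shows "- p (- x) + p y \<le> p (x + y)"
proof -
  have "p (- x + (x + y)) \<le> p (- x) + p (x + y)"
    using assms unfolding sublinear_on_def by (metis subspace_add subspace_neg)
  then show ?thesis by simp
qed

text \<open>The infimum of \<open>p (x + t *\<^sub>R c) - t * \<epsilon>\<close> over the cone
  generated by \<open>C\<close> is the largest sublinear minorant of \<open>p\<close> on
  \<open>E\<close> that is at most \<open>- \<epsilon>\<close> on \<open>- C\<close>. It is finite
  because \<open>\<epsilon> \<le> p c\<close> gives the lower bound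
  \<open>- p (- x)\<close>.\<close>

lemma sublinear_on_separate:
  fixes E :: "'v::real_vector set"
  assumes E: "subspace E" and p: "sublinear_on E p"
    and C: "C \<subseteq> E" "convex C" "C \<noteq> {}" "\<And>c. c \<in> C \<Longrightarrow> \<epsilon> \<le> p c"
  obtains q where "sublinear_on E q" "\<And>x. x \<in> E \<Longrightarrow> q x \<le> p x" "\<And>x. x \<notin> E \<Longrightarrow> q x = 0"
    "\<And>c. c \<in> C \<Longrightarrow> q (- c) \<le> - \<epsilon>"
proof
  define V where "V x = {p (x + t *\<^sub>R c) - t * \<epsilon> | t c. t \<ge> 0 \<and> c \<in> C}" for x
  define q where "q x = (if x \<in> E then Inf (V x) else 0)" for x
  have inE: "x + t *\<^sub>R c \<in> E" if "x \<in> E" "c \<in> C" for x t c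
    using that C E by (auto simp: subspace_def)
  have lower: "- p (- x) \<le> v" if x: "x \<in> E" and v: "v \<in> V x" for x v
  proof -
    obtain t c where tc: "v = p (x + t *\<^sub>R c) - t * \<epsilon>" "t \<ge> 0" "c \<in> C"
      using v by (auto simp: V_def)
    have "- p (- x) + p (t *\<^sub>R c) \<le> p (x + t *\<^sub>R c)"
      using sublinear_on_ge_neg[OF p E x] tc C E by (metis subspace_scale subsetD)
    moreover have "p (t *\<^sub>R c) = t * p c"
      using p tc C unfolding sublinear_on_def by blast
    moreover have "t * \<epsilon> \<le> t * p c"
      using tc C by (simp add: mult_left_mono)
    ultimately show ?thesis using tc by linarith
  qed
  have bdd: "bdd_below (V x)" if "x \<in> E" for x
    using lower[OF that] by (auto simp: bdd_below_def)
  have ne: "V x \<noteq> {}" for x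
    using C(3) by (auto simp: V_def)
  have le: "q x \<le> p (x + t *\<^sub>R c) - t * \<epsilon>" if "x \<in> E" "t \<ge> 0" "c \<in> C" for x t c
    unfolding q_def using that bdd by (auto intro!: cInf_lower simp: V_def)
  have ge: "a \<le> q x" if "x \<in> E" "\<And>t c. t \<ge> 0 \<Longrightarrow> c \<in> C \<Longrightarrow> a \<le> p (x + t *\<^sub>R c) - t * \<epsilon>" for a x
  proof -
    have "a \<le> Inf (V x)"
      using that(2) by (intro cInf_greatest ne) (auto simp: V_def)
    then show ?thesis using that(1) by (simp add: q_def)
  qed
  obtain c0 where c0: "c0 \<in> C" using C(3) by blast
  show le_p: "q x \<le> p x" if "x \<in> E" for x
    using le[OF that order_refl c0] by simp
  show "q x = 0" if "x \<notin> E" for x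
    using that by (simp add: q_def)
  show "q (- c) \<le> - \<epsilon>" if "c \<in> C" for c
  proof -
    have "- c \<in> E" using that C E by (auto intro: subspace_neg)
    from le[OF this zero_le_one that] sublinear_on_zero[OF p E] show ?thesis by simp
  qed
  show "sublinear_on E q"
  proof (rule sublinear_onI[OF E])
    have "0 \<in> E" using E by (rule subspace_0)
    moreover have "0 \<le> q 0"
    proof (rule ge[OF \<open>0 \<in> E\<close>])
      fix t :: real and c assume tc: "t \<ge> 0" "c \<in> C"
      have "p (t *\<^sub>R c) = t * p c"
        using p tc C unfolding sublinear_on_def by blast
      moreover have "t * \<epsilon> \<le> t * p c"
        using tc C by (simp add: mult_left_mono)
      ultimately show "0 \<le> p (0 + t *\<^sub>R c) - t * \<epsilon>" by simp
    qed
    ultimately show "q 0 = 0"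
      using le_p[of 0] sublinear_on_zero[OF p E] by simp
  next
    fix x y assume xy: "x \<in> E" "y \<in> E"
    have *: "q (x + y) \<le> (p (x + t *\<^sub>R c) - t * \<epsilon>) + (p (y + s *\<^sub>R d) - s * \<epsilon>)"
      if "t \<ge> 0" "c \<in> C" "s \<ge> 0" "d \<in> C" for t c s d
    proof -
      have sum: "p ((x + t *\<^sub>R c) + (y + s *\<^sub>R d)) \<le> p (x + t *\<^sub>R c) + p (y + s *\<^sub>R d)"
        using p inE xy that unfolding sublinear_on_def by blast
      \<comment> \<open>Convexity replaces \<open>t *\<^sub>R c + s *\<^sub>R d\<close> by one
        multiple of a point of \<open>C\<close>, which the infimum for \<open>x + y\<close> then
        sees. If \<open>t + s = 0\<close> any point of \<open>C\<close> serves.\<close>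
      obtain e where e: "e \<in> C" "(t + s) *\<^sub>R e = t *\<^sub>R c + s *\<^sub>R d"
      proof (cases "t + s = 0")
        case True
        then have "t = 0" "s = 0" using \<open>t \<ge> 0\<close> \<open>s \<ge> 0\<close> by linarith+
        then show ?thesis using that \<open>c \<in> C\<close> by auto
      next
        case False
        have "(t / (t + s)) *\<^sub>R c + (s / (t + s)) *\<^sub>R d \<in> C"
          using C(2) \<open>t \<ge> 0\<close> \<open>s \<ge> 0\<close> \<open>c \<in> C\<close> \<open>d \<in> C\<close> False
          by (intro convexD) (auto simp: add_divide_distrib[symmetric])
        moreover have "(t + s) *\<^sub>R ((t / (t + s)) *\<^sub>R c + (s / (t + s)) *\<^sub>R d) = t *\<^sub>R c + s *\<^sub>R d"
          using False by (simp add: scaleR_add_right)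
        ultimately show ?thesis using that by blast
      qed
      have "q (x + y) \<le> p ((x + y) + (t + s) *\<^sub>R e) - (t + s) * \<epsilon>"
        using xy e that E by (intro le) (auto intro: subspace_add)
      also have "(x + y) + (t + s) *\<^sub>R e = (x + t *\<^sub>R c) + (y + s *\<^sub>R d)"
        unfolding e(2) by (simp add: algebra_simps)
      finally show ?thesis using sum by (simp add: algebra_simps)
    qed
    have "q (x + y) - q y \<le> q x"
    proof (rule ge[OF xy(1)])
      fix t c assume tc: "t \<ge> (0::real)" "c \<in> C"
      have "q (x + y) - (p (x + t *\<^sub>R c) - t * \<epsilon>) \<le> q y"
        using *[OF tc] by (intro ge[OF xy(2)]) (simp add: algebra_simps)
      then show "q (x + y) - q y \<le> p (x + t *\<^sub>R c) - t * \<epsilon>" by simp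
    qed
    then show "q (x + y) \<le> q x + q y" by simp
  next
    fix x and a :: real assume x: "x \<in> E" and a: "a > 0"
    have "q (a *\<^sub>R x) / a \<le> q x"
    proof (rule ge[OF x])
      fix t c assume tc: "t \<ge> (0::real)" "c \<in> C"
      have "q (a *\<^sub>R x) \<le> p (a *\<^sub>R x + (a * t) *\<^sub>R c) - (a * t) * \<epsilon>"
        using x tc a E by (intro le) (auto intro: subspace_scale)
      also have "a *\<^sub>R x + (a * t) *\<^sub>R c = a *\<^sub>R (x + t *\<^sub>R c)"
        by (simp add: scaleR_add_right)
      also have "p \<dots> = a * p (x + t *\<^sub>R c)"
        using p inE[OF x tc(2)] a unfolding sublinear_on_def by (simp add: less_imp_le)
      finally show "q (a *\<^sub>R x) / a \<le> p (x + t *\<^sub>R c) - t * \<epsilon>"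
        using a by (simp add: field_simps)
    qed
    then show "q (a *\<^sub>R x) \<le> a * q x"
      using a by (simp add: field_simps)
  qed
qed

text \<open>A minimal sublinear functional is linear.\<close>

lemma dominated_below_sublinear:
  fixes E :: "'v::real_vector set"
  assumes E: "subspace E" and p: "sublinear_on E p"
  obtains L where "L \<in> dominated E p"
proof -
  define p0 where "p0 x = (if x \<in> E then p x else 0)" for x
  define A where "A = {q. sublinear_on E q \<and> (\<forall>x\<in>E. q x \<le> p x) \<and> (\<forall>x. x \<notin> E \<longrightarrow> q x = 0)}"
  have "sublinear_on E p0"
    using p E unfolding sublinear_on_def p0_def by (auto simp: subspace_def)
  then have p0: "p0 \<in> A" by (auto simp: A_def p0_def)
  have po: "partial_order_on A (relation_of (\<lambda>q r. \<forall>x. r x \<le> q x) A)"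
  proof (rule partial_order_on_relation_ofI)
    fix a b c :: "'v \<Rightarrow> real"
    show "\<forall>x. c x \<le> a x" if "\<forall>x. b x \<le> a x" "\<forall>x. c x \<le> b x"
      using that by (meson order_trans)
    show "a = b" if "\<forall>x. b x \<le> a x" "\<forall>x. a x \<le> b x"
      using that by (auto simp: fun_eq_iff intro: order_antisym)
  qed auto
  have "\<exists>m\<in>A. \<forall>a\<in>A. (\<forall>x. a x \<le> m x) \<longrightarrow> a = m"
  proof (rule predicate_Zorn[OF po])
    fix C assume "C \<in> Chains (relation_of (\<lambda>q r. \<forall>x. r x \<le> q x) A)"
    then have CA: "C \<subseteq> A" and chain: "\<And>q r. q \<in> C \<Longrightarrow> r \<in> C \<Longrightarrow> (\<forall>x. r x \<le> q x) \<or> (\<forall>x. q x \<le> r x)"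
      unfolding Chains_def relation_of_def by auto
    show "\<exists>u\<in>A. \<forall>a\<in>C. \<forall>x. u x \<le> a x"
    proof (cases "C = {}")
      case True
      then show ?thesis using p0 by auto
    next
      case False
      define u where "u x = (INF q\<in>C. q x)" for x
      \<comment> \<open>On \<open>E\<close> the common lower bound is \<open>- p (- x)\<close>, from
        \<open>0 \<le> q x + q (- x)\<close> and \<open>q \<le> p\<close>. Without it the infimum of
        reals would be meaningless.\<close>
      have bdd: "bdd_below ((\<lambda>q. q x) ` C)" for x
      proof (cases "x \<in> E")
        case True
        have "- p (- x) \<le> q x" if "q \<in> C" for q
        proof -
          from that CA have q: "sublinear_on E q" "q (- x) \<le> p (- x)"
            using True E by (auto simp: A_def subspace_neg)
          from sublinear_on_ge_neg[OF q(1) E True subspace_0[OF E]] sublinear_on_zero[OF q(1) E] q(2)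
          show ?thesis by simp
        qed
        then show ?thesis by (auto simp: bdd_below_def)
      next
        case False
        then show ?thesis using CA by (intro bdd_belowI[where m=0]) (auto simp: A_def)
      qed
      have le: "u x \<le> q x" if "q \<in> C" for q x
        unfolding u_def using bdd that by (rule cINF_lower)
      have ge: "a \<le> u x" if "\<And>q. q \<in> C \<Longrightarrow> a \<le> q x" for a x
        unfolding u_def using False that by (rule cINF_greatest)
      have CE: "q 0 = 0" "\<And>x c. x \<in> E \<Longrightarrow> c \<ge> 0 \<Longrightarrow> q (c *\<^sub>R x) = c * q x"
          "\<And>x y. x \<in> E \<Longrightarrow> y \<in> E \<Longrightarrow> q (x + y) \<le> q x + q y"
          "\<And>x. x \<in> E \<Longrightarrow> q x \<le> p x" "\<And>x. x \<notin> E \<Longrightarrow> q x = 0" if "q \<in> C" for q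
        using that CA sublinear_on_zero[of E q] E by (auto simp: A_def sublinear_on_def)
      obtain q0 where q0: "q0 \<in> C" using False by blast
      have "sublinear_on E u"
      proof (rule sublinear_onI[OF E])
        show "u 0 = 0"
          using le[OF q0, of 0] ge[of 0 0] CE(1) q0 by (metis order_antisym order_refl)
      next
        fix x y assume xy: "x \<in> E" "y \<in> E"
        have "u (x + y) - u y \<le> u x"
        proof (rule ge)
          fix q assume q: "q \<in> C"
          have "u (x + y) - q x \<le> u y"
          proof (rule ge)
            fix r assume r: "r \<in> C"
            \<comment> \<open>An infimum of sublinear functionals is subadditive only along a chain:
              the smaller of \<open>q\<close> and \<open>r\<close> is used at both \<open>x\<close>
              and \<open>y\<close>.\<close>
            from chain[OF q r] show "u (x + y) - q x \<le> r y"
            proof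
              assume "\<forall>x. r x \<le> q x"
              then show ?thesis using CE(3)[OF r xy] le[OF r, of "x + y"] by (smt (verit))
            next
              assume "\<forall>x. q x \<le> r x"
              then show ?thesis using CE(3)[OF q xy] le[OF q, of "x + y"] by (smt (verit))
            qed
          qed
          then show "u (x + y) - u y \<le> q x" by simp
        qed
        then show "u (x + y) \<le> u x + u y" by simp
      next
        fix x and c :: real assume x: "x \<in> E" and c: "c > 0"
        have "u (c *\<^sub>R x) / c \<le> u x"
        proof (rule ge)
          fix q assume q: "q \<in> C"
          show "u (c *\<^sub>R x) / c \<le> q x"
            using le[OF q, of "c *\<^sub>R x"] CE(2)[OF q x] c by (simp add: field_simps)
        qed
        then show "u (c *\<^sub>R x) \<le> c * u x" using c by (simp add: field_simps)
      qed
      moreover have "u x = 0" if "x \<notin> E" for x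
        using le[OF q0, of x] ge[of 0 x] CE(5)[OF _ that] q0 by (metis order_antisym order_refl)
      ultimately have "u \<in> A"
        using le[OF q0] CE(4)[OF q0] by (auto simp: A_def intro: order_trans)
      then show ?thesis using le by blast
    qed
  qed
  then obtain m where m: "m \<in> A" and min: "\<And>a. a \<in> A \<Longrightarrow> (\<And>x. a x \<le> m x) \<Longrightarrow> a = m"
    by blast
  have sm: "sublinear_on E m" using m by (auto simp: A_def)
  have neg: "m (- x) = - m x" if x: "x \<in> E" for x
  proof -
    \<comment> \<open>Pushing \<open>m\<close> down in the direction of the single point
      \<open>x\<close> with \<open>\<epsilon> = m x\<close> gives a minorant with value at most
      \<open>- m x\<close> at \<open>- x\<close>. By minimality that minorant is \<open>m\<close>
      itself.\<close>
    obtain q where q: "sublinear_on E q" "\<And>y. y \<in> E \<Longrightarrow> q y \<le> m y" "\<And>y. y \<notin> E \<Longrightarrow> q y = 0"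
        "\<And>c. c \<in> {x} \<Longrightarrow> q (- c) \<le> - m x"
      using sublinear_on_separate[OF E sm, of "{x}" "m x"] x by auto
    have "q \<in> A" using q m by (auto simp: A_def intro: order_trans)
    moreover have "q y \<le> m y" for y
      using q m by (cases "y \<in> E") (auto simp: A_def)
    ultimately have "q = m" using min by blast
    then have "m (- x) \<le> - m x" using q(4) by simp
    moreover have "- m x \<le> m (- x)"
      using sublinear_on_ge_neg[OF sm E x subspace_0[OF E]]
        sublinear_on_ge_neg[OF sm E subspace_neg[OF E x] subspace_0[OF E]] sublinear_on_zero[OF sm E] by simp
    ultimately show ?thesis by simp
  qed
  have "m \<in> dominated E p"
    unfolding dominated_def
  proof (intro CollectI conjI ballI allI impI)
    fix x y assume xy: "x \<in> E" "y \<in> E"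
    have "m (x + y) \<le> m x + m y" using sm xy by (auto simp: sublinear_on_def)
    moreover have "m x + m y \<le> m (x + y)"
      using sublinear_on_ge_neg[OF sm E xy] neg[OF xy(1)] by simp
    ultimately show "m (x + y) = m x + m y" by simp
  next
    fix x c assume x: "x \<in> E"
    show "m (c *\<^sub>R x) = c * m x"
    proof (cases "c \<ge> 0")
      case True
      then show ?thesis using sm x by (auto simp: sublinear_on_def)
    next
      case False
      then have "m ((- c) *\<^sub>R x) = (- c) * m x"
        using sm x unfolding sublinear_on_def by (metis less_eq_real_def linorder_not_le neg_0_le_iff_le)
      moreover have "m (- ((- c) *\<^sub>R x)) = - m ((- c) *\<^sub>R x)"
        using x E by (intro neg) (auto intro: subspace_scale subspace_neg)
      ultimately show ?thesis by simp
    qed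
  qed (use m in \<open>auto simp: A_def\<close>)
  then show ?thesis using that by blast
qed

text \<open>Any functional below the minorant \<open>q\<close> satisfies
  \<open>L (- c) \<le> - \<epsilon>\<close>. This one form of Hahn-Banach yields a mean from a
  finitely additive measure, the functional in Day's argument, and the states that vanish on an
  ideal.\<close>

theorem dominated_separate:
  fixes E :: "'v::real_vector set"
  assumes E: "subspace E" and p: "sublinear_on E p"
    and C: "C \<subseteq> E" "convex C" "C \<noteq> {}" "\<And>c. c \<in> C \<Longrightarrow> \<epsilon> \<le> p c"
  obtains L where "L \<in> dominated E p" "\<And>c. c \<in> C \<Longrightarrow> \<epsilon> \<le> L c"
proof -
  obtain q where q: "sublinear_on E q" "\<And>x. x \<in> E \<Longrightarrow> q x \<le> p x"
      "\<And>c. c \<in> C \<Longrightarrow> q (- c) \<le> - \<epsilon>"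
    using sublinear_on_separate[OF E p C] by metis
  obtain L where L: "L \<in> dominated E q" using dominated_below_sublinear[OF E q(1)] .
  have "L \<in> dominated E p" using L q(2) by (fastforce simp: dominated_def)
  moreover have "\<epsilon> \<le> L c" if c: "c \<in> C" for c
  proof -
    have "c \<in> E" using c C by blast
    then have "L (- c) \<le> q (- c)" "L ((-1) *\<^sub>R c) = -1 * L c"
      using L subspace_neg[OF E] unfolding dominated_def by blast+
    then show ?thesis using q(3)[OF c] by simp
  qed
  ultimately show ?thesis using that by blast
qed

lemma dominatedD:
  assumes "L \<in> dominated E p"
  shows "\<And>x y. x \<in> E \<Longrightarrow> y \<in> E \<Longrightarrow> L (x + y) = L x + L y"
    and "\<And>x c. x \<in> E \<Longrightarrow> L (c *\<^sub>R x) = c * L x"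
    and "\<And>x. x \<in> E \<Longrightarrow> L x \<le> p x"
    and "\<And>x. x \<notin> E \<Longrightarrow> L x = 0"
  using assms by (auto simp: dominated_def)

lemma dominated_minus:
  assumes "L \<in> dominated E p" "subspace E" "x \<in> E"
  shows "L (- x) = - L x"
  using dominatedD(2)[OF assms(1,3), of "-1"] by simp

lemma dominated_diff:
  assumes "L \<in> dominated E p" "subspace E" "x \<in> E" "y \<in> E"
  shows "L (x - y) = L x - L y"
  using dominatedD(1)[OF assms(1,3), of "- y"] dominated_minus[OF assms(1,2,4)] assms subspace_neg
  by auto

lemma dominated_0: "L \<in> dominated E p \<Longrightarrow> subspace E \<Longrightarrow> L 0 = 0"
  using dominatedD(2)[of L E p 0 0] subspace_0 by auto

lemma dominated_sum:
  assumes "L \<in> dominated E p" "subspace E" "\<And>i. i \<in> I \<Longrightarrow> f i \<in> E"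
  shows "L (sum f I) = (\<Sum>i\<in>I. L (f i))"
  using assms(3)
proof (induction I rule: infinite_finite_induct)
  case (insert i I)
  then show ?case using dominatedD(1)[OF assms(1), of "f i" "sum f I"] subspace_sum[OF assms(2), of I f]
    by simp
qed (auto simp: dominated_0[OF assms(1,2)])

section \<open>Compactness, minimal closed sets and extreme points\<close>

lemma compact_PiE_real:
  fixes B :: "'i \<Rightarrow> real set"
  assumes "\<And>i. compact (B i)"
  shows "compact {f. \<forall>i. f i \<in> B i}"
proof -
  have "compactin (product_topology (\<lambda>i::'i. euclidean) UNIV) (PiE UNIV B)"
    using assms by (subst compactin_PiE) auto
  moreover have "PiE UNIV B = {f. \<forall>i. f i \<in> B i}" by auto
  ultimately show ?thesis by (simp add: euclidean_product_topology)
qed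

lemma continuous_on_eval: "continuous_on S (\<lambda>f :: 'i \<Rightarrow> 'b::topological_space. f i)"
  using continuous_on_product_then_coordinatewise[OF continuous_on_id] .

text \<open>Banach-Alaoglu: by Tychonoff the box with sides \<open>{- p (- x)..p x}\<close> is
  compact, and linearity and domination are closed conditions on coordinates.\<close>

lemma compact_dominated:
  assumes "subspace E"
  shows "compact (dominated E p)"
proof -
  define B where "B x = (if x \<in> E then {- p (- x)..p x} else {0})" for x
  have "compact {L. \<forall>x. L x \<in> B x}"
    by (rule compact_PiE_real) (auto simp: B_def)
  moreover have "closed (dominated E p)"
  proof -
    have "dominated E p = (\<Inter>x\<in>E. \<Inter>y\<in>E. {L. L (x + y) = L x + L y}) \<inter>
        (\<Inter>x\<in>E. \<Inter>c. {L. L (c *\<^sub>R x) = c * L x}) \<inter> (\<Inter>x\<in>E. {L. L x \<le> p x}) \<inter>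
        (\<Inter>x\<in>-E. {L. L x = 0})"
      by (auto simp: dominated_def)
    also have "closed \<dots>"
      by (intro closed_Int closed_INT ballI closed_Collect_eq closed_Collect_le continuous_on_add
          continuous_on_mult_left continuous_on_const continuous_on_eval)
    finally show ?thesis .
  qed
  moreover have "dominated E p \<subseteq> {L. \<forall>x. L x \<in> B x}"
  proof (intro subsetI CollectI allI)
    fix L x assume L: "L \<in> dominated E p"
    show "L x \<in> B x"
    proof (cases "x \<in> E")
      case True
      then show ?thesis
        using dominatedD(3)[OF L True] dominatedD(3)[OF L, of "- x"] dominated_minus[OF L assms True]
          subspace_neg[OF assms True] by (auto simp: B_def)
    qed (use dominatedD(4)[OF L] in \<open>auto simp: B_def\<close>)
  qed
  ultimately show ?thesis
    by (metis compact_Int_closed inf.absorb_iff2)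
qed

lemma convex_dominated: "convex (dominated E p)"
proof (rule convexI)
  fix x y and u v :: real
  assume L: "x \<in> dominated E p" "y \<in> dominated E p" and uv: "0 \<le> u" "0 \<le> v" "u + v = 1"
  have "u * x z + v * y z \<le> p z" if "z \<in> E" for z
    using convex_bound_le[OF dominatedD(3)[OF L(1) that] dominatedD(3)[OF L(2) that] uv] .
  then show "u *\<^sub>R x + v *\<^sub>R y \<in> dominated E p"
    using L by (auto simp: dominated_def algebra_simps)
qed

text \<open>Zorn's lemma downwards; a chain of nonempty closed sets has nonempty intersection
  because each finite subfamily contains its smallest member. \<open>Inv\<close> stays abstract
  since it will mean "face", "left ideal" and "conjugation invariant".\<close>

lemma minimal_compact_subset:
  fixes U :: "'t::t2_space set"
  assumes U: "compact U" "U \<noteq> {}" "Inv U"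
    and chain: "\<And>\<A>. \<A> \<noteq> {} \<Longrightarrow> (\<And>S. S \<in> \<A> \<Longrightarrow> closed S \<and> S \<subseteq> U \<and> S \<noteq> {} \<and> Inv S) \<Longrightarrow> Inv (\<Inter>\<A>)"
  obtains S where "closed S" "S \<subseteq> U" "S \<noteq> {}" "Inv S"
    "\<And>T. closed T \<Longrightarrow> T \<subseteq> S \<Longrightarrow> T \<noteq> {} \<Longrightarrow> Inv T \<Longrightarrow> T = S"
proof -
  define A where "A = {S. closed S \<and> S \<subseteq> U \<and> S \<noteq> {} \<and> Inv S}"
  have po: "partial_order_on A (relation_of (\<supseteq>) A)"
    by (rule partial_order_on_relation_ofI) auto
  have "\<exists>m\<in>A. \<forall>a\<in>A. a \<subseteq> m \<longrightarrow> a = m"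
  proof (rule predicate_Zorn[OF po])
    fix \<A> assume "\<A> \<in> Chains (relation_of (\<supseteq>) A)"
    then have CA: "\<A> \<subseteq> A" and ch: "\<And>S T. S \<in> \<A> \<Longrightarrow> T \<in> \<A> \<Longrightarrow> S \<subseteq> T \<or> T \<subseteq> S"
      unfolding Chains_def relation_of_def by auto
    show "\<exists>u\<in>A. \<forall>a\<in>\<A>. u \<subseteq> a"
    proof (cases "\<A> = {}")
      case True
      then show ?thesis using U compact_imp_closed by (auto simp: A_def)
    next
      case False
      have fin: "\<exists>S\<in>\<A>. S \<subseteq> \<Inter>\<F>" if "finite \<F>" "\<F> \<noteq> {}" "\<F> \<subseteq> \<A>" for \<F>
        using that
      proof (induction rule: finite_ne_induct)
        case (insert F \<F>)
        then obtain S where "S \<in> \<A>" "S \<subseteq> \<Inter>\<F>" by auto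
        then show ?case using ch[of F S] insert by (metis Inter_insert insert_subset inf.boundedI order_refl order_trans)
      qed auto
      have "\<Inter>\<A> \<noteq> {}"
      proof
        assume "\<Inter>\<A> = {}"
        have "U \<inter> \<Inter>\<A> \<noteq> {}"
        proof (rule compact_imp_fip[OF U(1)])
          show "closed T" if "T \<in> \<A>" for T using that CA by (auto simp: A_def)
          fix \<F> assume F: "finite \<F>" "\<F> \<subseteq> \<A>"
          show "U \<inter> \<Inter>\<F> \<noteq> {}"
          proof (cases "\<F> = {}")
            case False
            from fin[OF F(1) False F(2)] obtain S where S: "S \<in> \<A>" "S \<subseteq> \<Inter>\<F>" by blast
            then have "S \<subseteq> U" "S \<noteq> {}" using CA by (auto simp: A_def)
            with S show ?thesis by blast
          qed (use U in auto)
        qed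
        then show False using \<open>\<Inter>\<A> = {}\<close> by simp
      qed
      moreover have "Inv (\<Inter>\<A>)" using CA by (intro chain False) (auto simp: A_def)
      moreover have "closed (\<Inter>\<A>)" using CA by (intro closed_Inter) (auto simp: A_def)
      moreover have "\<Inter>\<A> \<subseteq> U" using False CA by (auto simp: A_def)
      ultimately show ?thesis by (intro bexI[of _ "\<Inter>\<A>"]) (auto simp: A_def)
    qed
  qed
  then obtain m where m: "m \<in> A" and min: "\<And>a. a \<in> A \<Longrightarrow> a \<subseteq> m \<Longrightarrow> a = m" by blast
  show ?thesis
  proof (rule that[of m])
    show "T = m" if "closed T" "T \<subseteq> m" "T \<noteq> {}" "Inv T" for T
      using that m by (intro min) (auto simp: A_def)
  qed (use m in \<open>auto simp: A_def\<close>)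
qed

text \<open>The argument of Krein-Milman: inside a minimal closed face, the points that maximise one
  coordinate form a closed face again. So every coordinate is constant on it and the face is a
  single point.\<close>

lemma extreme_point_exists:
  fixes Q :: "('i \<Rightarrow> real) set"
  assumes Q: "compact Q" "Q \<noteq> {}"
  obtains w where "w \<in> Q"
    "\<And>x y t. x \<in> Q \<Longrightarrow> y \<in> Q \<Longrightarrow> 0 < t \<Longrightarrow> t < 1 \<Longrightarrow> w = t *\<^sub>R x + (1 - t) *\<^sub>R y \<Longrightarrow> x = w \<and> y = w"
proof -
  define Inv where "Inv S \<longleftrightarrow> (\<forall>x\<in>Q. \<forall>y\<in>Q. \<forall>t. 0 < t \<longrightarrow> t < 1 \<longrightarrow> t *\<^sub>R x + (1 - t) *\<^sub>R y \<in> S \<longrightarrow> x \<in> S \<and> y \<in> S)"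
    for S
  obtain S where S: "closed S" "S \<subseteq> Q" "S \<noteq> {}" "Inv S"
    and min: "\<And>T. closed T \<Longrightarrow> T \<subseteq> S \<Longrightarrow> T \<noteq> {} \<Longrightarrow> Inv T \<Longrightarrow> T = S"
  proof (rule minimal_compact_subset[of Q Inv])
    show "Inv Q" by (auto simp: Inv_def)
    show "Inv (\<Inter>\<A>)" if "\<A> \<noteq> {}" "\<And>S. S \<in> \<A> \<Longrightarrow> closed S \<and> S \<subseteq> Q \<and> S \<noteq> {} \<and> Inv S" for \<A>
      using that unfolding Inv_def by blast
  qed (use Q in auto)
  have cS: "compact S" using Q S by (metis compact_Int_closed inf.absorb_iff2)
  obtain w where w: "w \<in> S" using S by blast
  have "v = w" if v: "v \<in> S" for v
  proof
    fix i
    have "continuous_on S (\<lambda>f. f i)" by (rule continuous_on_eval)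
    from continuous_attains_sup[OF cS S(3) this] obtain z where z: "z \<in> S" "\<And>y. y \<in> S \<Longrightarrow> y i \<le> z i"
      by blast
    define T where "T = {y \<in> S. y i = z i}"
    have "closed T"
    proof -
      have "T = S \<inter> {y. y i = z i}" by (auto simp: T_def)
      moreover have "closed {y. y i = z i}"
        by (intro closed_Collect_eq continuous_on_eval continuous_on_const)
      ultimately show ?thesis using S(1) by auto
    qed
    moreover have "Inv T"
      unfolding Inv_def
    proof (intro ballI allI impI)
      fix x y t assume xy: "x \<in> Q" "y \<in> Q" "0 < (t::real)" "t < 1" "t *\<^sub>R x + (1 - t) *\<^sub>R y \<in> T"
      then have xyS: "x \<in> S" "y \<in> S" using S(4) unfolding Inv_def T_def by blast+
      have eq: "t * x i + (1 - t) * y i = z i" using xy(5) by (simp add: T_def)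
      have le: "x i \<le> z i" "y i \<le> z i" using z xyS by auto
      have "t * x i \<le> t * z i" "(1 - t) * y i \<le> (1 - t) * z i"
        using le xy by (auto intro: mult_left_mono)
      moreover have "t * z i + (1 - t) * z i = z i" by (simp add: algebra_simps)
      ultimately have "t * x i = t * z i" "(1 - t) * y i = (1 - t) * z i"
        using eq by linarith+
      then have "x i = z i" "y i = z i" using xy by auto
      then show "x \<in> T \<and> y \<in> T" using xyS by (auto simp: T_def)
    qed
    ultimately have "T = S" using min[of T] z by (auto simp: T_def)
    then show "v i = w i" using v w unfolding T_def by (metis (mono_tags, lifting) mem_Collect_eq)
  qed
  then have "S = {w}" using w by blast
  then show ?thesis using that[of w] S unfolding Inv_def by (metis insertI1 singletonD subsetD)
qed

section \<open>Bounded operators on square-summable functions\<close>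

text \<open>The summands are nonnegative, so a uniform bound on finite subsets controls both
  summability and the norm. Inequalities in \<open>l2\<close> are thereby reduced to those for
  \<open>L2_set\<close>.\<close>

lemma l2I:
  assumes "\<And>x. x \<notin> carrier G \<Longrightarrow> f x = 0"
    and "\<And>F. finite F \<Longrightarrow> F \<subseteq> carrier G \<Longrightarrow> L2_set (\<lambda>x. cmod (f x)) F \<le> c"
  shows "f \<in> l2 G" and "l2norm G f \<le> c"
proof -
  have c: "0 \<le> c" using assms(2)[of "{}"] by simp
  have le: "(\<Sum>x\<in>F. (cmod (f x))\<^sup>2) \<le> c\<^sup>2" if "finite F" "F \<subseteq> carrier G" for F
    using assms(2)[OF that] c unfolding L2_set_def by (metis real_sqrt_le_iff real_sqrt_unique)
  have "(\<lambda>x. (cmod (f x))\<^sup>2) summable_on carrier G"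
    by (rule nonneg_bdd_above_summable_on) (auto simp: bdd_above_def intro!: exI[of _ "c\<^sup>2"] le)
  then show "f \<in> l2 G" using assms(1) by (auto simp: l2_def)
  have "(\<Sum>\<^sub>\<infinity>x\<in>carrier G. (cmod (f x))\<^sup>2) \<le> c\<^sup>2"
    by (rule infsum_le_finite_sums[OF \<open>_ summable_on _\<close>]) (use le in auto)
  then show "l2norm G f \<le> c"
    unfolding l2norm_def using c by (metis real_sqrt_le_iff real_sqrt_unique)
qed

lemma l2_outside: "f \<in> l2 G \<Longrightarrow> x \<notin> carrier G \<Longrightarrow> f x = 0"
  by (auto simp: l2_def)

lemma l2_summable: "f \<in> l2 G \<Longrightarrow> (\<lambda>x. (cmod (f x))\<^sup>2) summable_on carrier G"
  by (auto simp: l2_def)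

lemma L2_set_le_l2norm:
  assumes "f \<in> l2 G" "finite F" "F \<subseteq> carrier G"
  shows "L2_set (\<lambda>x. cmod (f x)) F \<le> l2norm G f"
  unfolding L2_set_def l2norm_def
  by (intro real_sqrt_le_mono finite_sum_le_infsum l2_summable assms) auto

lemma l2norm_nonneg [simp]: "0 \<le> l2norm G f"
  by (simp add: l2norm_def infsum_nonneg)

lemma l2norm_power2: "(l2norm G f)\<^sup>2 = (\<Sum>\<^sub>\<infinity>x\<in>carrier G. (cmod (f x))\<^sup>2)"
  by (simp add: l2norm_def infsum_nonneg)

lemma cmod_le_l2norm:
  assumes "f \<in> l2 G"
  shows "cmod (f x) \<le> l2norm G f"
proof (cases "x \<in> carrier G")
  case True
  then show ?thesis using L2_set_le_l2norm[OF assms, of "{x}"] by simp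
qed (simp add: l2_outside[OF assms])

lemma
  assumes "f \<in> l2 G" "h \<in> l2 G"
  shows l2_add: "(\<lambda>x. f x + h x) \<in> l2 G"
    and l2norm_triangle: "l2norm G (\<lambda>x. f x + h x) \<le> l2norm G f + l2norm G h"
proof -
  have "L2_set (\<lambda>x. cmod (f x + h x)) F \<le> l2norm G f + l2norm G h"
    if F: "finite F" "F \<subseteq> carrier G" for F
  proof -
    have "L2_set (\<lambda>x. cmod (f x + h x)) F \<le> L2_set (\<lambda>x. cmod (f x) + cmod (h x)) F"
      by (intro L2_set_mono norm_triangle_ineq) auto
    also have "\<dots> \<le> L2_set (\<lambda>x. cmod (f x)) F + L2_set (\<lambda>x. cmod (h x)) F"
      by (rule L2_set_triangle_ineq)
    finally show ?thesis using L2_set_le_l2norm[OF assms(1) F] L2_set_le_l2norm[OF assms(2) F] by simp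
  qed
  from l2I[of G "\<lambda>x. f x + h x", OF _ this]
  show "(\<lambda>x. f x + h x) \<in> l2 G" "l2norm G (\<lambda>x. f x + h x) \<le> l2norm G f + l2norm G h"
    using assms by (auto simp: l2_outside)
qed

lemma l2norm_scale: "l2norm G (\<lambda>x. a * f x) = cmod a * l2norm G f"
proof -
  have "(\<Sum>\<^sub>\<infinity>x\<in>carrier G. (cmod (a * f x))\<^sup>2) = (cmod a)\<^sup>2 * (\<Sum>\<^sub>\<infinity>x\<in>carrier G. (cmod (f x))\<^sup>2)"
    by (simp add: norm_mult power_mult_distrib infsum_cmult_right')
  then show ?thesis by (simp add: l2norm_def real_sqrt_mult)
qed

lemma l2_scale: "f \<in> l2 G \<Longrightarrow> (\<lambda>x. a * f x) \<in> l2 G"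
  by (auto simp: l2_def norm_mult power_mult_distrib intro!: summable_on_cmult_right)

lemma l2_zero [simp]: "(\<lambda>_. 0) \<in> l2 G" and l2norm_zero [simp]: "l2norm G (\<lambda>_. 0) = 0"
  by (auto simp: l2_def l2norm_def)

lemma l2_uminus: "f \<in> l2 G \<Longrightarrow> (\<lambda>x. - f x) \<in> l2 G"
  using l2_scale[of f G "-1"] by simp

lemma l2_diff: "f \<in> l2 G \<Longrightarrow> h \<in> l2 G \<Longrightarrow> (\<lambda>x. f x - h x) \<in> l2 G"
  using l2_add[OF _ l2_uminus, of f G h] by simp

lemma l2_restrict: "f \<in> l2 G \<Longrightarrow> (\<lambda>x. if x \<in> A then f x else 0) \<in> l2 G"
  by (rule l2I(1)[where c="l2norm G f"])
    (auto simp: l2_outside intro!: order_trans[OF L2_set_mono L2_set_le_l2norm])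

lemma l2norm_zero_iff:
  assumes "f \<in> l2 G" "l2norm G f = 0"
  shows "f = (\<lambda>_. 0)"
  using cmod_le_l2norm[OF assms(1)] assms(2) by (auto simp: fun_eq_iff)

lemma l2_finite_support:
  assumes "finite F" "F \<subseteq> carrier G" "\<And>x. x \<notin> F \<Longrightarrow> f x = 0"
  shows "f \<in> l2 G" "(l2norm G f)\<^sup>2 = (\<Sum>x\<in>F. (cmod (f x))\<^sup>2)"
proof -
  have "(\<lambda>x. (cmod (f x))\<^sup>2) summable_on F" using assms(1) by simp
  then have "(\<lambda>x. (cmod (f x))\<^sup>2) summable_on carrier G"
    by (rule summable_on_cong_neutral[THEN iffD1, rotated -1]) (use assms in auto)
  then show "f \<in> l2 G" using assms by (auto simp: l2_def)
  have "(\<Sum>\<^sub>\<infinity>x\<in>carrier G. (cmod (f x))\<^sup>2) = (\<Sum>\<^sub>\<infinity>x\<in>F. (cmod (f x))\<^sup>2)"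
    by (rule infsum_cong_neutral) (use assms in auto)
  then show "(l2norm G f)\<^sup>2 = (\<Sum>x\<in>F. (cmod (f x))\<^sup>2)"
    using assms(1) by (simp add: l2norm_power2)
qed

definition delta :: "'a \<Rightarrow> 'a \<Rightarrow> complex" where
  "delta x = (\<lambda>y. if y = x then 1 else 0)"

lemma delta_l2: "x \<in> carrier G \<Longrightarrow> delta x \<in> l2 G"
  and l2norm_delta: "x \<in> carrier G \<Longrightarrow> l2norm G (delta x) = 1"
  using l2_finite_support[of "{x}" G "delta x"]
  by (auto simp: delta_def power2_eq_1_iff) (smt (verit) l2norm_nonneg)

lemma l2norm_split:
  assumes "f \<in> l2 G"
  shows "(l2norm G f)\<^sup>2 = (l2norm G (\<lambda>x. if x \<in> A then f x else 0))\<^sup>2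
    + (l2norm G (\<lambda>x. if x \<in> A then 0 else f x))\<^sup>2"
proof -
  have s: "(\<lambda>x. (cmod (if x \<in> A then f x else 0))\<^sup>2) summable_on carrier G"
       "(\<lambda>x. (cmod (if x \<in> - A then f x else 0))\<^sup>2) summable_on carrier G"
    using l2_summable[OF l2_restrict[OF assms, of A]] l2_summable[OF l2_restrict[OF assms, of "- A"]] by auto
  have "(\<Sum>\<^sub>\<infinity>x\<in>carrier G. (cmod (f x))\<^sup>2) = (\<Sum>\<^sub>\<infinity>x\<in>carrier G.
      (cmod (if x \<in> A then f x else 0))\<^sup>2 + (cmod (if x \<in> - A then f x else 0))\<^sup>2)"
    by (rule infsum_cong) auto
  also have "\<dots> = (\<Sum>\<^sub>\<infinity>x\<in>carrier G. (cmod (if x \<in> A then f x else 0))\<^sup>2) +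
      (\<Sum>\<^sub>\<infinity>x\<in>carrier G. (cmod (if x \<in> - A then f x else 0))\<^sup>2)"
    by (rule infsum_add[OF s])
  also have "(\<lambda>x. if x \<in> - A then f x else 0) = (\<lambda>x. if x \<in> A then 0 else f x)" by auto
  finally show ?thesis unfolding l2norm_power2 by simp
qed

lemma l2_tail:
  assumes f: "f \<in> l2 G" and e: "\<epsilon> > 0"
  obtains F where "finite F" "F \<subseteq> carrier G" "l2norm G (\<lambda>x. if x \<in> F then 0 else f x) < \<epsilon>"
proof -
  \<comment> \<open>The approximation is only within \<open>\<le>\<close>; asking for half of the
    square leaves room for the strict bound.\<close>
  obtain F where F: "finite F" "F \<subseteq> carrier G"
    "dist (\<Sum>x\<in>F. (cmod (f x))\<^sup>2) (\<Sum>\<^sub>\<infinity>x\<in>carrier G. (cmod (f x))\<^sup>2) \<le> \<epsilon>\<^sup>2 / 2"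
    using infsum_finite_approximation[OF l2_summable[OF f], of "\<epsilon>\<^sup>2 / 2"] e by auto
  have "(l2norm G (\<lambda>x. if x \<in> F then f x else 0))\<^sup>2 = (\<Sum>x\<in>F. (cmod (f x))\<^sup>2)"
    using l2_finite_support(2)[OF F(1,2), of "\<lambda>x. if x \<in> F then f x else 0"] by simp
  with F(3) l2norm_split[OF f, of F] have "(l2norm G (\<lambda>x. if x \<in> F then 0 else f x))\<^sup>2 \<le> \<epsilon>\<^sup>2 / 2"
    by (simp add: l2norm_power2 dist_real_def)
  also have "\<dots> < \<epsilon>\<^sup>2" using e by simp
  finally have "l2norm G (\<lambda>x. if x \<in> F then 0 else f x) < \<epsilon>"
    using e by (simp add: power_less_imp_less_base less_imp_le)
  with F that show ?thesis by blast
qed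

section \<open>Bounded operators and the operator norm\<close>

lemma bounded_ops_l2: "T \<in> bounded_ops G \<Longrightarrow> f \<in> l2 G \<Longrightarrow> T f \<in> l2 G"
  and bounded_ops_outside: "T \<in> bounded_ops G \<Longrightarrow> f \<notin> l2 G \<Longrightarrow> T f = (\<lambda>_. 0)"
  and bounded_ops_linear: "T \<in> bounded_ops G \<Longrightarrow> f \<in> l2 G \<Longrightarrow> h \<in> l2 G \<Longrightarrow>
    T (\<lambda>x. a * f x + h x) = (\<lambda>x. a * T f x + T h x)"
  by (auto simp: bounded_ops_def)

lemma bounded_ops_add:
  "T \<in> bounded_ops G \<Longrightarrow> f \<in> l2 G \<Longrightarrow> h \<in> l2 G \<Longrightarrow> T (\<lambda>x. f x + h x) = (\<lambda>x. T f x + T h x)"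
  using bounded_ops_linear[of T G f h 1] by simp

lemma bounded_ops_zero: "T \<in> bounded_ops G \<Longrightarrow> T (\<lambda>_. 0) = (\<lambda>_. 0)"
  using bounded_ops_add[of T G "\<lambda>_. 0" "\<lambda>_. 0"] by (simp add: fun_eq_iff)

lemma bounded_ops_scale:
  "T \<in> bounded_ops G \<Longrightarrow> f \<in> l2 G \<Longrightarrow> T (\<lambda>x. a * f x) = (\<lambda>x. a * T f x)"
  using bounded_ops_linear[of T G f "\<lambda>_. 0" a] by (simp add: bounded_ops_zero)

lemma bounded_ops_diff:
  "T \<in> bounded_ops G \<Longrightarrow> f \<in> l2 G \<Longrightarrow> h \<in> l2 G \<Longrightarrow> T (\<lambda>x. f x - h x) = (\<lambda>x. T f x - T h x)"
  using bounded_ops_linear[of T G h f "-1"] by (simp add: algebra_simps)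

text \<open>\<open>opnorm\<close> is a supremum of reals and carries information only for sets
  bounded above. For this reason membership in \<open>bounded_ops\<close> accompanies nearly every
  later norm estimate.\<close>

lemma bdd_above_opnorm:
  assumes "T \<in> bounded_ops G"
  shows "bdd_above {l2norm G (T f) |f. f \<in> l2 G \<and> l2norm G f \<le> 1}"
proof -
  obtain K where K: "\<And>f. f \<in> l2 G \<Longrightarrow> l2norm G (T f) \<le> K * l2norm G f"
    using assms unfolding bounded_ops_def by blast
  have "l2norm G (T f) \<le> \<bar>K\<bar>" if "f \<in> l2 G" "l2norm G f \<le> 1" for f
  proof -
    have "K * l2norm G f \<le> \<bar>K\<bar> * 1" using that by (intro mult_mono) auto
    with K[OF that(1)] show ?thesis by simp
  qed
  then show ?thesis by (auto simp: bdd_above_def)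
qed

lemma opnorm_bound:
  assumes T: "T \<in> bounded_ops G" and f: "f \<in> l2 G"
  shows "l2norm G (T f) \<le> opnorm G T * l2norm G f"
proof (cases "l2norm G f = 0")
  case True
  with l2norm_zero_iff[OF f] bounded_ops_zero[OF T] show ?thesis by simp
next
  case False
  define c where "c = complex_of_real (1 / l2norm G f)"
  have c: "cmod c = 1 / l2norm G f" by (simp add: c_def norm_divide)
  have "l2norm G (T (\<lambda>x. c * f x)) \<le> opnorm G T"
    unfolding opnorm_def
    by (intro cSup_upper bdd_above_opnorm[OF T])
      (use False c in \<open>auto simp: l2norm_scale intro!: exI[of _ "\<lambda>x. c * f x"] l2_scale f\<close>)
  then show ?thesis
    using False by (simp add: bounded_ops_scale[OF T f] l2norm_scale c field_simps less_le)
qed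

lemma opnorm_leI:
  assumes "\<And>f. f \<in> l2 G \<Longrightarrow> l2norm G (T f) \<le> K * l2norm G f" "0 \<le> K"
  shows "opnorm G T \<le> K"
  unfolding opnorm_def
proof (rule cSup_least)
  show "{l2norm G (T f) |f. f \<in> l2 G \<and> l2norm G f \<le> 1} \<noteq> {}"
    by (auto intro!: exI[of _ "\<lambda>_. 0"])
  fix v assume "v \<in> {l2norm G (T f) |f. f \<in> l2 G \<and> l2norm G f \<le> 1}"
  then obtain f where f: "v = l2norm G (T f)" "f \<in> l2 G" "l2norm G f \<le> 1" by blast
  have "K * l2norm G f \<le> K * 1" using f assms by (intro mult_left_mono) auto
  with assms(1)[OF f(2)] f(1) show "v \<le> K" by simp
qed

lemma opnorm_nonneg: "T \<in> bounded_ops G \<Longrightarrow> 0 \<le> opnorm G T"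
  unfolding opnorm_def
  by (intro order_trans[OF l2norm_nonneg[of G "T (\<lambda>_. 0)"]] cSup_upper bdd_above_opnorm)
    (auto intro!: exI[of _ "\<lambda>_. 0"])

lemma bounded_opsI:
  assumes "\<And>f. f \<in> l2 G \<Longrightarrow> T f \<in> l2 G"
    and "\<And>f. f \<notin> l2 G \<Longrightarrow> T f = (\<lambda>_. 0)"
    and "\<And>f h a x. f \<in> l2 G \<Longrightarrow> h \<in> l2 G \<Longrightarrow> T (\<lambda>x. a * f x + h x) x = a * T f x + T h x"
    and "\<And>f. f \<in> l2 G \<Longrightarrow> l2norm G (T f) \<le> K * l2norm G f"
  shows "T \<in> bounded_ops G"
  unfolding bounded_ops_def
  by (intro CollectI conjI exI[of _ K] ballI allI impI ext assms)

lemma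
  assumes S: "S \<in> bounded_ops G" and T: "T \<in> bounded_ops G"
  shows bounded_ops_plus: "(\<lambda>f x. S f x + T f x) \<in> bounded_ops G"
    and opnorm_triangle: "opnorm G (\<lambda>f x. S f x + T f x) \<le> opnorm G S + opnorm G T"
proof -
  have b: "l2norm G (\<lambda>x. S f x + T f x) \<le> (opnorm G S + opnorm G T) * l2norm G f" if f: "f \<in> l2 G" for f
    using l2norm_triangle[OF bounded_ops_l2[OF S f] bounded_ops_l2[OF T f]]
      opnorm_bound[OF S f] opnorm_bound[OF T f] by (simp add: algebra_simps)
  show "(\<lambda>f x. S f x + T f x) \<in> bounded_ops G"
    by (rule bounded_opsI[OF _ _ _ b])
      (use S T in \<open>auto simp: bounded_ops_l2 bounded_ops_outside bounded_ops_linear l2_add ring_distribs\<close>)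
  show "opnorm G (\<lambda>f x. S f x + T f x) \<le> opnorm G S + opnorm G T"
    by (rule opnorm_leI[OF b]) (use S T in \<open>auto simp: opnorm_nonneg\<close>)
qed

lemma
  assumes T: "T \<in> bounded_ops G"
  shows bounded_ops_cscale: "(\<lambda>f x. a * T f x) \<in> bounded_ops G"
    and opnorm_cscale_le: "opnorm G (\<lambda>f x. a * T f x) \<le> cmod a * opnorm G T"
proof -
  have b: "l2norm G (\<lambda>x. a * T f x) \<le> (cmod a * opnorm G T) * l2norm G f" if f: "f \<in> l2 G" for f
    using mult_left_mono[OF opnorm_bound[OF T f], of "cmod a"] by (simp add: l2norm_scale mult.assoc)
  show "(\<lambda>f x. a * T f x) \<in> bounded_ops G"
    by (rule bounded_opsI[OF _ _ _ b])
      (use T in \<open>auto simp: bounded_ops_l2 bounded_ops_outside bounded_ops_linear l2_scale ring_distribs\<close>)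
  show "opnorm G (\<lambda>f x. a * T f x) \<le> cmod a * opnorm G T"
    by (rule opnorm_leI[OF b]) (use T in \<open>auto simp: opnorm_nonneg\<close>)
qed

lemma
  assumes S: "S \<in> bounded_ops G" and T: "T \<in> bounded_ops G"
  shows bounded_ops_compose: "S \<circ> T \<in> bounded_ops G"
    and opnorm_compose: "opnorm G (S \<circ> T) \<le> opnorm G S * opnorm G T"
proof -
  have b: "l2norm G ((S \<circ> T) f) \<le> (opnorm G S * opnorm G T) * l2norm G f" if f: "f \<in> l2 G" for f
    using order_trans[OF opnorm_bound[OF S bounded_ops_l2[OF T f]]
        mult_left_mono[OF opnorm_bound[OF T f] opnorm_nonneg[OF S]]] by (simp add: mult.assoc)
  show "S \<circ> T \<in> bounded_ops G"
    by (rule bounded_opsI[OF _ _ _ b])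
      (use S T in \<open>auto simp: bounded_ops_l2 bounded_ops_outside bounded_ops_zero bounded_ops_linear\<close>)
  show "opnorm G (S \<circ> T) \<le> opnorm G S * opnorm G T"
    by (rule opnorm_leI[OF b]) (use S T in \<open>auto simp: opnorm_nonneg\<close>)
qed

lemma bounded_ops_0: "(\<lambda>_ _. 0) \<in> bounded_ops G" and opnorm_0: "opnorm G (\<lambda>_ _. 0) = 0"
proof -
  show *: "(\<lambda>_ _. 0) \<in> bounded_ops G" by (rule bounded_opsI[where K=0]) auto
  show "opnorm G (\<lambda>_ _. 0) = 0"
    using opnorm_leI[of G "\<lambda>_ _. 0" 0] opnorm_nonneg[OF *] by simp
qed

lemma bounded_ops_minus:
  assumes "S \<in> bounded_ops G" "T \<in> bounded_ops G"
  shows "(\<lambda>f x. S f x - T f x) \<in> bounded_ops G"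
  using bounded_ops_plus[OF assms(1) bounded_ops_cscale[OF assms(2), of "-1"]] by simp

text \<open>Ideals are defined with operations written out pointwise, Hahn-Banach is stated in a
  real vector space. These equations pass between the two; complex multiples remain explicit
  functions.\<close>

lemma scaleR_op: "r *\<^sub>R (T :: 'a op) = (\<lambda>f x. complex_of_real r * T f x)"
  by (simp add: fun_eq_iff scaleR_conv_of_real)

lemma plus_op: "(S :: 'a op) + T = (\<lambda>f x. S f x + T f x)"
  by (simp add: fun_eq_iff)

lemma minus_op: "(S :: 'a op) - T = (\<lambda>f x. S f x - T f x)"
  by (simp add: fun_eq_iff)

lemma zero_op: "(0 :: 'a op) = (\<lambda>_ _. 0)"
  by (simp add: fun_eq_iff)

lemma subspace_bounded_ops: "subspace (bounded_ops G)"
  unfolding subspace_def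
  by (auto simp: zero_op plus_op scaleR_op bounded_ops_0 bounded_ops_plus bounded_ops_cscale)

lemma sublinear_opnorm: "sublinear_on (bounded_ops G) (opnorm G)"
proof (rule sublinear_onI[OF subspace_bounded_ops])
  fix T :: "'a op" and c :: real assume "T \<in> bounded_ops G" "c > 0"
  then show "opnorm G (c *\<^sub>R T) \<le> c * opnorm G T"
    using opnorm_cscale_le[of T G "of_real c"] by (simp add: scaleR_op)
qed (auto simp: zero_op plus_op opnorm_0 opnorm_triangle)

section \<open>The reduced group algebra\<close>

text \<open>The diagonal copy of the bounded functions inside the bounded operators. Like all
  operators here it is extended by zero outside \<open>l2 G\<close>.\<close>

definition mult_op :: "('a, 'b) monoid_scheme \<Rightarrow> ('a \<Rightarrow> real) \<Rightarrow> 'a op" where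
  "mult_op G \<phi> f = (if f \<in> l2 G then (\<lambda>x. complex_of_real (\<phi> x) * f x) else (\<lambda>_. 0))"

text \<open>Values off the carrier are arbitrary; \<open>mean_cong\<close> shows that means do not
  see them.\<close>

definition bdd_fun :: "('a, 'b) monoid_scheme \<Rightarrow> ('a \<Rightarrow> real) set" where
  "bdd_fun G = {\<phi>. \<exists>c. \<forall>x\<in>carrier G. \<bar>\<phi> x\<bar> \<le> c}"

lemma bdd_funI: "(\<And>x. x \<in> carrier G \<Longrightarrow> \<bar>\<phi> x\<bar> \<le> c) \<Longrightarrow> \<phi> \<in> bdd_fun G"
  by (auto simp: bdd_fun_def)

lemma bdd_funE:
  assumes "\<phi> \<in> bdd_fun G"
  obtains c where "0 \<le> c" "\<And>x. x \<in> carrier G \<Longrightarrow> \<bar>\<phi> x\<bar> \<le> c"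
proof -
  obtain c where c: "\<And>x. x \<in> carrier G \<Longrightarrow> \<bar>\<phi> x\<bar> \<le> c"
    using assms by (auto simp: bdd_fun_def)
  show ?thesis by (rule that[of "max c 0"]) (auto intro: order_trans[OF c])
qed

lemma mult_op_bound:
  assumes c: "0 \<le> c" "\<And>x. x \<in> carrier G \<Longrightarrow> \<bar>\<phi> x\<bar> \<le> c" and f: "f \<in> l2 G"
  shows "mult_op G \<phi> f \<in> l2 G" "l2norm G (mult_op G \<phi> f) \<le> c * l2norm G f"
proof -
  have b: "L2_set (\<lambda>x. cmod (complex_of_real (\<phi> x) * f x)) F \<le> c * l2norm G f"
    if F: "finite F" "F \<subseteq> carrier G" for F
  proof -
    have "L2_set (\<lambda>x. cmod (complex_of_real (\<phi> x) * f x)) F \<le> L2_set (\<lambda>x. c * cmod (f x)) F"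
      using c F by (intro L2_set_mono) (auto simp: norm_mult intro!: mult_right_mono)
    also have "\<dots> = c * L2_set (\<lambda>x. cmod (f x)) F"
      using c by (simp add: L2_set_right_distrib)
    also have "\<dots> \<le> c * l2norm G f"
      using c by (intro mult_left_mono L2_set_le_l2norm f F)
    finally show ?thesis .
  qed
  from l2I[of G "\<lambda>x. complex_of_real (\<phi> x) * f x", OF _ b] f
  show "mult_op G \<phi> f \<in> l2 G" "l2norm G (mult_op G \<phi> f) \<le> c * l2norm G f"
    by (auto simp: mult_op_def l2_outside)
qed

lemma mult_op_bounded: "\<phi> \<in> bdd_fun G \<Longrightarrow> mult_op G \<phi> \<in> bounded_ops G"
proof (erule bdd_funE)
  fix c assume c: "0 \<le> c" "\<And>x. x \<in> carrier G \<Longrightarrow> \<bar>\<phi> x\<bar> \<le> c"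
  show ?thesis
    by (rule bounded_opsI[OF mult_op_bound(1)[OF c] _ _ mult_op_bound(2)[OF c]])
      (auto simp: mult_op_def l2_add l2_scale ring_distribs)
qed

lemma opnorm_mult_op_le:
  "0 \<le> c \<Longrightarrow> (\<And>x. x \<in> carrier G \<Longrightarrow> \<bar>\<phi> x\<bar> \<le> c) \<Longrightarrow> opnorm G (mult_op G \<phi>) \<le> c"
  by (rule opnorm_leI[OF mult_op_bound(2)]) auto

lemma mult_op_plus: "mult_op G (\<lambda>x. \<phi> x + \<psi> x) = mult_op G \<phi> + mult_op G \<psi>"
  by (auto simp: mult_op_def fun_eq_iff ring_distribs)

lemma mult_op_scaleR: "mult_op G (\<lambda>x. c * \<phi> x) = c *\<^sub>R mult_op G \<phi>"
  by (auto simp: mult_op_def fun_eq_iff scaleR_conv_of_real)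

context group
begin

section \<open>The left regular representation\<close>

lemma left_reg_l2:
  assumes g: "g \<in> carrier G" and f: "f \<in> l2 G"
  shows "left_reg G g f \<in> l2 G" "l2norm G (left_reg G g f) \<le> l2norm G f"
proof -
  have b: "L2_set (\<lambda>x. cmod (left_reg G g f x)) F \<le> l2norm G f"
    if F: "finite F" "F \<subseteq> carrier G" for F
  proof -
    have inj: "inj_on (\<lambda>x. inv g \<otimes> x) F"
      using g F(2) by (intro inj_onI) (metis inv_closed l_cancel subsetD)
    have "L2_set (\<lambda>x. cmod (left_reg G g f x)) F = L2_set (\<lambda>x. cmod (f x)) ((\<lambda>x. inv g \<otimes> x) ` F)"
      unfolding L2_set_def using F f by (subst sum.reindex[OF inj]) (auto simp: left_reg_def subset_iff)
    also have "\<dots> \<le> l2norm G f"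
      using F g by (intro L2_set_le_l2norm f) auto
    finally show ?thesis .
  qed
  from l2I[of G "left_reg G g f", OF _ b] f show "left_reg G g f \<in> l2 G" "l2norm G (left_reg G g f) \<le> l2norm G f"
    by (auto simp: left_reg_def)
qed

lemma left_reg_apply:
  "f \<in> l2 G \<Longrightarrow> x \<in> carrier G \<Longrightarrow> left_reg G g f x = f (inv g \<otimes> x)"
  by (simp add: left_reg_def)

lemma left_reg_bounded: "g \<in> carrier G \<Longrightarrow> left_reg G g \<in> bounded_ops G"
  using left_reg_l2 by (intro bounded_opsI[where K=1]) (auto simp: left_reg_def l2_add l2_scale)

lemma opnorm_left_reg_le: "g \<in> carrier G \<Longrightarrow> opnorm G (left_reg G g) \<le> 1"
  using left_reg_l2 by (intro opnorm_leI) auto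

lemma left_reg_mult:
  assumes "g \<in> carrier G" "h \<in> carrier G"
  shows "left_reg G g \<circ> left_reg G h = left_reg G (g \<otimes> h)"
proof (intro ext)
  fix f x
  show "(left_reg G g \<circ> left_reg G h) f x = left_reg G (g \<otimes> h) f x"
  proof (cases "f \<in> l2 G \<and> x \<in> carrier G")
    case True
    then have "left_reg G h f \<in> l2 G" using left_reg_l2 assms by blast
    with True assms show ?thesis
      by (simp add: left_reg_apply inv_mult_group m_assoc)
  next
    case False
    then show ?thesis by (auto simp: left_reg_def)
  qed
qed

lemma left_reg_one: "f \<in> l2 G \<Longrightarrow> left_reg G \<one> f = f"
  by (auto simp: left_reg_def fun_eq_iff l2_outside)

lemma compose_left_reg_one:
  assumes "T \<in> bounded_ops G"
  shows "T \<circ> left_reg G \<one> = T" "left_reg G \<one> \<circ> T = T"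
proof -
  show "T \<circ> left_reg G \<one> = T"
  proof
    fix f show "(T \<circ> left_reg G \<one>) f = T f"
      using bounded_ops_zero[OF assms] bounded_ops_outside[OF assms]
      by (cases "f \<in> l2 G") (auto simp: left_reg_one, simp add: left_reg_def)
  qed
  show "left_reg G \<one> \<circ> T = T"
  proof
    fix f show "(left_reg G \<one> \<circ> T) f = T f"
      using bounded_ops_l2[OF assms] bounded_ops_outside[OF assms]
      by (cases "f \<in> l2 G") (auto simp: left_reg_one)
  qed
qed

text \<open>Both \<open>left_reg G g\<close> and its inverse \<open>left_reg G (inv g)\<close> are
  contractions.\<close>

lemma left_reg_isometry:
  assumes "g \<in> carrier G" "f \<in> l2 G"
  shows "l2norm G (left_reg G g f) = l2norm G f"
proof -
  have "(left_reg G (inv g) \<circ> left_reg G g) f = f"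
    using assms by (simp add: left_reg_mult left_reg_one del: comp_apply)
  then show ?thesis
    using left_reg_l2(2)[OF assms] left_reg_l2(2)[of "inv g" "left_reg G g f"] left_reg_l2(1)[OF assms] assms
    by simp
qed

lemma left_reg_delta:
  assumes "g \<in> carrier G" "x \<in> carrier G"
  shows "left_reg G g (delta x) = delta (g \<otimes> x)"
proof
  fix y
  show "left_reg G g (delta x) y = delta (g \<otimes> x) y"
  proof (cases "y \<in> carrier G")
    case True
    then have "inv g \<otimes> y = x \<longleftrightarrow> y = g \<otimes> x"
      using assms by (metis inv_closed inv_solve_left)
    with True show ?thesis
      by (simp add: left_reg_apply[OF delta_l2[OF assms(2)]]) (simp add: delta_def)
  next
    case False
    then have "y \<noteq> g \<otimes> x" using assms by auto
    with False show ?thesis by (simp add: left_reg_def delta_def)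
  qed
qed

text \<open>The covariance relation of the crossed product. It is the source of
  \<open>conj_op_mult_op\<close>, by which conjugating operators translates diagonal
  functions.\<close>

lemma left_reg_mult_op:
  assumes h: "h \<in> carrier G" and \<phi>: "\<phi> \<in> bdd_fun G"
  shows "mult_op G \<phi> \<circ> left_reg G h = left_reg G h \<circ> mult_op G (\<lambda>x. \<phi> (h \<otimes> x))"
proof (intro ext)
  fix f x
  have \<phi>': "(\<lambda>x. \<phi> (h \<otimes> x)) \<in> bdd_fun G"
    using \<phi> h unfolding bdd_fun_def by auto
  show "(mult_op G \<phi> \<circ> left_reg G h) f x = (left_reg G h \<circ> mult_op G (\<lambda>x. \<phi> (h \<otimes> x))) f x"
  proof (cases "f \<in> l2 G")
    case True
    then have "left_reg G h f \<in> l2 G" "mult_op G (\<lambda>x. \<phi> (h \<otimes> x)) f \<in> l2 G"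
      using left_reg_l2 h bounded_ops_l2 mult_op_bounded[OF \<phi>'] by blast+
    moreover have "h \<otimes> (inv h \<otimes> x) = x" if "x \<in> carrier G"
      using h that by (simp add: m_assoc[symmetric])
    ultimately show ?thesis using True
      by (simp add: left_reg_def mult_op_def)
  next
    case False
    then show ?thesis by (auto simp: left_reg_def mult_op_def)
  qed
qed

lemma mult_op_one: "mult_op G (\<lambda>_. 1) = left_reg G \<one>"
  by (auto simp: mult_op_def left_reg_def fun_eq_iff l2_outside)

section \<open>The group ring and its norm closure\<close>

lemma group_ring_op_eq: "group_ring_op G S c = (\<Sum>g\<in>S. (\<lambda>f x. c g * left_reg G g f x))"
proof (intro ext)
  fix f x
  show "group_ring_op G S c f x = (\<Sum>g\<in>S. (\<lambda>f x. c g * left_reg G g f x)) f x"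
    unfolding group_ring_op_def by (induction S rule: infinite_finite_induct) auto
qed

lemma group_ring_op_bounded:
  assumes "S \<subseteq> carrier G"
  shows "group_ring_op G S c \<in> bounded_ops G"
  unfolding group_ring_op_eq
  by (intro subspace_sum[OF subspace_bounded_ops] bounded_ops_cscale left_reg_bounded) (use assms in auto)

lemma reduced_cstar_bounded: "T \<in> reduced_cstar G \<Longrightarrow> T \<in> bounded_ops G"
  by (simp add: reduced_cstar_def)

definition algebraic_ops :: "'a op set" where
  "algebraic_ops = {group_ring_op G S c | S c. finite S \<and> S \<subseteq> carrier G}"

lemma algebraic_ops_bounded: "T \<in> algebraic_ops \<Longrightarrow> T \<in> bounded_ops G"
  by (auto simp: algebraic_ops_def group_ring_op_bounded)

lemma algebraic_opsI:
  assumes "finite S" "S \<subseteq> carrier G" "\<And>f x. T f x = (\<Sum>g\<in>S. c g * left_reg G g f x)"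
  shows "T \<in> algebraic_ops"
proof -
  have "T = group_ring_op G S c" by (simp add: fun_eq_iff group_ring_op_def assms(3))
  with assms show ?thesis unfolding algebraic_ops_def by blast
qed

lemma algebraic_ops_plus:
  assumes "S \<in> algebraic_ops" "T \<in> algebraic_ops"
  shows "(\<lambda>f x. S f x + T f x) \<in> algebraic_ops"
proof -
  obtain A c B d where A: "finite A" "A \<subseteq> carrier G" "S = group_ring_op G A c"
    and B: "finite B" "B \<subseteq> carrier G" "T = group_ring_op G B d"
    using assms by (auto simp: algebraic_ops_def)
  have S: "S f x = (\<Sum>g\<in>A \<union> B. (if g \<in> A then c g else 0) * left_reg G g f x)" for f x
    unfolding A(3) group_ring_op_def using A B by (intro sum.mono_neutral_cong_left) auto
  have T: "T f x = (\<Sum>g\<in>A \<union> B. (if g \<in> B then d g else 0) * left_reg G g f x)" for f x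
    unfolding B(3) group_ring_op_def using A B by (intro sum.mono_neutral_cong_left) auto
  show ?thesis
    by (rule algebraic_opsI[of "A \<union> B" _ "\<lambda>g. (if g \<in> A then c g else 0) + (if g \<in> B then d g else 0)"])
      (use A(1,2) B(1,2) in \<open>auto simp: S T sum.distrib ring_distribs\<close>)
qed

lemma algebraic_ops_cscale:
  assumes "T \<in> algebraic_ops"
  shows "(\<lambda>f x. a * T f x) \<in> algebraic_ops"
proof -
  obtain B d where B: "finite B" "B \<subseteq> carrier G" "T = group_ring_op G B d"
    using assms by (auto simp: algebraic_ops_def)
  show ?thesis
    by (rule algebraic_opsI[OF B(1,2), of _ "\<lambda>g. a * d g"])
      (simp add: B(3) group_ring_op_def sum_distrib_left mult.assoc)
qed

lemma algebraic_ops_left_reg: "g \<in> carrier G \<Longrightarrow> left_reg G g \<in> algebraic_ops"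
  by (rule algebraic_opsI[of "{g}" _ "\<lambda>_. 1"]) auto

lemma algebraic_ops_0: "(\<lambda>_ _. 0) \<in> algebraic_ops"
  by (rule algebraic_opsI[of "{}"]) auto

lemma algebraic_ops_sum:
  "(\<And>i. i \<in> I \<Longrightarrow> T i \<in> algebraic_ops) \<Longrightarrow> (\<lambda>f x. \<Sum>i\<in>I. T i f x) \<in> algebraic_ops"
  by (induction I rule: infinite_finite_induct) (auto simp: algebraic_ops_0 algebraic_ops_plus)

text \<open>Splitting off one group element at a time leaves only single terms
  \<open>c * left_reg G g\<close> to check. The sum case keeps membership of both summands, from
  which their boundedness is recovered.\<close>

lemma algebraic_ops_induct [consumes 1, case_names zero plus left_reg]:
  assumes T: "T \<in> algebraic_ops"
    and 0: "Q (\<lambda>_ _. 0)"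
    and plus: "\<And>S T. S \<in> algebraic_ops \<Longrightarrow> T \<in> algebraic_ops \<Longrightarrow> Q S \<Longrightarrow> Q T \<Longrightarrow> Q (\<lambda>f x. S f x + T f x)"
    and left_reg: "\<And>g c. g \<in> carrier G \<Longrightarrow> Q (\<lambda>f x. c * left_reg G g f x)"
  shows "Q T"
proof -
  obtain B d where B: "finite B" "B \<subseteq> carrier G" "T = group_ring_op G B d"
    using T by (auto simp: algebraic_ops_def)
  from B(1,2) have "Q (\<lambda>f x. \<Sum>g\<in>B. d g * left_reg G g f x)"
  proof (induction B rule: finite_induct)
    case (insert g B)
    have "(\<lambda>f x. \<Sum>h\<in>B. d h * left_reg G h f x) \<in> algebraic_ops"
      using insert by (intro algebraic_ops_sum algebraic_ops_cscale algebraic_ops_left_reg) auto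
    with insert have "Q (\<lambda>f x. d g * left_reg G g f x + (\<Sum>h\<in>B. d h * left_reg G h f x))"
      by (intro plus left_reg algebraic_ops_cscale algebraic_ops_left_reg) auto
    with insert show ?case by simp
  qed (simp add: 0)
  then show ?thesis by (simp add: B(3) group_ring_op_def[abs_def])
qed

text \<open>Two nested inductions reduce the claim to \<open>left_reg_mult\<close>. The inner one
  distributes \<open>left_reg G g\<close> over sums, which is linearity on \<open>l2 G\<close>;
  elsewhere both sides vanish because operators are extended by zero.\<close>

lemma algebraic_ops_compose:
  assumes S: "S \<in> algebraic_ops" and T: "T \<in> algebraic_ops"
  shows "S \<circ> T \<in> algebraic_ops"
  using S
proof (induction rule: algebraic_ops_induct)
  case zero
  then show ?case by (simp add: comp_def algebraic_ops_0)
next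
  case (plus S S')
  then show ?case using algebraic_ops_plus[OF plus.IH] by (simp add: comp_def)
next
  case (left_reg g c)
  have "left_reg G g \<circ> T \<in> algebraic_ops"
    using T
  proof (induction rule: algebraic_ops_induct)
    case zero
    then show ?case using bounded_ops_zero[OF left_reg_bounded[OF \<open>g \<in> carrier G\<close>]]
      by (simp add: comp_def algebraic_ops_0)
  next
    case (plus T T')
    have "left_reg G g \<circ> (\<lambda>f x. T f x + T' f x) = (\<lambda>f x. (left_reg G g \<circ> T) f x + (left_reg G g \<circ> T') f x)"
    proof
      fix f show "(left_reg G g \<circ> (\<lambda>f x. T f x + T' f x)) f = (\<lambda>x. (left_reg G g \<circ> T) f x + (left_reg G g \<circ> T') f x)"
      proof (cases "f \<in> l2 G")
        case True
        then show ?thesis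
          using bounded_ops_add[OF left_reg_bounded[OF left_reg]]
            bounded_ops_l2[OF algebraic_ops_bounded[OF plus.hyps(1)] True]
            bounded_ops_l2[OF algebraic_ops_bounded[OF plus.hyps(2)] True]
          by simp
      next
        case False
        then show ?thesis
          using bounded_ops_zero[OF left_reg_bounded[OF left_reg]]
            bounded_ops_outside[OF algebraic_ops_bounded[OF plus.hyps(1)] False]
            bounded_ops_outside[OF algebraic_ops_bounded[OF plus.hyps(2)] False]
          by simp
      qed
    qed
    with algebraic_ops_plus[OF plus.IH] show ?case by simp
  next
    case (left_reg h d)
    have "left_reg G g \<circ> (\<lambda>f x. d * left_reg G h f x) = (\<lambda>f x. d * left_reg G (g \<otimes> h) f x)"
    proof
      fix f show "(left_reg G g \<circ> (\<lambda>f x. d * left_reg G h f x)) f = (\<lambda>x. d * left_reg G (g \<otimes> h) f x)"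
      proof (cases "f \<in> l2 G")
        case True
        then show ?thesis
          using bounded_ops_scale[OF left_reg_bounded[OF \<open>g \<in> carrier G\<close>] left_reg_l2(1)[OF left_reg True]]
            left_reg_mult[OF \<open>g \<in> carrier G\<close> left_reg] by (simp add: fun_eq_iff)
      next
        case False
        then have "left_reg G h f = (\<lambda>_. 0)" "left_reg G (g \<otimes> h) f = (\<lambda>_. 0)" by (auto simp: left_reg_def)
        then show ?thesis
          using bounded_ops_zero[OF left_reg_bounded[OF \<open>g \<in> carrier G\<close>]] by simp
      qed
    qed
    then show ?case
      using algebraic_ops_cscale[OF algebraic_ops_left_reg] \<open>g \<in> carrier G\<close> left_reg by simp
  qed
  from algebraic_ops_cscale[OF this] show ?case by (simp add: comp_def)
qed

lemma reduced_cstar_iff: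
  "T \<in> reduced_cstar G \<longleftrightarrow> T \<in> bounded_ops G \<and>
     (\<forall>\<epsilon>>0. \<exists>S\<in>algebraic_ops. opnorm G (\<lambda>f x. T f x - S f x) < \<epsilon>)"
proof -
  have "(\<exists>S c. finite S \<and> S \<subseteq> carrier G \<and> opnorm G (\<lambda>f x. T f x - group_ring_op G S c f x) < \<epsilon>) \<longleftrightarrow>
      (\<exists>S\<in>algebraic_ops. opnorm G (\<lambda>f x. T f x - S f x) < \<epsilon>)" for \<epsilon>
    unfolding algebraic_ops_def by blast
  then show ?thesis unfolding reduced_cstar_def by simp
qed

lemma reduced_cstarE:
  assumes "T \<in> reduced_cstar G" "\<epsilon> > 0"
  obtains S where "S \<in> algebraic_ops" "opnorm G (\<lambda>f x. T f x - S f x) < \<epsilon>"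
  using assms unfolding reduced_cstar_iff by blast

lemma algebraic_ops_subset: "T \<in> algebraic_ops \<Longrightarrow> T \<in> reduced_cstar G"
  unfolding reduced_cstar_iff
  by (auto simp: algebraic_ops_bounded intro!: bexI[of _ T]) (simp add: opnorm_0)

lemma left_reg_reduced: "g \<in> carrier G \<Longrightarrow> left_reg G g \<in> reduced_cstar G"
  by (intro algebraic_ops_subset algebraic_ops_left_reg)

lemma reduced_cstar_plus:
  assumes "S \<in> reduced_cstar G" "T \<in> reduced_cstar G"
  shows "(\<lambda>f x. S f x + T f x) \<in> reduced_cstar G"
  unfolding reduced_cstar_iff
proof (intro conjI allI impI)
  have b: "S \<in> bounded_ops G" "T \<in> bounded_ops G" using assms by (auto simp: reduced_cstar_bounded)
  then show "(\<lambda>f x. S f x + T f x) \<in> bounded_ops G" by (rule bounded_ops_plus)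
  fix \<epsilon> :: real assume "\<epsilon> > 0"
  then have "\<epsilon> / 2 > 0" by simp
  obtain S' where S': "S' \<in> algebraic_ops" "opnorm G (\<lambda>f x. S f x - S' f x) < \<epsilon> / 2"
    using reduced_cstarE[OF assms(1) \<open>\<epsilon> / 2 > 0\<close>] .
  obtain T' where T': "T' \<in> algebraic_ops" "opnorm G (\<lambda>f x. T f x - T' f x) < \<epsilon> / 2"
    using reduced_cstarE[OF assms(2) \<open>\<epsilon> / 2 > 0\<close>] .
  note * = S' T'
  have "opnorm G (\<lambda>f x. (S f x - S' f x) + (T f x - T' f x)) < \<epsilon>"
    using opnorm_triangle[OF bounded_ops_minus[OF b(1) algebraic_ops_bounded[OF *(1)]]
        bounded_ops_minus[OF b(2) algebraic_ops_bounded[OF *(3)]]] *(2,4) by simp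
  moreover have "(\<lambda>f x. (S f x - S' f x) + (T f x - T' f x)) = (\<lambda>f x. S f x + T f x - (S' f x + T' f x))"
    by (simp add: algebra_simps)
  ultimately show "\<exists>R\<in>algebraic_ops. opnorm G (\<lambda>f x. S f x + T f x - R f x) < \<epsilon>"
    using algebraic_ops_plus[OF *(1,3)] by auto
qed

text \<open>Products of approximations approximate the product by
  \<open>S T - S' T' = (S - S') T + S' (T - T')\<close>.\<close>

lemma reduced_cstar_compose:
  assumes "S \<in> reduced_cstar G" "T \<in> reduced_cstar G"
  shows "S \<circ> T \<in> reduced_cstar G"
  unfolding reduced_cstar_iff
proof (intro conjI allI impI)
  have b: "S \<in> bounded_ops G" "T \<in> bounded_ops G" using assms by (auto simp: reduced_cstar_bounded)
  then show "S \<circ> T \<in> bounded_ops G" by (rule bounded_ops_compose)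
  fix \<epsilon> :: real assume e: "\<epsilon> > 0"
  define K where "K = opnorm G T + 1"
  have K: "K > 0" using opnorm_nonneg[OF b(2)] by (simp add: K_def)
  obtain S' where S': "S' \<in> algebraic_ops" "opnorm G (\<lambda>f x. S f x - S' f x) < \<epsilon> / (2 * K)"
    using reduced_cstarE[OF assms(1), of "\<epsilon> / (2 * K)"] e K by auto
  have bS': "S' \<in> bounded_ops G" by (rule algebraic_ops_bounded[OF S'(1)])
  \<comment> \<open>The tolerance for \<open>T'\<close> depends on the norm of \<open>S'\<close>, so
    \<open>T'\<close> is chosen second. Adding 1 keeps the denominators positive.\<close>
  define L where "L = opnorm G S' + 1"
  have L: "L > 0" using opnorm_nonneg[OF bS'] by (simp add: L_def)
  obtain T' where T': "T' \<in> algebraic_ops" "opnorm G (\<lambda>f x. T f x - T' f x) < \<epsilon> / (2 * L)"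
    using reduced_cstarE[OF assms(2), of "\<epsilon> / (2 * L)"] e L by auto
  have bT': "T' \<in> bounded_ops G" by (rule algebraic_ops_bounded[OF T'(1)])
  have b1: "(\<lambda>f x. S f x - S' f x) \<in> bounded_ops G" "(\<lambda>f x. T f x - T' f x) \<in> bounded_ops G"
    using b bS' bT' by (auto intro: bounded_ops_minus)
  have eq: "(\<lambda>f x. (S \<circ> T) f x - (S' \<circ> T') f x) =
      (\<lambda>f x. ((\<lambda>f x. S f x - S' f x) \<circ> T) f x + (S' \<circ> (\<lambda>f x. T f x - T' f x)) f x)"
  proof
    fix f
    show "(\<lambda>x. (S \<circ> T) f x - (S' \<circ> T') f x) =
      (\<lambda>x. ((\<lambda>f x. S f x - S' f x) \<circ> T) f x + (S' \<circ> (\<lambda>f x. T f x - T' f x)) f x)"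
    proof (cases "f \<in> l2 G")
      case True
      then show ?thesis
        by (simp add: bounded_ops_diff[OF bS'] bounded_ops_l2[OF b(2)] bounded_ops_l2[OF bT'])
    next
      case False
      then show ?thesis
        by (simp add: bounded_ops_outside[OF b(2)] bounded_ops_outside[OF bT']
            bounded_ops_zero[OF b(1)] bounded_ops_zero[OF bS'])
    qed
  qed
  have "opnorm G ((\<lambda>f x. S f x - S' f x) \<circ> T) \<le> \<epsilon> / (2 * K) * opnorm G T"
    by (rule order_trans[OF opnorm_compose[OF b1(1) b(2)]
        mult_right_mono[OF less_imp_le[OF S'(2)] opnorm_nonneg[OF b(2)]]])
  also have "\<dots> < \<epsilon> / (2 * K) * K"
    using e K by (intro mult_strict_left_mono) (auto simp: K_def)
  also have "\<dots> = \<epsilon> / 2" using K by simp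
  finally have 1: "opnorm G ((\<lambda>f x. S f x - S' f x) \<circ> T) < \<epsilon> / 2" .
  have "opnorm G (S' \<circ> (\<lambda>f x. T f x - T' f x)) \<le> opnorm G S' * (\<epsilon> / (2 * L))"
    by (rule order_trans[OF opnorm_compose[OF bS' b1(2)]
        mult_left_mono[OF less_imp_le[OF T'(2)] opnorm_nonneg[OF bS']]])
  also have "\<dots> \<le> L * (\<epsilon> / (2 * L))"
    using e L by (intro mult_right_mono) (auto simp: L_def)
  also have "\<dots> = \<epsilon> / 2" using L by simp
  finally have 2: "opnorm G (S' \<circ> (\<lambda>f x. T f x - T' f x)) \<le> \<epsilon> / 2" .
  have "opnorm G (\<lambda>f x. (S \<circ> T) f x - (S' \<circ> T') f x) < \<epsilon>"
    unfolding eq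
    using opnorm_triangle[OF bounded_ops_compose[OF b1(1) b(2)] bounded_ops_compose[OF bS' b1(2)]] 1 2
    by linarith
  then show "\<exists>R\<in>algebraic_ops. opnorm G (\<lambda>f x. (S \<circ> T) f x - R f x) < \<epsilon>"
    using algebraic_ops_compose[OF S'(1) T'(1)] by blast
qed

text \<open>A scalar multiple is composition with the group ring element
  \<open>a * left_reg G \<one>\<close>, so closure under composition suffices.\<close>

lemma reduced_cstar_cscale:
  assumes T: "T \<in> reduced_cstar G"
  shows "(\<lambda>f x. a * T f x) \<in> reduced_cstar G"
proof -
  have "(\<lambda>f x. a * left_reg G \<one> f x) \<circ> T \<in> reduced_cstar G"
    by (intro reduced_cstar_compose T algebraic_ops_subset algebraic_ops_cscale algebraic_ops_left_reg) simp
  moreover have "(\<lambda>f x. a * left_reg G \<one> f x) \<circ> T = (\<lambda>f x. a * T f x)"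
    using compose_left_reg_one(2)[OF reduced_cstar_bounded[OF T]] by (simp add: fun_eq_iff)
  ultimately show ?thesis by simp
qed

end

section \<open>Means\<close>

lemma subspace_bdd_fun: "subspace (bdd_fun G)"
  unfolding subspace_def
proof (intro conjI ballI allI)
  show "0 \<in> bdd_fun G" by (rule bdd_funI[of G _ 0]) simp
next
  fix \<phi> \<psi> assume "\<phi> \<in> bdd_fun G" "\<psi> \<in> bdd_fun G"
  then obtain c d where "\<And>x. x \<in> carrier G \<Longrightarrow> \<bar>\<phi> x\<bar> \<le> c" "\<And>x. x \<in> carrier G \<Longrightarrow> \<bar>\<psi> x\<bar> \<le> d"
    by (metis bdd_funE)
  then show "\<phi> + \<psi> \<in> bdd_fun G"
    by (intro bdd_funI[of G _ "c + d"]) (auto intro: order_trans[OF abs_triangle_ineq add_mono])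
next
  fix \<phi> and a :: real assume "\<phi> \<in> bdd_fun G"
  then obtain c where "\<And>x. x \<in> carrier G \<Longrightarrow> \<bar>\<phi> x\<bar> \<le> c" by (metis bdd_funE)
  then show "a *\<^sub>R \<phi> \<in> bdd_fun G"
    by (intro bdd_funI[of G _ "\<bar>a\<bar> * c"]) (auto simp: abs_mult intro: mult_left_mono)
qed

lemma bdd_fun_add: "\<phi> \<in> bdd_fun G \<Longrightarrow> \<psi> \<in> bdd_fun G \<Longrightarrow> (\<lambda>x. \<phi> x + \<psi> x) \<in> bdd_fun G"
  using subspace_add[OF subspace_bdd_fun, of \<phi> G \<psi>] by (simp add: plus_fun_def)

lemma bdd_fun_cmult: "\<phi> \<in> bdd_fun G \<Longrightarrow> (\<lambda>x. a * \<phi> x) \<in> bdd_fun G"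
  using subspace_scale[OF subspace_bdd_fun, of \<phi> G a] by (simp add: scaleR_fun_def)

lemma bdd_fun_diff: "\<phi> \<in> bdd_fun G \<Longrightarrow> \<psi> \<in> bdd_fun G \<Longrightarrow> (\<lambda>x. \<phi> x - \<psi> x) \<in> bdd_fun G"
  using bdd_fun_add[OF _ bdd_fun_cmult[of \<psi> G "-1"], of \<phi>] by simp

lemma bdd_fun_const: "(\<lambda>_. c) \<in> bdd_fun G"
  by (rule bdd_funI[of G _ "\<bar>c\<bar>"]) simp

lemma bdd_fun_mult:
  assumes "\<phi> \<in> bdd_fun G" "\<psi> \<in> bdd_fun G"
  shows "(\<lambda>x. \<phi> x * \<psi> x) \<in> bdd_fun G"
proof -
  obtain c where c: "0 \<le> c" "\<And>x. x \<in> carrier G \<Longrightarrow> \<bar>\<phi> x\<bar> \<le> c" by (rule bdd_funE[OF assms(1)], rule that)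
  obtain d where d: "0 \<le> d" "\<And>x. x \<in> carrier G \<Longrightarrow> \<bar>\<psi> x\<bar> \<le> d" by (rule bdd_funE[OF assms(2)], rule that)
  show ?thesis
    by (rule bdd_funI[of G _ "c * d"]) (use c d in \<open>auto simp: abs_mult intro: mult_mono\<close>)
qed

lemma bdd_fun_indicat: "indicat_real A \<in> bdd_fun G"
  by (rule bdd_funI[of G _ 1]) (auto simp: indicator_def)

text \<open>Domination by the supremum encodes positivity and \<open>m 1 = 1\<close> at once: apply
  it to \<open>\<phi>\<close> and to \<open>- \<phi>\<close>.\<close>

definition means :: "('a, 'b) monoid_scheme \<Rightarrow> (('a \<Rightarrow> real) \<Rightarrow> real) set" where
  "means G = dominated (bdd_fun G) (\<lambda>\<phi>. Sup (\<phi> ` carrier G))"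

lemma mean_outside: "m \<in> means G \<Longrightarrow> \<phi> \<notin> bdd_fun G \<Longrightarrow> m \<phi> = 0"
  using dominatedD(4)[of m "bdd_fun G"] unfolding means_def by blast

lemma mean_add:
  "m \<in> means G \<Longrightarrow> \<phi> \<in> bdd_fun G \<Longrightarrow> \<psi> \<in> bdd_fun G \<Longrightarrow> m (\<lambda>x. \<phi> x + \<psi> x) = m \<phi> + m \<psi>"
  unfolding means_def using dominatedD(1)[of m "bdd_fun G" _ \<phi> \<psi>] by (simp add: plus_fun_def)

lemma mean_cmult: "m \<in> means G \<Longrightarrow> \<phi> \<in> bdd_fun G \<Longrightarrow> m (\<lambda>x. a * \<phi> x) = a * m \<phi>"
  unfolding means_def using dominatedD(2)[of m "bdd_fun G" _ \<phi> a] by (simp add: scaleR_fun_def)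

lemma mean_diff:
  "m \<in> means G \<Longrightarrow> \<phi> \<in> bdd_fun G \<Longrightarrow> \<psi> \<in> bdd_fun G \<Longrightarrow> m (\<lambda>x. \<phi> x - \<psi> x) = m \<phi> - m \<psi>"
  using mean_add[OF _ _ bdd_fun_cmult[of \<psi> G "-1"], of m \<phi>] mean_cmult[of m G \<psi> "-1"] by simp

lemma mean_sum:
  assumes "m \<in> means G" "\<And>i. i \<in> I \<Longrightarrow> \<phi> i \<in> bdd_fun G"
  shows "m (\<lambda>x. \<Sum>i\<in>I. \<phi> i x) = (\<Sum>i\<in>I. m (\<phi> i))"
proof -
  have "(\<lambda>x. \<Sum>i\<in>I. \<phi> i x) = sum \<phi> I"
    by (induction I rule: infinite_finite_induct) (auto simp: fun_eq_iff)
  then show ?thesis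
    using dominated_sum[OF assms(1)[unfolded means_def] subspace_bdd_fun assms(2)] by simp
qed

context group
begin

lemma mean_le:
  assumes "m \<in> means G" "\<phi> \<in> bdd_fun G" "\<And>x. x \<in> carrier G \<Longrightarrow> \<phi> x \<le> c"
  shows "m \<phi> \<le> c"
proof -
  have "Sup (\<phi> ` carrier G) \<le> c"
    by (rule cSup_least) (use assms(3) in auto)
  then show ?thesis using dominatedD(3)[OF assms(1)[unfolded means_def] assms(2)] by simp
qed

lemma mean_ge:
  assumes m: "m \<in> means G" and \<phi>: "\<phi> \<in> bdd_fun G" "\<And>x. x \<in> carrier G \<Longrightarrow> c \<le> \<phi> x"
  shows "c \<le> m \<phi>"
proof -
  have "m (\<lambda>x. -1 * \<phi> x) \<le> - c"
    by (rule mean_le[OF m bdd_fun_cmult[OF \<phi>(1)]]) (use \<phi>(2) in auto)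
  then show ?thesis using mean_cmult[OF m \<phi>(1), of "-1"] by simp
qed

lemma mean_const: "m \<in> means G \<Longrightarrow> m (\<lambda>_. c) = c"
  using mean_le[of m "\<lambda>_. c" c] mean_ge[of m "\<lambda>_. c" c] bdd_fun_const by force

lemma mean_mono:
  assumes m: "m \<in> means G" and "\<phi> \<in> bdd_fun G" "\<psi> \<in> bdd_fun G" "\<And>x. x \<in> carrier G \<Longrightarrow> \<phi> x \<le> \<psi> x"
  shows "m \<phi> \<le> m \<psi>"
  using mean_ge[OF m bdd_fun_diff[OF assms(3,2)], of 0] mean_diff[OF m assms(3,2)] assms(4) by simp

lemma bdd_fun_cong:
  assumes "\<phi> \<in> bdd_fun G" "\<And>x. x \<in> carrier G \<Longrightarrow> \<phi> x = \<psi> x"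
  shows "\<psi> \<in> bdd_fun G"
  using assms unfolding bdd_fun_def by auto

lemma mean_cong:
  assumes m: "m \<in> means G" and "\<And>x. x \<in> carrier G \<Longrightarrow> \<phi> x = \<psi> x"
  shows "m \<phi> = m \<psi>"
proof (cases "\<phi> \<in> bdd_fun G")
  case True
  then have "\<psi> \<in> bdd_fun G" by (rule bdd_fun_cong) (rule assms)
  with True show ?thesis using assms by (simp add: order_antisym mean_mono[OF m])
next
  case False
  then have "\<psi> \<notin> bdd_fun G" using bdd_fun_cong[of \<psi> \<phi>] assms(2) by auto
  with False show ?thesis using mean_outside[OF m] by simp
qed

lemma mean_abs_le:
  assumes m: "m \<in> means G" and "\<And>x. x \<in> carrier G \<Longrightarrow> \<bar>\<phi> x\<bar> \<le> c"
  shows "\<bar>m \<phi>\<bar> \<le> c"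
proof -
  have b: "\<phi> \<in> bdd_fun G" by (rule bdd_funI[OF assms(2)])
  have "m \<phi> \<le> c" by (rule mean_le[OF m b]) (use assms(2) in \<open>auto simp: abs_le_iff\<close>)
  moreover have "- c \<le> m \<phi>" by (rule mean_ge[OF m b]) (use assms(2) in \<open>force simp: abs_le_iff\<close>)
  ultimately show ?thesis by simp
qed

lemma meansI:
  assumes "\<And>\<phi> \<psi>. \<phi> \<in> bdd_fun G \<Longrightarrow> \<psi> \<in> bdd_fun G \<Longrightarrow> m (\<lambda>x. \<phi> x + \<psi> x) = m \<phi> + m \<psi>"
    and "\<And>\<phi> a. \<phi> \<in> bdd_fun G \<Longrightarrow> m (\<lambda>x. a * \<phi> x) = a * m \<phi>"
    and "\<And>\<phi> c. \<phi> \<in> bdd_fun G \<Longrightarrow> (\<And>x. x \<in> carrier G \<Longrightarrow> \<phi> x \<le> c) \<Longrightarrow> m \<phi> \<le> c"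
    and "\<And>\<phi>. \<phi> \<notin> bdd_fun G \<Longrightarrow> m \<phi> = 0"
  shows "m \<in> means G"
proof -
  have "m \<phi> \<le> Sup (\<phi> ` carrier G)" if \<phi>: "\<phi> \<in> bdd_fun G" for \<phi>
  proof -
    obtain c where c: "\<And>x. x \<in> carrier G \<Longrightarrow> \<bar>\<phi> x\<bar> \<le> c" using bdd_funE[OF \<phi>] by metis
    have "bdd_above (\<phi> ` carrier G)"
      by (rule bdd_aboveI2[of _ _ c]) (use c in \<open>auto simp: abs_le_iff\<close>)
    then show ?thesis by (intro assms(3)[OF \<phi>] cSup_upper) auto
  qed
  then show ?thesis
    using assms(1,2,4) unfolding means_def dominated_def by (simp add: plus_fun_def scaleR_fun_def)
qed

lemma compact_means: "compact (means G)"
  unfolding means_def by (rule compact_dominated[OF subspace_bdd_fun])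

lemma convex_means: "convex (means G)"
  unfolding means_def by (rule convex_dominated)

lemma sublinear_sup: "sublinear_on (bdd_fun G) (\<lambda>\<phi>. Sup (\<phi> ` carrier G))"
proof -
  have bdd: "bdd_above (\<phi> ` carrier G)" if \<phi>: "\<phi> \<in> bdd_fun G" for \<phi> :: "'a \<Rightarrow> real"
  proof -
    obtain c where c: "\<And>x. x \<in> carrier G \<Longrightarrow> \<bar>\<phi> x\<bar> \<le> c" using bdd_funE[OF \<phi>] by metis
    show ?thesis by (rule bdd_aboveI2[of _ _ c]) (use c in \<open>auto simp: abs_le_iff\<close>)
  qed
  have ne: "\<phi> ` carrier G \<noteq> {}" for \<phi> :: "'a \<Rightarrow> real" by auto
  have upper: "\<phi> x \<le> Sup (\<phi> ` carrier G)" if "\<phi> \<in> bdd_fun G" "x \<in> carrier G" for \<phi> x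
    using that by (intro cSup_upper bdd) auto
  show ?thesis
  proof (rule sublinear_onI[OF subspace_bdd_fun])
    have "carrier G \<noteq> {}" by auto
    then show "Sup ((0 :: 'a \<Rightarrow> real) ` carrier G) = 0"
      by (simp add: image_constant_conv)
  next
    fix \<phi> \<psi> :: "'a \<Rightarrow> real" assume "\<phi> \<in> bdd_fun G" "\<psi> \<in> bdd_fun G"
    then show "Sup ((\<phi> + \<psi>) ` carrier G) \<le> Sup (\<phi> ` carrier G) + Sup (\<psi> ` carrier G)"
      by (intro cSup_least[OF ne]) (auto intro: add_mono upper)
  next
    fix \<phi> :: "'a \<Rightarrow> real" and c :: real assume "\<phi> \<in> bdd_fun G" "c > 0"
    then show "Sup ((c *\<^sub>R \<phi>) ` carrier G) \<le> c * Sup (\<phi> ` carrier G)"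
      by (intro cSup_least[OF ne]) (auto intro: mult_left_mono upper)
  qed
qed

text \<open>A bounded function is a uniform limit of step functions built from the level sets of
  \<open>\<lfloor>k * \<phi> x\<rfloor>\<close>, and means are continuous for uniform
  convergence.\<close>

lemma means_eqI:
  assumes m: "m \<in> means G" "n \<in> means G"
    and eq: "\<And>A. A \<subseteq> carrier G \<Longrightarrow> m (indicat_real A) = n (indicat_real A)"
  shows "m = n"
proof
  fix \<phi>
  show "m \<phi> = n \<phi>"
  proof (cases "\<phi> \<in> bdd_fun G")
    case True
    obtain c where c: "0 \<le> c" "\<And>x. x \<in> carrier G \<Longrightarrow> \<bar>\<phi> x\<bar> \<le> c" by (rule bdd_funE[OF True], rule that)
    have "\<bar>m \<phi> - n \<phi>\<bar> \<le> \<epsilon>" if "\<epsilon> > 0" for \<epsilon>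
    proof -
      \<comment> \<open>Replacing \<open>\<phi>\<close> by the step function costs
        \<open>1 / k\<close> for each of the two means, hence \<open>\<epsilon>\<close>
        altogether.\<close>
      define k where "k = 2 / \<epsilon>"
      have k: "k > 0" using that by (simp add: k_def)
      define A where "A j = {x \<in> carrier G. \<lfloor>k * \<phi> x\<rfloor> = j}" for j
      define s where "s x = (\<Sum>j\<in>{- \<lceil>k * c\<rceil> - 1..\<lceil>k * c\<rceil>}. of_int j / k * indicat_real (A j) x)" for x
      have s: "s x = of_int \<lfloor>k * \<phi> x\<rfloor> / k" if x: "x \<in> carrier G" for x
      proof -
        have "\<bar>k * \<phi> x\<bar> \<le> k * c" using c(2)[OF x] k by (simp add: abs_mult)
        then have "\<lfloor>k * \<phi> x\<rfloor> \<in> {- \<lceil>k * c\<rceil> - 1..\<lceil>k * c\<rceil>}" by (auto simp: abs_le_iff) linarith+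
        then show ?thesis
          unfolding s_def using x by (subst sum.remove[of _ "\<lfloor>k * \<phi> x\<rfloor>"]) (auto simp: A_def indicator_def)
      qed
      have bs: "(\<lambda>x. of_int j / k * indicat_real (A j) x) \<in> bdd_fun G" for j
        by (intro bdd_fun_cmult bdd_fun_indicat)
      have ms: "p s = (\<Sum>j\<in>{- \<lceil>k * c\<rceil> - 1..\<lceil>k * c\<rceil>}. of_int j / k * p (indicat_real (A j)))"
        if "p \<in> means G" for p
        unfolding s_def by (subst mean_sum[OF that bs]) (simp only: mean_cmult[OF that bdd_fun_indicat])
      have "m s = n s"
        unfolding ms[OF m(1)] ms[OF m(2)] by (intro sum.cong refl) (simp add: eq A_def)
      have sb: "\<bar>\<phi> x - s x\<bar> \<le> 1 / k" if "x \<in> carrier G" for x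
      proof -
        have "\<phi> x - s x = (k * \<phi> x - of_int \<lfloor>k * \<phi> x\<rfloor>) / k"
          using k by (simp add: s[OF that] field_simps)
        moreover have "\<bar>k * \<phi> x - of_int \<lfloor>k * \<phi> x\<rfloor>\<bar> \<le> 1" by linarith
        ultimately show ?thesis using k by (simp only: abs_divide) (simp add: divide_right_mono)
      qed
      have "s \<in> bdd_fun G"
      proof (rule bdd_funI)
        fix x assume "x \<in> carrier G"
        from sb[OF this] c(2)[OF this] show "\<bar>s x\<bar> \<le> c + 1 / k" by linarith
      qed
      then have "\<bar>p \<phi> - p s\<bar> \<le> 1 / k" if "p \<in> means G" for p
        using mean_abs_le[OF that, of "\<lambda>x. \<phi> x - s x" "1 / k"] sb mean_diff[OF that True] that by simp
      from this[OF m(1)] this[OF m(2)] \<open>m s = n s\<close> have "\<bar>m \<phi> - n \<phi>\<bar> \<le> 2 * (1 / k)" by linarith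
      then show ?thesis using that by (simp add: k_def)
    qed
    then have "\<bar>m \<phi> - n \<phi>\<bar> \<le> 0" by (rule field_le_epsilon) simp
    then show ?thesis by simp
  qed (simp add: mean_outside[OF m(1)] mean_outside[OF m(2)])
qed

section \<open>The convolution semigroup of means\<close>

definition conv :: "(('a \<Rightarrow> real) \<Rightarrow> real) \<Rightarrow> (('a \<Rightarrow> real) \<Rightarrow> real) \<Rightarrow> ('a \<Rightarrow> real) \<Rightarrow> real" where
  "conv m n \<phi> = (if \<phi> \<in> bdd_fun G then m (\<lambda>x. n (\<lambda>y. \<phi> (x \<otimes> y))) else 0)"

definition dirac :: "'a \<Rightarrow> ('a \<Rightarrow> real) \<Rightarrow> real" where
  "dirac x \<phi> = (if \<phi> \<in> bdd_fun G then \<phi> x else 0)"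

lemma bdd_fun_translate:
  assumes "\<phi> \<in> bdd_fun G" "x \<in> carrier G"
  shows "(\<lambda>y. \<phi> (x \<otimes> y)) \<in> bdd_fun G"
  using assms unfolding bdd_fun_def by auto

lemma bdd_fun_orbit:
  assumes \<phi>: "\<phi> \<in> bdd_fun G" and n: "n \<in> means G"
  shows "(\<lambda>x. n (\<lambda>y. \<phi> (x \<otimes> y))) \<in> bdd_fun G"
proof -
  obtain c where c: "\<And>x. x \<in> carrier G \<Longrightarrow> \<bar>\<phi> x\<bar> \<le> c" using bdd_funE[OF \<phi>] by metis
  show ?thesis by (rule bdd_funI[of _ _ c], rule mean_abs_le[OF n]) (auto intro: c)
qed

lemma conv_means:
  assumes m: "m \<in> means G" and n: "n \<in> means G"
  shows "conv m n \<in> means G"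
proof (rule meansI)
  fix \<phi> \<psi> assume b: "\<phi> \<in> bdd_fun G" "\<psi> \<in> bdd_fun G"
  have "conv m n (\<lambda>x. \<phi> x + \<psi> x) = m (\<lambda>x. n (\<lambda>y. \<phi> (x \<otimes> y)) + n (\<lambda>y. \<psi> (x \<otimes> y)))"
    unfolding conv_def using b bdd_fun_add[OF b]
    by (simp, intro mean_cong[OF m]) (simp add: mean_add[OF n] bdd_fun_translate)
  also have "\<dots> = conv m n \<phi> + conv m n \<psi>"
    using b by (simp add: conv_def mean_add[OF m] bdd_fun_orbit n)
  finally show "conv m n (\<lambda>x. \<phi> x + \<psi> x) = conv m n \<phi> + conv m n \<psi>" .
next
  fix \<phi> a assume b: "\<phi> \<in> bdd_fun G"
  have "conv m n (\<lambda>x. a * \<phi> x) = m (\<lambda>x. a * n (\<lambda>y. \<phi> (x \<otimes> y)))"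
    unfolding conv_def using b bdd_fun_cmult[OF b, of a]
    by (simp, intro mean_cong[OF m]) (simp add: mean_cmult[OF n] bdd_fun_translate)
  also have "\<dots> = a * conv m n \<phi>"
    using b by (simp add: conv_def mean_cmult[OF m] bdd_fun_orbit n)
  finally show "conv m n (\<lambda>x. a * \<phi> x) = a * conv m n \<phi>" .
next
  fix \<phi> c assume b: "\<phi> \<in> bdd_fun G" "\<And>x. x \<in> carrier G \<Longrightarrow> \<phi> x \<le> c"
  have "n (\<lambda>y. \<phi> (x \<otimes> y)) \<le> c" if "x \<in> carrier G" for x
    by (rule mean_le[OF n bdd_fun_translate[OF b(1) that]]) (simp add: b(2) that)
  from mean_le[OF m bdd_fun_orbit[OF b(1) n] this] show "conv m n \<phi> \<le> c"
    using b(1) by (simp add: conv_def)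
qed (simp add: conv_def)

lemma dirac_means: "x \<in> carrier G \<Longrightarrow> dirac x \<in> means G"
  by (rule meansI) (auto simp: dirac_def bdd_fun_add bdd_fun_cmult)

lemma means_nonempty: "means G \<noteq> {}"
  using dirac_means by blast

text \<open>Both sides are the same iterated mean of
  \<open>\<phi> (x \<otimes> y \<otimes> z)\<close>, with \<open>p\<close> innermost and
  \<open>m\<close> outermost.\<close>

lemma conv_assoc:
  assumes "m \<in> means G" "n \<in> means G" "p \<in> means G"
  shows "conv (conv m n) p = conv m (conv n p)"
proof
  fix \<phi>
  show "conv (conv m n) p \<phi> = conv m (conv n p) \<phi>"
  proof (cases "\<phi> \<in> bdd_fun G")
    case True
    have *: "n (\<lambda>y. p (\<lambda>z. \<phi> (x \<otimes> y \<otimes> z))) = conv n p (\<lambda>y. \<phi> (x \<otimes> y))"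
      if x: "x \<in> carrier G" for x
      unfolding conv_def using bdd_fun_translate[OF True x]
      by (simp, intro mean_cong[OF assms(2)] mean_cong[OF assms(3)]) (simp add: m_assoc x)
    have "conv (conv m n) p \<phi> = m (\<lambda>x. n (\<lambda>y. p (\<lambda>z. \<phi> (x \<otimes> y \<otimes> z))))"
      using True bdd_fun_orbit[OF True assms(3)] by (simp add: conv_def)
    also have "\<dots> = m (\<lambda>x. conv n p (\<lambda>y. \<phi> (x \<otimes> y)))"
      by (intro mean_cong[OF assms(1)] *)
    finally show ?thesis using True by (simp add: conv_def)
  qed (simp add: conv_def)
qed

lemma conv_dirac:
  assumes "g \<in> carrier G" "n \<in> means G" "\<phi> \<in> bdd_fun G"
  shows "conv (dirac g) n \<phi> = n (\<lambda>y. \<phi> (g \<otimes> y))"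
  using assms by (simp add: conv_def dirac_def bdd_fun_orbit)

lemma conv_dirac_one: "n \<in> means G \<Longrightarrow> conv (dirac \<one>) n = n"
proof
  fix \<phi> assume n: "n \<in> means G"
  show "conv (dirac \<one>) n \<phi> = n \<phi>"
  proof (cases "\<phi> \<in> bdd_fun G")
    case True
    then show ?thesis by (simp add: conv_dirac n) (rule mean_cong[OF n], simp)
  qed (simp add: conv_def mean_outside[OF n])
qed

lemma conv_dirac_dirac:
  assumes "g \<in> carrier G" "h \<in> carrier G"
  shows "conv (dirac g) (dirac h) = dirac (g \<otimes> h)"
proof
  fix \<phi>
  show "conv (dirac g) (dirac h) \<phi> = dirac (g \<otimes> h) \<phi>"
    using assms dirac_means[of h] bdd_fun_translate
    by (cases "\<phi> \<in> bdd_fun G") (auto simp: conv_dirac, auto simp: conv_def dirac_def)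
qed

text \<open>The left factor varies while the right one is fixed. Hence images of compact sets under
  right multiplication are compact, which is how closed left ideals are produced below.\<close>

lemma continuous_on_conv: "continuous_on S (\<lambda>m. conv m n)"
proof (rule continuous_on_coordinatewise_then_product)
  fix \<phi>
  show "continuous_on S (\<lambda>m. conv m n \<phi>)"
    by (cases "\<phi> \<in> bdd_fun G") (simp_all add: conv_def continuous_on_eval)
qed

lemma conv_affine:
  "conv (s *\<^sub>R m + t *\<^sub>R n) p = s *\<^sub>R conv m p + t *\<^sub>R conv n p"
  by (auto simp: conv_def fun_eq_iff)

section \<open>Stabilisers of means under left translation\<close>

definition stab :: "(('a \<Rightarrow> real) \<Rightarrow> real) \<Rightarrow> 'a set" where
  "stab m = {g \<in> carrier G. conv (dirac g) m = m}"

lemma stab_iff: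
  assumes "m \<in> means G" "g \<in> carrier G"
  shows "g \<in> stab m \<longleftrightarrow> (\<forall>\<phi>\<in>bdd_fun G. m (\<lambda>y. \<phi> (g \<otimes> y)) = m \<phi>)"
proof -
  have "conv (dirac g) m = m \<longleftrightarrow> (\<forall>\<phi>\<in>bdd_fun G. conv (dirac g) m \<phi> = m \<phi>)"
    using mean_outside[OF assms(1)] by (auto simp: fun_eq_iff conv_def)
  then show ?thesis using assms by (simp add: stab_def conv_dirac)
qed

lemma subgroup_stab:
  assumes m: "m \<in> means G"
  shows "subgroup (stab m) G"
proof (rule subgroupI)
  show "stab m \<subseteq> carrier G" by (auto simp: stab_def)
  show "stab m \<noteq> {}" using conv_dirac_one[OF m] by (auto simp: stab_def)
next
  fix g assume g: "g \<in> stab m"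
  then have gc: "g \<in> carrier G" by (simp add: stab_def)
  have "conv (dirac (inv g)) m = conv (dirac (inv g)) (conv (dirac g) m)"
    using g by (simp add: stab_def)
  also have "\<dots> = m"
    using gc m by (simp add: conv_assoc[symmetric] dirac_means conv_dirac_dirac conv_dirac_one)
  finally show "inv g \<in> stab m" using gc by (simp add: stab_def)
next
  fix g h assume gh: "g \<in> stab m" "h \<in> stab m"
  then have c: "g \<in> carrier G" "h \<in> carrier G" by (auto simp: stab_def)
  have "conv (dirac (g \<otimes> h)) m = conv (dirac g) (conv (dirac h) m)"
    using c m by (simp add: conv_assoc[symmetric] dirac_means conv_dirac_dirac)
  then show "g \<otimes> h \<in> stab m" using gh c by (simp add: stab_def)
qed

lemma stab_conv_left:
  assumes "m \<in> means G" "n \<in> means G"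
  shows "stab m \<subseteq> stab (conv m n)"
  using assms by (auto simp: stab_def conv_assoc[symmetric] dirac_means)

text \<open>From \<open>h \<otimes> x = x \<otimes> (inv x \<otimes> h \<otimes> x)\<close>: the
  inner mean \<open>n\<close> absorbs the conjugate, which lies in \<open>N\<close> again. Together
  with \<open>stab_conv_left\<close> this gives one mean invariant under several normal
  subgroups.\<close>

lemma stab_conv_right:
  assumes m: "m \<in> means G" and n: "n \<in> means G" and N: "N \<subseteq> stab n"
    and norm: "\<And>x h. x \<in> carrier G \<Longrightarrow> h \<in> N \<Longrightarrow> inv x \<otimes> h \<otimes> x \<in> N"
  shows "N \<subseteq> stab (conv m n)"
proof
  fix h assume h: "h \<in> N"
  then have hc: "h \<in> carrier G" using N by (auto simp: stab_def)
  have "conv m n (\<lambda>y. \<phi> (h \<otimes> y)) = conv m n \<phi>" if \<phi>: "\<phi> \<in> bdd_fun G" for \<phi>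
  proof -
    have "n (\<lambda>y. \<phi> (h \<otimes> (x \<otimes> y))) = n (\<lambda>y. \<phi> (x \<otimes> y))" if x: "x \<in> carrier G" for x
    proof -
      have "inv x \<otimes> h \<otimes> x \<in> stab n" using norm[OF x h] N by blast
      then have "n (\<lambda>y. \<phi> (x \<otimes> (inv x \<otimes> h \<otimes> x \<otimes> y))) = n (\<lambda>y. \<phi> (x \<otimes> y))"
        using stab_iff[OF n, of "inv x \<otimes> h \<otimes> x"] bdd_fun_translate[OF \<phi> x] x hc by auto
      moreover have "x \<otimes> (inv x \<otimes> h \<otimes> x \<otimes> y) = h \<otimes> (x \<otimes> y)" if "y \<in> carrier G" for y
        using that x hc by (simp add: m_assoc[symmetric])
      ultimately show ?thesis using mean_cong[OF n, of "\<lambda>y. \<phi> (x \<otimes> (inv x \<otimes> h \<otimes> x \<otimes> y))"] by auto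
    qed
    then show ?thesis
      using \<phi> bdd_fun_translate[OF \<phi> hc] by (auto simp: conv_def intro!: mean_cong[OF m])
  qed
  then show "h \<in> stab (conv m n)"
    using stab_iff[OF conv_means[OF m n] hc] by blast
qed

lemma closed_means_stab:
  assumes "H \<subseteq> carrier G"
  shows "closed {m \<in> means G. H \<subseteq> stab m}"
proof -
  have "{m \<in> means G. H \<subseteq> stab m} =
      means G \<inter> (\<Inter>g\<in>H. \<Inter>\<phi>\<in>bdd_fun G. {m. m (\<lambda>y. \<phi> (g \<otimes> y)) = m \<phi>})"
    using assms by (auto simp: stab_iff subset_iff)
  moreover have "closed \<dots>"
    by (intro closed_Int closed_INT ballI closed_Collect_eq continuous_on_eval
        compact_imp_closed compact_means)
  ultimately show ?thesis by simp
qed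

text \<open>The invariant mean lives on all of \<open>G\<close> instead of on \<open>H\<close>. For
  subgroups this is ordinary amenability by \<open>amen_iff\<close>, but in this form it passes to
  subsets at once and survives limits of means.\<close>

definition amen :: "'a set \<Rightarrow> bool" where
  "amen H \<longleftrightarrow> (\<exists>m\<in>means G. H \<subseteq> stab m)"

lemma amen_mono: "amen H \<Longrightarrow> K \<subseteq> H \<Longrightarrow> amen K"
  by (auto simp: amen_def)

section \<open>Amenable subgroups\<close>

lemma conv_affine_right:
  assumes m: "m \<in> means G" and n: "n \<in> means G" "p \<in> means G"
  shows "conv m (s *\<^sub>R n + t *\<^sub>R p) = s *\<^sub>R conv m n + t *\<^sub>R conv m p"
proof
  fix \<phi>
  show "conv m (s *\<^sub>R n + t *\<^sub>R p) \<phi> = (s *\<^sub>R conv m n + t *\<^sub>R conv m p) \<phi>"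
  proof (cases "\<phi> \<in> bdd_fun G")
    case True
    then show ?thesis
      using mean_add[OF m bdd_fun_cmult[OF bdd_fun_orbit[OF True n(1)]] bdd_fun_cmult[OF bdd_fun_orbit[OF True n(2)]], of s t]
        mean_cmult[OF m bdd_fun_orbit[OF True n(1)], of s] mean_cmult[OF m bdd_fun_orbit[OF True n(2)], of t]
      by (simp add: conv_def)
  qed (simp add: conv_def)
qed

definition closed_left_ideal :: "(('a \<Rightarrow> real) \<Rightarrow> real) set \<Rightarrow> bool" where
  "closed_left_ideal J \<longleftrightarrow> closed J \<and> J \<noteq> {} \<and> J \<subseteq> means G \<and> (\<forall>m\<in>means G. \<forall>j\<in>J. conv m j \<in> J)"

text \<open>Extreme points of a minimal closed left ideal of the semigroup of means
  play the role of points of the Furstenberg boundary.\<close>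

definition extreme_mean :: "(('a \<Rightarrow> real) \<Rightarrow> real) \<Rightarrow> bool" where
  "extreme_mean w \<longleftrightarrow> w \<in> means G \<and> (\<forall>J. closed_left_ideal J \<longrightarrow> (\<exists>j\<in>J. conv j w = w)) \<and>
     (\<forall>m\<in>means G. \<forall>n\<in>means G. \<forall>t. 0 < t \<longrightarrow> t < 1 \<longrightarrow>
        w = t *\<^sub>R conv m w + (1 - t) *\<^sub>R conv n w \<longrightarrow> conv m w = w \<and> conv n w = w)"

text \<open>Let \<open>w\<close> be an extreme point of a minimal closed left ideal
  \<open>Q\<close>. For any closed left ideal \<open>J\<close>, the image of \<open>J\<close> under
  right convolution by \<open>w\<close> is a closed left ideal inside \<open>Q\<close>, so it equals
  \<open>Q\<close> and contains \<open>w\<close>. All \<open>conv m w\<close> lie in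
  \<open>Q\<close>, so extremality in \<open>Q\<close> applies to them.\<close>

lemma extreme_mean_exists: "\<exists>w. extreme_mean w"
proof -
  define Inv where "Inv S \<longleftrightarrow> (\<forall>m\<in>means G. \<forall>n\<in>S. conv m n \<in> S)" for S
  obtain Q where Q: "closed Q" "Q \<subseteq> means G" "Q \<noteq> {}" "Inv Q"
    and min: "\<And>T. closed T \<Longrightarrow> T \<subseteq> Q \<Longrightarrow> T \<noteq> {} \<Longrightarrow> Inv T \<Longrightarrow> T = Q"
  proof (rule minimal_compact_subset[of "means G" Inv])
    show "Inv (\<Inter>\<A>)" if "\<A> \<noteq> {}" "\<And>S. S \<in> \<A> \<Longrightarrow> closed S \<and> S \<subseteq> means G \<and> S \<noteq> {} \<and> Inv S" for \<A>
      using that unfolding Inv_def by blast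
    show "Inv (means G)" by (simp add: Inv_def conv_means)
  qed (use compact_means means_nonempty that in blast)+
  have "compact Q" using Q compact_means by (metis compact_Int_closed inf.absorb_iff2)
  then obtain w where w: "w \<in> Q"
    and ext: "\<And>x y t. x \<in> Q \<Longrightarrow> y \<in> Q \<Longrightarrow> 0 < t \<Longrightarrow> t < 1 \<Longrightarrow> w = t *\<^sub>R x + (1 - t) *\<^sub>R y \<Longrightarrow> x = w \<and> y = w"
    using extreme_point_exists[of Q] Q(3) by metis
  have wm: "w \<in> means G" using w Q by blast
  have cw: "conv m w \<in> Q" if "m \<in> means G" for m
    using that w Q(4) by (simp add: Inv_def)
  have fixed: "\<exists>j\<in>J. conv j w = w" if J: "closed_left_ideal J" for J
  proof -
    have cJ: "closed J" and neJ: "J \<noteq> {}" and Jm: "J \<subseteq> means G"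
      and id: "\<And>m j. m \<in> means G \<Longrightarrow> j \<in> J \<Longrightarrow> conv m j \<in> J"
      using J by (auto simp: closed_left_ideal_def)
    have "compact J" using cJ Jm compact_means by (metis compact_Int_closed inf.absorb_iff2)
    then have "compact ((\<lambda>j. conv j w) ` J)"
      by (rule compact_continuous_image[OF continuous_on_conv])
    moreover have "Inv ((\<lambda>j. conv j w) ` J)"
      unfolding Inv_def
    proof (intro ballI)
      fix m n assume m: "m \<in> means G" and "n \<in> (\<lambda>j. conv j w) ` J"
      then obtain j where j: "j \<in> J" "n = conv j w" by blast
      then have "conv m n = conv (conv m j) w"
        using Jm m wm by (simp add: conv_assoc subset_iff)
      then show "conv m n \<in> (\<lambda>j. conv j w) ` J" using id[OF m j(1)] by blast
    qed
    ultimately have "(\<lambda>j. conv j w) ` J = Q"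
      using neJ Jm cw by (intro min) (auto intro: compact_imp_closed)
    with w have "w \<in> (\<lambda>j. conv j w) ` J" by simp
    then obtain j where "w = conv j w" "j \<in> J" by (rule imageE)
    then show ?thesis by (intro bexI[of _ j]) (rule sym)
  qed
  have "extreme_mean w"
    unfolding extreme_mean_def
  proof (intro conjI allI impI ballI)
    fix m n t
    assume *: "m \<in> means G" "n \<in> means G" "0 < (t::real)" "t < 1"
      "w = t *\<^sub>R conv m w + (1 - t) *\<^sub>R conv n w"
    from ext[OF cw[OF *(1)] cw[OF *(2)] *(3-5)] show "conv m w = w" "conv n w = w" by (rule conjunct1, rule conjunct2)
  qed (rule wm, rule fixed)
  then show ?thesis by blast
qed

text \<open>With \<open>d\<close> the average of the point masses at \<open>\<one>\<close> and
  \<open>g\<close>, the means \<open>conv m d\<close> form a closed left ideal, so one of them fixes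
  \<open>w\<close>. This makes \<open>w\<close> a midpoint; extremality gives that \<open>m\<close>
  and \<open>conv m (dirac g)\<close> both fix \<open>w\<close>. Commutativity moves
  \<open>dirac g\<close> to the front, hence \<open>g\<close> fixes \<open>w\<close>.\<close>

lemma abelian_amen:
  assumes comm: "\<And>x y. x \<in> carrier G \<Longrightarrow> y \<in> carrier G \<Longrightarrow> x \<otimes> y = y \<otimes> x"
  shows "amen (carrier G)"
proof -
  obtain w where "extreme_mean w" using extreme_mean_exists by blast
  then have w: "w \<in> means G"
    and J: "\<And>J. closed_left_ideal J \<Longrightarrow> \<exists>j\<in>J. conv j w = w"
    and ext: "\<And>m n t. m \<in> means G \<Longrightarrow> n \<in> means G \<Longrightarrow> 0 < t \<Longrightarrow> t < 1 \<Longrightarrow>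
       w = t *\<^sub>R conv m w + (1 - t) *\<^sub>R conv n w \<Longrightarrow> conv m w = w \<and> conv n w = w"
    unfolding extreme_mean_def by blast+
  have "conv (dirac g) w = w" if g: "g \<in> carrier G" for g
  proof -
    define d where "d = (1 / 2) *\<^sub>R dirac \<one> + (1 - 1 / 2) *\<^sub>R dirac g"
    have d: "d \<in> means G"
      unfolding d_def using dirac_means g by (intro convexD[OF convex_means]) auto
    have "\<exists>j\<in>(\<lambda>m. conv m d) ` means G. conv j w = w"
    proof (rule J, unfold closed_left_ideal_def, intro conjI ballI)
      show "closed ((\<lambda>m. conv m d) ` means G)"
        by (intro compact_imp_closed compact_continuous_image continuous_on_conv compact_means)
      show "conv m j \<in> (\<lambda>m. conv m d) ` means G" if "m \<in> means G" "j \<in> (\<lambda>m. conv m d) ` means G" for m j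
        using that d by (auto simp: conv_assoc[symmetric] conv_means)
    qed (use means_nonempty d conv_means in auto)
    then obtain m where m: "m \<in> means G" "conv (conv m d) w = w" by blast
    have one: "conv m (dirac \<one>) = m"
    proof
      fix \<phi> show "conv m (dirac \<one>) \<phi> = m \<phi>"
        by (cases "\<phi> \<in> bdd_fun G")
          (auto simp: conv_def dirac_def bdd_fun_translate mean_outside[OF m(1)] intro!: mean_cong[OF m(1)])
    qed
    have swap: "conv m (dirac g) = conv (dirac g) m"
    proof
      fix \<phi> show "conv m (dirac g) \<phi> = conv (dirac g) m \<phi>"
      proof (cases "\<phi> \<in> bdd_fun G")
        case True
        then have "conv m (dirac g) \<phi> = m (\<lambda>x. \<phi> (g \<otimes> x))"
          unfolding conv_def using g by (simp, intro mean_cong[OF m(1)])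
            (simp add: dirac_def bdd_fun_translate comm[of g])
        with True show ?thesis by (simp add: conv_dirac g m)
      qed (simp add: conv_def)
    qed
    have "w = (1 / 2) *\<^sub>R conv (conv m (dirac \<one>)) w + (1 - 1 / 2) *\<^sub>R conv (conv m (dirac g)) w"
      using m(2) unfolding d_def
      by (simp only: conv_affine_right[OF m(1) dirac_means[OF one_closed] dirac_means[OF g]] conv_affine)
    then have c: "conv (conv m (dirac \<one>)) w = w \<and> conv (conv m (dirac g)) w = w"
      using m g by (intro ext[of _ _ "1 / 2"] conv_means dirac_means) auto
    have "conv (dirac g) (conv m w) = w"
      using c m g w by (simp add: swap conv_assoc dirac_means)
    moreover have "conv m w = w" using c unfolding one by simp
    ultimately show ?thesis by metis
  qed
  then show ?thesis using w by (auto simp: amen_def stab_def)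
qed

section \<open>Invariant means against invariant finitely additive measures\<close>

lemma finite_amen:
  assumes H: "subgroup H G" and fin: "finite H"
  shows "amen H"
proof -
  have HC: "H \<subseteq> carrier G" by (rule subgroup.subset[OF H])
  have ne: "card H > 0" using fin subgroup.one_closed[OF H] by (auto simp: card_gt_0_iff)
  define m where "m \<phi> = (if \<phi> \<in> bdd_fun G then (\<Sum>x\<in>H. \<phi> x) / real (card H) else 0)" for \<phi> :: "'a \<Rightarrow> real"
  have m: "m \<in> means G"
  proof (rule meansI)
    fix \<phi> c assume b: "\<phi> \<in> bdd_fun G" "\<And>x. x \<in> carrier G \<Longrightarrow> \<phi> x \<le> c"
    then have "(\<Sum>x\<in>H. \<phi> x) \<le> real (card H) * c"
      using HC by (intro sum_bounded_above) auto
    then show "m \<phi> \<le> c" using b ne by (simp add: m_def field_simps)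
  qed (auto simp: m_def bdd_fun_add bdd_fun_cmult sum.distrib add_divide_distrib sum_distrib_left)
  have "H \<subseteq> stab m"
  proof
    fix g assume g: "g \<in> H"
    have bij: "bij_betw (\<lambda>y. g \<otimes> y) H H"
      by (rule bij_betw_byWitness[where f'="\<lambda>y. inv g \<otimes> y"])
        (use g H HC in \<open>auto simp: subgroup.m_closed subgroup.m_inv_closed m_assoc[symmetric] subset_iff\<close>)
    have "m (\<lambda>y. \<phi> (g \<otimes> y)) = m \<phi>" if "\<phi> \<in> bdd_fun G" for \<phi>
      using that bdd_fun_translate[OF that, of g] g HC sum.reindex_bij_betw[OF bij, of \<phi>]
      by (auto simp: m_def)
    then show "g \<in> stab m" using stab_iff[OF m] g HC by blast
  qed
  with m show ?thesis by (auto simp: amen_def)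
qed

text \<open>Integration against \<open>\<mu>\<close> is obtained from Hahn-Banach: a mean that
  annihilates every \<open>indicat_real A - \<mu> (A \<inter> H)\<close> must integrate indicators
  by \<open>\<mu>\<close>. Such a mean exists once no linear combination of these functions has
  negative supremum, which is the content of \<open>part\<close>.\<close>

lemma amenable_group_imp_amen:
  assumes H: "subgroup H G" and am: "amenable_group (G\<lparr>carrier := H\<rparr>)"
  shows "amen H"
proof -
  have HC: "H \<subseteq> carrier G" by (rule subgroup.subset[OF H])
  obtain \<mu> :: "'a set \<Rightarrow> real" where nonneg: "\<And>A. A \<subseteq> H \<Longrightarrow> 0 \<le> \<mu> A" and one: "\<mu> H = 1"
    and add: "\<And>A B. A \<subseteq> H \<Longrightarrow> B \<subseteq> H \<Longrightarrow> A \<inter> B = {} \<Longrightarrow> \<mu> (A \<union> B) = \<mu> A + \<mu> B"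
    and inv: "\<And>g A. g \<in> H \<Longrightarrow> A \<subseteq> H \<Longrightarrow> \<mu> (g <# A) = \<mu> A"
  proof -
    have eq: "g <#\<^bsub>G\<lparr>carrier := H\<rparr>\<^esub> A = g <# A" for g A by (simp add: l_coset_def)
    have c: "carrier (G\<lparr>carrier := H\<rparr>) = H" by simp
    from am[unfolded amenable_group_def eq c] show thesis
    proof (elim exE conjE)
      fix \<mu> :: "'a set \<Rightarrow> real"
      assume "\<forall>A\<subseteq>H. 0 \<le> \<mu> A" "\<mu> H = 1"
        "\<forall>A B. A \<subseteq> H \<longrightarrow> B \<subseteq> H \<longrightarrow> A \<inter> B = {} \<longrightarrow> \<mu> (A \<union> B) = \<mu> A + \<mu> B"
        "\<forall>g A. g \<in> H \<longrightarrow> A \<subseteq> H \<longrightarrow> \<mu> (g <# A) = \<mu> A"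
      then show thesis by (intro that[of \<mu>]) blast+
    qed
  qed
  have empty: "\<mu> {} = 0" using add[of "{}" "{}"] by simp
  \<comment> \<open>Monotonicity of the integral of a simple function whose sets may overlap. The
    induction cuts \<open>D\<close> along one set \<open>A b\<close>; on the part inside, the bound
    \<open>s\<close> drops to \<open>s - r b\<close>.\<close>
  have part: "(\<Sum>a\<in>t. r a * \<mu> (A a \<inter> D)) \<le> s * \<mu> D"
    if "finite t" "D \<subseteq> H" "\<And>x. x \<in> D \<Longrightarrow> (\<Sum>a\<in>t. r a * indicat_real (A a) x) \<le> s"
    for t :: "('a \<Rightarrow> real) set" and r :: "('a \<Rightarrow> real) \<Rightarrow> real" and A D s
    using that
  proof (induction t arbitrary: D s rule: finite_induct)
    case empty
    show ?case
    proof (cases "D = {}")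
      case False
      then have "0 \<le> s" using empty by auto
      then show ?thesis using nonneg[OF empty(1)] by simp
    qed (simp add: \<open>\<mu> {} = 0\<close>)
  next
    case (insert b t)
    have 1: "(\<Sum>a\<in>t. r a * \<mu> (A a \<inter> (D \<inter> A b))) \<le> (s - r b) * \<mu> (D \<inter> A b)"
    proof (rule insert.IH)
      show "D \<inter> A b \<subseteq> H" using insert by blast
      fix x assume x: "x \<in> D \<inter> A b"
      then have "(\<Sum>a\<in>insert b t. r a * indicat_real (A a) x) \<le> s" by (intro insert.prems) simp
      then show "(\<Sum>a\<in>t. r a * indicat_real (A a) x) \<le> s - r b"
        unfolding sum.insert[OF insert.hyps] using x by (simp only: indicator_def) simp
    qed
    have 2: "(\<Sum>a\<in>t. r a * \<mu> (A a \<inter> (D - A b))) \<le> s * \<mu> (D - A b)"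
    proof (rule insert.IH)
      show "D - A b \<subseteq> H" using insert by blast
      fix x assume x: "x \<in> D - A b"
      then have "(\<Sum>a\<in>insert b t. r a * indicat_real (A a) x) \<le> s" by (intro insert.prems) simp
      then show "(\<Sum>a\<in>t. r a * indicat_real (A a) x) \<le> s"
        unfolding sum.insert[OF insert.hyps] using x by (simp only: indicator_def) simp
    qed
    have 3: "\<mu> (B \<inter> D) = \<mu> (B \<inter> (D \<inter> A b)) + \<mu> (B \<inter> (D - A b))" for B
    proof -
      have "B \<inter> D = (B \<inter> (D \<inter> A b)) \<union> (B \<inter> (D - A b))" by blast
      then show ?thesis using insert.prems(1) add[of "B \<inter> (D \<inter> A b)" "B \<inter> (D - A b)"] by auto
    qed
    have 4: "\<mu> D = \<mu> (D \<inter> A b) + \<mu> (D - A b)" using 3[of D] by (simp add: Int_absorb1 Int_Diff)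
    have "A b \<inter> D = D \<inter> A b" by blast
    moreover have "(\<Sum>a\<in>t. r a * \<mu> (A a \<inter> D)) =
        (\<Sum>a\<in>t. r a * \<mu> (A a \<inter> (D \<inter> A b))) + (\<Sum>a\<in>t. r a * \<mu> (A a \<inter> (D - A b)))"
      by (simp only: 3[of "A _"] ring_distribs sum.distrib)
    ultimately show ?case using 1 2 insert.hyps unfolding 4 by (simp add: algebra_simps)
  qed
  define B where "B = {(\<lambda>x. indicat_real A x - \<mu> (A \<inter> H)) | A. A \<subseteq> carrier G}"
  have BE: "B \<subseteq> bdd_fun G"
    by (auto simp: B_def intro!: bdd_fun_diff bdd_fun_indicat bdd_fun_const)
  have sup: "0 \<le> Sup (v ` carrier G)" if v: "v \<in> span B" for v
  proof -
    define s where "s = Sup (v ` carrier G)"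
    have "v \<in> bdd_fun G" using v BE span_minimal[OF _ subspace_bdd_fun] by blast
    then obtain c where c: "\<And>x. x \<in> carrier G \<Longrightarrow> \<bar>v x\<bar> \<le> c" by (metis bdd_funE)
    have "bdd_above (v ` carrier G)"
      by (rule bdd_aboveI2[of _ _ c]) (use c in \<open>auto simp: abs_le_iff\<close>)
    then have vs: "v x \<le> s" if "x \<in> carrier G" for x
      unfolding s_def using that by (intro cSup_upper) auto
    obtain t r where t: "finite t" "t \<subseteq> B" "v = (\<Sum>a\<in>t. r a *\<^sub>R a)"
      using v unfolding span_explicit by blast
    have "\<forall>a\<in>t. \<exists>A. a = (\<lambda>x. indicat_real A x - \<mu> (A \<inter> H))" using t(2) by (auto simp: B_def)
    then obtain A where A: "\<And>a. a \<in> t \<Longrightarrow> a = (\<lambda>x. indicat_real (A a) x - \<mu> (A a \<inter> H))" by metis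
    have vx: "v x = (\<Sum>a\<in>t. r a * indicat_real (A a) x) - (\<Sum>a\<in>t. r a * \<mu> (A a \<inter> H))" for x
    proof -
      have "v x = (\<Sum>a\<in>t. r a * a x)"
        unfolding t(3) by (induction t rule: infinite_finite_induct) auto
      also have "\<dots> = (\<Sum>a\<in>t. r a * indicat_real (A a) x - r a * \<mu> (A a \<inter> H))"
      proof (rule sum.cong[OF refl])
        fix a assume "a \<in> t"
        then have "a x = indicat_real (A a) x - \<mu> (A a \<inter> H)" using fun_cong[OF A, of a x] by simp
        then show "r a * a x = r a * indicat_real (A a) x - r a * \<mu> (A a \<inter> H)"
          by (simp add: right_diff_distrib)
      qed
      finally show ?thesis by (simp add: sum_subtractf)
    qed
    have "(\<Sum>a\<in>t. r a * \<mu> (A a \<inter> H)) \<le> (s + (\<Sum>a\<in>t. r a * \<mu> (A a \<inter> H))) * \<mu> H"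
    proof (rule part[OF t(1) order_refl])
      fix x assume "x \<in> H"
      then show "(\<Sum>a\<in>t. r a * indicat_real (A a) x) \<le> s + (\<Sum>a\<in>t. r a * \<mu> (A a \<inter> H))"
        using vs[of x] HC vx[of x] by auto
    qed
    then show ?thesis by (simp add: one s_def)
  qed
  \<comment> \<open>Nonnegativity on a subspace forces vanishing on it, because \<open>- v\<close>
    belongs to the span as well.\<close>
  obtain m where m: "m \<in> means G" and m0: "\<And>v. v \<in> span B \<Longrightarrow> 0 \<le> m v"
  proof (rule dominated_separate[OF subspace_bdd_fun sublinear_sup, of "span B" 0])
    show "span B \<subseteq> bdd_fun G" using BE span_minimal[OF _ subspace_bdd_fun] by blast
    show "span B \<noteq> {}" using span_zero by blast
    show "convex (span B)" by (rule subspace_imp_convex[OF subspace_span])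
  qed (use sup that in \<open>auto simp: means_def\<close>)
  have mind: "m (indicat_real A) = \<mu> (A \<inter> H)" if "A \<subseteq> carrier G" for A
  proof -
    let ?v = "\<lambda>x. indicat_real A x - \<mu> (A \<inter> H)"
    have v: "?v \<in> span B" using that by (intro span_base) (auto simp: B_def)
    then have "- ?v \<in> span B" by (rule span_neg)
    then have "0 \<le> m (- ?v)" "0 \<le> m ?v" using m0 v by auto
    moreover have "m (- ?v) = - m ?v"
      using v BE span_minimal[OF _ subspace_bdd_fun, of B]
      by (intro dominated_minus[OF m[unfolded means_def] subspace_bdd_fun]) blast
    ultimately have "m ?v = 0" by simp
    then show ?thesis using mean_diff[OF m bdd_fun_indicat bdd_fun_const] mean_const[OF m] by simp
  qed
  have "H \<subseteq> stab m"
  proof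
    fix g assume g: "g \<in> H"
    then have gC: "g \<in> carrier G" using HC by blast
    have "conv (dirac g) m = m"
    proof (rule means_eqI)
      fix A assume A: "A \<subseteq> carrier G"
      let ?A = "{y \<in> carrier G. g \<otimes> y \<in> A}"
      have "conv (dirac g) m (indicat_real A) = m (\<lambda>y. indicat_real A (g \<otimes> y))"
        by (rule conv_dirac[OF gC m bdd_fun_indicat])
      also have "\<dots> = m (indicat_real ?A)"
        by (rule mean_cong[OF m]) (auto simp: indicator_def)
      also have "\<dots> = \<mu> (?A \<inter> H)" by (rule mind) auto
      also have "?A \<inter> H = inv g <# (A \<inter> H)"
      proof (intro equalityI subsetI)
        fix y assume y: "y \<in> ?A \<inter> H"
        then have "g \<otimes> y \<in> A \<inter> H" using g H by (auto intro: subgroup.m_closed)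
        moreover have "y = inv g \<otimes> (g \<otimes> y)" using y gC by (simp add: m_assoc[symmetric])
        ultimately show "y \<in> inv g <# (A \<inter> H)" unfolding l_coset_def by blast
      next
        fix y assume "y \<in> inv g <# (A \<inter> H)"
        then obtain a where a: "a \<in> A" "a \<in> H" "y = inv g \<otimes> a" by (auto simp: l_coset_def)
        moreover have "g \<otimes> (inv g \<otimes> a) = a" using a HC gC by (auto simp: m_assoc[symmetric])
        ultimately show "y \<in> ?A \<inter> H"
          using g H HC gC by (auto intro: subgroup.m_closed subgroup.m_inv_closed)
      qed
      also have "\<mu> (inv g <# (A \<inter> H)) = \<mu> (A \<inter> H)"
        using g H by (intro inv) (auto intro: subgroup.m_inv_closed)
      finally show "conv (dirac g) m (indicat_real A) = m (indicat_real A)" using mind[OF A] by simp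
    qed (use m gC in \<open>auto intro: conv_means dirac_means\<close>)
    then show "g \<in> stab m" using gC by (simp add: stab_def)
  qed
  with m show ?thesis by (auto simp: amen_def)
qed

text \<open>The mean on \<open>G\<close> is pushed forward along an \<open>H\<close>-equivariant map
  \<open>p\<close> from \<open>G\<close> to \<open>H\<close>.\<close>

lemma amen_imp_amenable_group:
  assumes H: "subgroup H G" and am: "amen H"
  shows "amenable_group (G\<lparr>carrier := H\<rparr>)"
proof -
  have HC: "H \<subseteq> carrier G" by (rule subgroup.subset[OF H])
  obtain m where m: "m \<in> means G" "H \<subseteq> stab m" using am by (auto simp: amen_def)
  \<comment> \<open>The chosen representative depends only on the right coset of \<open>x\<close>;
    it is unchanged when \<open>x\<close> is multiplied on the left by \<open>g \<in> H\<close>, so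
    \<open>p (g \<otimes> x) = g \<otimes> p x\<close>.\<close>
  define p where "p x = x \<otimes> inv (SOME y. y \<in> H #> x)" for x
  have p: "p x \<in> H" if x: "x \<in> carrier G" for x
  proof -
    have "(SOME y. y \<in> H #> x) \<in> H #> x" using rcos_self[OF x H] by (rule someI)
    then obtain h where h: "h \<in> H" "(SOME y. y \<in> H #> x) = h \<otimes> x" by (auto simp: r_coset_def)
    have "p x = inv h"
      unfolding p_def h(2) using h(1) HC x by (auto simp: inv_mult_group m_assoc[symmetric] subset_iff)
    then show ?thesis using subgroup.m_inv_closed[OF H h(1)] by simp
  qed
  have pm: "p (g \<otimes> x) = g \<otimes> p x" if g: "g \<in> H" and x: "x \<in> carrier G" for g x
  proof -
    have gC: "g \<in> carrier G" using g HC by blast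
    have "H #> (g \<otimes> x) = H #> x"
      using coset_mult_assoc[OF HC gC x] coset_join2[OF gC H g] by simp
    moreover have "(SOME y. y \<in> H #> x) \<in> carrier G"
      using someI[of "\<lambda>y. y \<in> H #> x", OF rcos_self[OF x H]] r_coset_subset_G[OF HC x] by blast
    ultimately show ?thesis using gC x by (simp add: p_def m_assoc)
  qed
  define \<mu> where "\<mu> A = m (\<lambda>x. indicat_real A (p x))" for A
  have b: "(\<lambda>x. indicat_real A (p x)) \<in> bdd_fun G" for A
    by (rule bdd_funI[of _ _ 1]) (auto simp: indicator_def)
  have "\<mu> (g <# A) = \<mu> A" if g: "g \<in> H" and A: "A \<subseteq> H" for g A
  proof -
    have gC: "g \<in> carrier G" using g HC by blast
    have ig: "inv g \<in> H" using subgroup.m_inv_closed[OF H g] .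
    have "\<mu> (g <# A) = m (\<lambda>x. indicat_real A (p (inv g \<otimes> x)))"
      unfolding \<mu>_def
    proof (rule mean_cong[OF m(1)])
      fix x assume x: "x \<in> carrier G"
      have "p x \<in> g <# A \<longleftrightarrow> inv g \<otimes> p x \<in> A"
      proof
        assume "p x \<in> g <# A"
        then obtain a where "a \<in> A" "p x = g \<otimes> a" by (auto simp: l_coset_def)
        moreover have "a \<in> carrier G" using \<open>a \<in> A\<close> A HC by blast
        ultimately show "inv g \<otimes> p x \<in> A" using gC by (simp add: m_assoc[symmetric])
      next
        assume a: "inv g \<otimes> p x \<in> A"
        have "p x = g \<otimes> (inv g \<otimes> p x)" using gC p[OF x] HC by (auto simp: m_assoc[symmetric])
        with a show "p x \<in> g <# A" unfolding l_coset_def by blast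
      qed
      then show "indicat_real (g <# A) (p x) = indicat_real A (p (inv g \<otimes> x))"
        using pm[OF ig x] by (simp add: indicator_def)
    qed
    also have "\<dots> = \<mu> A"
    proof -
      have "inv g \<in> carrier G" "inv g \<in> stab m" using ig m(2) HC by blast+
      with stab_iff[OF m(1), of "inv g"] show ?thesis unfolding \<mu>_def using bspec[OF _ b] by simp
    qed
    finally show ?thesis .
  qed
  moreover have "\<mu> (A \<union> B) = \<mu> A + \<mu> B" if "A \<inter> B = {}" for A B
  proof -
    have "\<mu> (A \<union> B) = m (\<lambda>x. indicat_real A (p x) + indicat_real B (p x))"
      unfolding \<mu>_def using that by (intro mean_cong[OF m(1)]) (auto simp: indicator_def)
    then show ?thesis unfolding \<mu>_def using mean_add[OF m(1) b b] by simp
  qed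
  moreover have "0 \<le> \<mu> A" for A
    unfolding \<mu>_def by (rule mean_ge[OF m(1) b]) simp
  moreover have "\<mu> H = 1"
    unfolding \<mu>_def using mean_cong[OF m(1), of "\<lambda>x. indicat_real H (p x)" "\<lambda>_. 1"] p mean_const[OF m(1)]
    by simp
  ultimately show ?thesis
    unfolding amenable_group_def l_coset_def by (intro exI[of _ \<mu>]) simp
qed

lemma amen_iff: "subgroup H G \<Longrightarrow> amen H \<longleftrightarrow> amenable_group (G\<lparr>carrier := H\<rparr>)"
  using amen_imp_amenable_group amenable_group_imp_amen by blast

text \<open>Convolving invariant means gives a mean fixed by any finite family of amenable normal
  subgroups, and compactness extends this to all of them at once.\<close>

lemma amenable_radical_exists:
  "\<exists>R. R \<lhd> G \<and> amen R \<and> (\<forall>N. N \<lhd> G \<longrightarrow> amen N \<longrightarrow> N \<subseteq> R)"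
proof -
  define \<N> where "\<N> = {N. N \<lhd> G \<and> amen N}"
  have NC: "N \<subseteq> carrier G" if "N \<in> \<N>" for N
    using that by (auto simp: \<N>_def normal_def subgroup.subset)
  have nm: "inv x \<otimes> h \<otimes> x \<in> N" if "N \<in> \<N>" "x \<in> carrier G" "h \<in> N" for N x h
    using that normal.inv_op_closed1 by (auto simp: \<N>_def)
  have fin: "\<exists>m\<in>means G. \<forall>N\<in>\<F>. N \<subseteq> stab m" if "finite \<F>" "\<F> \<subseteq> \<N>" for \<F>
    using that
  proof (induction \<F> rule: finite_induct)
    case empty
    then show ?case using means_nonempty by auto
  next
    case (insert N \<F>)
    then obtain m where m: "m \<in> means G" "\<And>N. N \<in> \<F> \<Longrightarrow> N \<subseteq> stab m" by auto
    obtain n where n: "n \<in> means G" "N \<subseteq> stab n" using insert.prems by (auto simp: \<N>_def amen_def)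
    have "N \<subseteq> stab (conv m n)" using insert.prems by (intro stab_conv_right m n nm) auto
    with m n stab_conv_left[OF m(1) n(1)] show ?case
      by (intro bexI[of _ "conv m n"] conv_means) auto
  qed
  define I where "I = {m \<in> means G. \<forall>N\<in>\<N>. N \<subseteq> stab m}"
  have "means G \<inter> (\<Inter>N\<in>\<N>. {m \<in> means G. N \<subseteq> stab m}) \<noteq> {}"
  proof (rule compact_imp_fip_image[OF compact_means])
    show "closed {m \<in> means G. N \<subseteq> stab m}" if "N \<in> \<N>" for N
      using closed_means_stab[OF NC[OF that]] .
    show "means G \<inter> (\<Inter>N\<in>\<F>. {m \<in> means G. N \<subseteq> stab m}) \<noteq> {}" if "finite \<F>" "\<F> \<subseteq> \<N>" for \<F>
      using fin[OF that] by blast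
  qed
  then obtain m0 where m0: "m0 \<in> I" by (auto simp: I_def)
  \<comment> \<open>The set \<open>I\<close> of jointly invariant means is mapped to itself by left
    translations, since conjugation preserves every \<open>N\<close>. Hence the intersection of the
    stabilisers is normal; any one mean in \<open>I\<close> witnesses that it is amenable.\<close>
  define R where "R = (\<Inter>m\<in>I. stab m)"
  have sub: "subgroup R G"
    unfolding R_def using m0 by (intro subgroups_Inter) (auto simp: I_def intro: subgroup_stab)
  have "x \<otimes> h \<otimes> inv x \<in> R" if x: "x \<in> carrier G" and h: "h \<in> R" for x h
    unfolding R_def
  proof
    fix m assume m: "m \<in> I"
    then have mm: "m \<in> means G" by (simp add: I_def)
    have "N \<subseteq> stab (conv (dirac (inv x)) m)" if N: "N \<in> \<N>" for N
      using m N x by (intro stab_conv_right dirac_means nm) (auto simp: I_def)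
    then have "conv (dirac (inv x)) m \<in> I"
      using mm x by (auto simp: I_def conv_means dirac_means)
    then have h': "h \<in> stab (conv (dirac (inv x)) m)" using h by (auto simp: R_def)
    have hC: "h \<in> carrier G" using h subgroup.subset[OF sub] by blast
    have "conv (dirac (x \<otimes> h \<otimes> inv x)) m = conv (dirac x) (conv (dirac h) (conv (dirac (inv x)) m))"
      using x hC mm by (simp add: conv_assoc[symmetric] dirac_means conv_means conv_dirac_dirac m_assoc)
    also have "\<dots> = conv (dirac x) (conv (dirac (inv x)) m)" using h' by (simp add: stab_def)
    also have "\<dots> = m"
      using x mm by (simp add: conv_assoc[symmetric] dirac_means conv_dirac_dirac conv_dirac_one)
    finally show "x \<otimes> h \<otimes> inv x \<in> stab m" using x hC by (simp add: stab_def)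
  qed
  with sub have "R \<lhd> G" by (simp add: normal_inv_iff)
  moreover have "amen R" using m0 by (auto simp: amen_def R_def I_def)
  moreover have "N \<subseteq> R" if "N \<lhd> G" "amen N" for N
    using that by (auto simp: R_def I_def \<N>_def)
  ultimately show ?thesis by blast
qed

section \<open>The amenable radical\<close>

text \<open>The existence of a largest amenable normal subgroup makes the definite description in
  \<open>amenable_radical\<close> denote, and the rest of the proof can speak of amenable normal
  subgroups only.\<close>

lemma amenable_radical_trivial_iff:
  "amenable_radical G = {\<one>} \<longleftrightarrow> (\<forall>N. N \<lhd> G \<longrightarrow> amen N \<longrightarrow> N = {\<one>})"
proof -
  obtain R where R: "R \<lhd> G" "amen R" and max: "\<And>N. N \<lhd> G \<Longrightarrow> amen N \<Longrightarrow> N \<subseteq> R"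
    using amenable_radical_exists by blast
  have iff: "N \<lhd> G \<and> amenable_group (G\<lparr>carrier := N\<rparr>) \<longleftrightarrow> N \<lhd> G \<and> amen N" for N
    using amen_iff[OF normal_imp_subgroup, of N] by blast
  have "amenable_radical G = R"
    unfolding amenable_radical_def
  proof (rule the_equality)
    show "R \<lhd> G \<and> amenable_group (G\<lparr>carrier := R\<rparr>) \<and>
        (\<forall>M. M \<lhd> G \<and> amenable_group (G\<lparr>carrier := M\<rparr>) \<longrightarrow> M \<subseteq> R)"
      using R max iff by blast
    fix N assume "N \<lhd> G \<and> amenable_group (G\<lparr>carrier := N\<rparr>) \<and>
        (\<forall>M. M \<lhd> G \<and> amenable_group (G\<lparr>carrier := M\<rparr>) \<longrightarrow> M \<subseteq> N)"
    then show "N = R" using R max iff by blast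
  qed
  moreover have "\<one> \<in> N" if "N \<lhd> G" for N
    using subgroup.one_closed[OF normal_imp_subgroup[OF that]] .
  ultimately show ?thesis using R max by blast
qed

section \<open>Conjugates, and subgroups with finitely many of them\<close>

definition conjugate :: "'a \<Rightarrow> 'a set \<Rightarrow> 'a set" where
  "conjugate g A = (\<lambda>h. g \<otimes> h \<otimes> inv g) ` A"

lemma conj_conj:
  assumes "g \<in> carrier G" "h \<in> carrier G" "A \<subseteq> carrier G"
  shows "conjugate g (conjugate h A) = conjugate (g \<otimes> h) A"
  unfolding conjugate_def image_image
  by (rule image_cong) (use assms in \<open>auto simp: inv_mult_group m_assoc subset_iff\<close>)

lemma conj_one: "A \<subseteq> carrier G \<Longrightarrow> conjugate \<one> A = A"
  unfolding conjugate_def by (force simp: subset_iff image_iff)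

lemma conj_subset: "g \<in> carrier G \<Longrightarrow> A \<subseteq> carrier G \<Longrightarrow> conjugate g A \<subseteq> carrier G"
  by (auto simp: conjugate_def)

lemma mem_conj_iff:
  assumes "g \<in> carrier G" "A \<subseteq> carrier G" "x \<in> carrier G"
  shows "x \<in> conjugate g A \<longleftrightarrow> inv g \<otimes> x \<otimes> g \<in> A"
proof
  assume "x \<in> conjugate g A"
  then obtain h where "h \<in> A" "x = g \<otimes> h \<otimes> inv g" by (auto simp: conjugate_def)
  moreover have "h \<in> carrier G" using \<open>h \<in> A\<close> assms by blast
  ultimately have "inv g \<otimes> x \<otimes> g = h" using assms(1) by (simp add: m_assoc) (simp add: m_assoc[symmetric])
  then show "inv g \<otimes> x \<otimes> g \<in> A" using \<open>h \<in> A\<close> by simp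
next
  assume a: "inv g \<otimes> x \<otimes> g \<in> A"
  have "x = g \<otimes> (inv g \<otimes> x \<otimes> g) \<otimes> inv g"
    using assms(1,3) by (simp add: m_assoc) (simp add: m_assoc[symmetric])
  with a show "x \<in> conjugate g A" unfolding conjugate_def by (rule rev_image_eqI)
qed

lemma subgroup_conj:
  assumes g: "g \<in> carrier G" and H: "subgroup H G"
  shows "subgroup (conjugate g H) G"
proof -
  have HC: "H \<subseteq> carrier G" by (rule subgroup.subset[OF H])
  have i: "inv g \<otimes> (x \<otimes> y) \<otimes> g = (inv g \<otimes> x \<otimes> g) \<otimes> (inv g \<otimes> y \<otimes> g)"
    if "x \<in> carrier G" "y \<in> carrier G" for x y
    using that g by (simp add: m_assoc) (simp add: m_assoc[symmetric])
  show ?thesis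
  proof (rule subgroupI)
    show sub: "conjugate g H \<subseteq> carrier G" using conj_subset[OF g HC] .
    show "conjugate g H \<noteq> {}" using subgroup.one_closed[OF H] by (auto simp: conjugate_def)
    show "inv x \<in> conjugate g H" if "x \<in> conjugate g H" for x
    proof -
      have x: "x \<in> carrier G" using sub that by blast
      have "inv (inv g \<otimes> x \<otimes> g) \<in> H"
        using that mem_conj_iff[OF g HC x] subgroup.m_inv_closed[OF H] by blast
      moreover have "inv (inv g \<otimes> x \<otimes> g) = inv g \<otimes> inv x \<otimes> g"
        using g x by (simp add: inv_mult_group m_assoc)
      ultimately show ?thesis using mem_conj_iff[OF g HC, of "inv x"] x by simp
    qed
    show "x \<otimes> y \<in> conjugate g H" if "x \<in> conjugate g H" "y \<in> conjugate g H" for x y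
    proof -
      have xy: "x \<in> carrier G" "y \<in> carrier G" using sub that by blast+
      then show ?thesis
        using that mem_conj_iff[OF g HC] subgroup.m_closed[OF H] i[OF xy] by simp
    qed
  qed
qed

lemma amen_conj:
  assumes g: "g \<in> carrier G" and H: "H \<subseteq> carrier G" and am: "amen H"
  shows "amen (conjugate g H)"
proof -
  obtain m where m: "m \<in> means G" "H \<subseteq> stab m" using am by (auto simp: amen_def)
  have "g \<otimes> h \<otimes> inv g \<in> stab (conv (dirac g) m)" if h: "h \<in> H" for h
  proof -
    have hC: "h \<in> carrier G" using h H by blast
    have "conv (dirac (g \<otimes> h \<otimes> inv g)) (conv (dirac g) m) = conv (dirac g) (conv (dirac h) m)"
      using g hC m(1) by (simp add: conv_assoc[symmetric] dirac_means conv_means conv_dirac_dirac m_assoc)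
    also have "\<dots> = conv (dirac g) m" using h m(2) by (auto simp: stab_def)
    finally show ?thesis using g hC by (simp add: stab_def)
  qed
  then show ?thesis
    using m g unfolding amen_def conjugate_def by (intro bexI[of _ "conv (dirac g) m"] conv_means dirac_means) auto
qed

lemma normal_conjI:
  assumes "subgroup N G" "\<And>g. g \<in> carrier G \<Longrightarrow> conjugate g N \<subseteq> N"
  shows "N \<lhd> G"
  unfolding normal_inv_iff using assms by (force simp: conjugate_def)

lemma conj_Int_subset: "conjugate g (A \<inter> B) \<subseteq> conjugate g A \<inter> conjugate g B"
  by (auto simp: conjugate_def)

text \<open>Let \<open>L\<close> be the kernel of the action of \<open>G\<close> on the finite set
  \<open>Y\<close> of conjugates. The amenable radical of \<open>L\<close> is normal in
  \<open>G\<close>, so it is trivial, and therefore so is \<open>H \<inter> L\<close>, which is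
  normal in \<open>L\<close>. As \<open>H\<close> and \<open>L\<close> normalise each other they
  commute, so \<open>H\<close> lies in the centraliser \<open>M\<close> of \<open>L\<close>. The
  group \<open>M \<inter> L\<close> is abelian and normal, hence trivial; so \<open>M\<close> acts
  faithfully on \<open>Y\<close> and is finite, and a finite normal subgroup is trivial.\<close>

lemma finite_conjugates_trivial:
  assumes triv: "\<And>N. N \<lhd> G \<Longrightarrow> amen N \<Longrightarrow> N = {\<one>}"
    and H: "subgroup H G" "amen H"
    and fin: "finite {conjugate g H | g. g \<in> carrier G}"
  shows "H = {\<one>}"
proof -
  have HC: "H \<subseteq> carrier G" by (rule subgroup.subset[OF H(1)])
  define Y where "Y = {conjugate g H | g. g \<in> carrier G}"
  have YC: "K \<subseteq> carrier G" if "K \<in> Y" for K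
    using that conj_subset HC by (auto simp: Y_def)
  have Yconj: "conjugate g K \<in> Y" if "K \<in> Y" "g \<in> carrier G" for K g
    using that HC by (auto simp: Y_def conj_conj)
  have HY: "H \<in> Y" using conj_one[OF HC] by (auto simp: Y_def intro!: exI[of _ \<one>])
  define L where "L = {l \<in> carrier G. \<forall>K\<in>Y. conjugate l K = K}"
  have LC: "L \<subseteq> carrier G" by (auto simp: L_def)
  have L: "subgroup L G"
  proof (rule subgroupI[OF LC])
    show "L \<noteq> {}" using conj_one YC by (auto simp: L_def)
    show "inv l \<in> L" if "l \<in> L" for l
    proof -
      have "conjugate (inv l) K = K" if K: "K \<in> Y" for K
      proof -
        have "conjugate (inv l) (conjugate l K) = K"
          using \<open>l \<in> L\<close> YC[OF K] by (simp add: L_def conj_conj conj_one)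
        moreover have "conjugate l K = K" using \<open>l \<in> L\<close> K by (simp add: L_def)
        ultimately show ?thesis by simp
      qed
      then show ?thesis using that by (simp add: L_def)
    qed
    show "k \<otimes> l \<in> L" if kl: "k \<in> L" "l \<in> L" for k l
    proof -
      have "conjugate (k \<otimes> l) K = K" if K: "K \<in> Y" for K
        using kl K conj_conj[of k l K] YC[OF K] by (simp add: L_def)
      then show ?thesis using kl by (simp add: L_def)
    qed
  qed
  have Ln: "g \<otimes> l \<otimes> inv g \<in> L" if g: "g \<in> carrier G" and l: "l \<in> L" for g l
  proof -
    have lC: "l \<in> carrier G" using l LC by blast
    have "conjugate (g \<otimes> l \<otimes> inv g) K = K" if K: "K \<in> Y" for K
    proof -
      have "conjugate (g \<otimes> l \<otimes> inv g) K = conjugate g (conjugate l (conjugate (inv g) K))"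
        using g lC YC[OF K] by (simp add: conj_conj conj_subset m_assoc)
      also have "conjugate l (conjugate (inv g) K) = conjugate (inv g) K"
        using l Yconj[OF K, of "inv g"] g by (simp add: L_def)
      also have "conjugate g (conjugate (inv g) K) = K"
        using g YC[OF K] by (simp add: conj_conj conj_one)
      finally show ?thesis .
    qed
    then show ?thesis using g lC by (simp add: L_def)
  qed
  \<comment> \<open>The radical of \<open>L\<close> is needed, so the development is instantiated
    for \<open>L\<close> as a group of its own. The equivalences \<open>subL\<close>,
    \<open>normL\<close> and \<open>amenL\<close> translate its notions back to
    \<open>G\<close>.\<close>
  interpret L: group "G\<lparr>carrier := L\<rparr>" by (rule subgroup_imp_group[OF L])
  have invL: "inv\<^bsub>G\<lparr>carrier := L\<rparr>\<^esub> l = inv l" if "l \<in> L" for l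
    using m_inv_consistent[OF L that] .
  have subL: "subgroup N (G\<lparr>carrier := L\<rparr>) \<longleftrightarrow> subgroup N G \<and> N \<subseteq> L" for N
    using subgroup_incl[OF _ L, of N] incl_subgroup[OF L, of N] subgroup.subset[of N "G\<lparr>carrier := L\<rparr>"] by auto
  have normL: "N \<lhd> G\<lparr>carrier := L\<rparr> \<longleftrightarrow> subgroup N G \<and> N \<subseteq> L \<and> (\<forall>l\<in>L. conjugate l N \<subseteq> N)" for N
    unfolding L.normal_inv_iff subL by (auto simp: conjugate_def invL)
  have amenL: "L.amen N \<longleftrightarrow> amen N" if "subgroup N G" "N \<subseteq> L" for N
    using L.amen_iff[of N] amen_iff[of N] that subL by simp
  obtain R where R: "R \<lhd> G\<lparr>carrier := L\<rparr>" "L.amen R"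
    and max: "\<And>N. N \<lhd> G\<lparr>carrier := L\<rparr> \<Longrightarrow> L.amen N \<Longrightarrow> N \<subseteq> R"
    using L.amenable_radical_exists by auto
  have R': "subgroup R G" "R \<subseteq> L" "\<And>l. l \<in> L \<Longrightarrow> conjugate l R \<subseteq> R"
    using R(1) unfolding normL by auto
  have amR: "amen R" using R(2) amenL[OF R'(1,2)] by simp
  note R' = R' amR
  have RC: "R \<subseteq> carrier G" using R' LC by blast
  \<comment> \<open>The radical is characteristic: conjugation by \<open>g\<close> is an
    automorphism of the normal subgroup \<open>L\<close>, so it sends \<open>R\<close> to another
    amenable normal subgroup of \<open>L\<close>, which maximality puts inside
    \<open>R\<close>.\<close>
  have "conjugate g R \<subseteq> R" if g: "g \<in> carrier G" for g
  proof -
    have s: "subgroup (conjugate g R) G" "conjugate g R \<subseteq> L" "amen (conjugate g R)"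
      using subgroup_conj[OF g R'(1)] amen_conj[OF g RC amR] Ln[OF g] R'(2) by (auto simp: conjugate_def)
    have "conjugate l (conjugate g R) \<subseteq> conjugate g R" if l: "l \<in> L" for l
    proof -
      have lC: "l \<in> carrier G" using l LC by blast
      have l': "inv g \<otimes> l \<otimes> g \<in> L" using Ln[of "inv g" l] g l by simp
      have "conjugate l (conjugate g R) = conjugate (l \<otimes> g) R" using g lC RC by (simp add: conj_conj)
      also have "l \<otimes> g = g \<otimes> (inv g \<otimes> l \<otimes> g)" using g lC by (simp add: m_assoc[symmetric])
      also have "conjugate \<dots> R = conjugate g (conjugate (inv g \<otimes> l \<otimes> g) R)"
        using g lC RC by (simp add: conj_conj)
      also have "\<dots> \<subseteq> conjugate g R" using R'(3)[OF l'] unfolding conjugate_def[of g] by (rule image_mono)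
      finally show ?thesis .
    qed
    with s have "conjugate g R \<lhd> G\<lparr>carrier := L\<rparr>" unfolding normL by blast
    then show ?thesis using max amenL[OF s(1,2)] s(3) by blast
  qed
  then have "R \<lhd> G" by (rule normal_conjI[OF R'(1)])
  then have R1: "R = {\<one>}" using triv R'(4) by blast
  have HL: "H \<inter> L \<subseteq> {\<one>}"
  proof -
    have s: "subgroup (H \<inter> L) G" using H(1) L by (rule subgroups_Inter_pair)
    have "conjugate l (H \<inter> L) \<subseteq> H \<inter> L" if l: "l \<in> L" for l
    proof -
      have "conjugate l H = H" using l HY by (simp add: L_def)
      moreover have "conjugate l L \<subseteq> L" using l LC Ln by (auto simp: conjugate_def)
      ultimately show ?thesis using conj_Int_subset[of l H L] by blast
    qed
    with s have "H \<inter> L \<lhd> G\<lparr>carrier := L\<rparr>" unfolding normL by blast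
    moreover have "L.amen (H \<inter> L)" using amenL[OF s] amen_mono[OF H(2)] by blast
    ultimately show ?thesis using max R1 by blast
  qed
  define M where "M = {g \<in> carrier G. \<forall>l\<in>L. g \<otimes> l = l \<otimes> g}"
  have MC: "M \<subseteq> carrier G" by (auto simp: M_def)
  have M: "subgroup M G"
  proof (rule subgroupI[OF MC])
    show "M \<noteq> {}" using LC by (auto simp: M_def intro!: exI[of _ \<one>])
    show "inv g \<in> M" if g: "g \<in> M" for g
    proof -
      have "inv g \<otimes> l = l \<otimes> inv g" if l: "l \<in> L" for l
      proof -
        have c: "g \<in> carrier G" "l \<in> carrier G" using g l LC by (auto simp: M_def)
        have "g \<otimes> l = l \<otimes> g" using g l by (simp add: M_def)
        moreover have "inv g \<otimes> (g \<otimes> l) = l" using c by (simp add: m_assoc[symmetric])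
        ultimately have "l = inv g \<otimes> l \<otimes> g" using c by (simp add: m_assoc)
        then have "l \<otimes> inv g = inv g \<otimes> l \<otimes> g \<otimes> inv g" by simp
        also have "\<dots> = inv g \<otimes> l" using c by (simp add: m_assoc)
        finally show ?thesis by simp
      qed
      then show ?thesis using g by (simp add: M_def)
    qed
    show "g \<otimes> h \<in> M" if gh: "g \<in> M" "h \<in> M" for g h
    proof -
      have "g \<otimes> h \<otimes> l = l \<otimes> (g \<otimes> h)" if l: "l \<in> L" for l
      proof -
        have c: "g \<in> carrier G" "h \<in> carrier G" "l \<in> carrier G" using gh l LC by (auto simp: M_def)
        have "g \<otimes> l = l \<otimes> g" "h \<otimes> l = l \<otimes> h" using gh l by (auto simp: M_def)
        then show ?thesis using c by (metis m_assoc)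
      qed
      then show ?thesis using gh by (simp add: M_def)
    qed
  qed
  have Mn: "g \<otimes> x \<otimes> inv g \<in> M" if g: "g \<in> carrier G" and x: "x \<in> M" for g x
  proof -
    have xC: "x \<in> carrier G" using x MC by blast
    have "(g \<otimes> x \<otimes> inv g) \<otimes> l = l \<otimes> (g \<otimes> x \<otimes> inv g)" if l: "l \<in> L" for l
    proof -
      have lC: "l \<in> carrier G" using l LC by blast
      have l': "inv g \<otimes> l \<otimes> g \<in> L" using Ln[of "inv g" l] g l by simp
      have "(g \<otimes> x \<otimes> inv g) \<otimes> l = g \<otimes> (x \<otimes> (inv g \<otimes> l \<otimes> g)) \<otimes> inv g"
        using g xC lC by (simp add: m_assoc)
      also have "x \<otimes> (inv g \<otimes> l \<otimes> g) = (inv g \<otimes> l \<otimes> g) \<otimes> x" using x l' by (simp add: M_def)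
      also have "g \<otimes> ((inv g \<otimes> l \<otimes> g) \<otimes> x) \<otimes> inv g = l \<otimes> (g \<otimes> x \<otimes> inv g)"
        using g xC lC by (simp add: m_assoc[symmetric])
      finally show ?thesis .
    qed
    then show ?thesis using g xC by (simp add: M_def)
  qed
  \<comment> \<open>The commutator of \<open>h\<close> and \<open>l\<close> is in \<open>H\<close>
    because \<open>l\<close> normalises \<open>H\<close>, and in \<open>L\<close> because
    \<open>L\<close> is normal. So it is trivial.\<close>
  have "h \<in> M" if h: "h \<in> H" for h
  proof -
    have hC: "h \<in> carrier G" using h HC by blast
    have "h \<otimes> l = l \<otimes> h" if l: "l \<in> L" for l
    proof -
      have lC: "l \<in> carrier G" using l LC by blast
      have ih: "inv h \<in> H" and il: "inv l \<in> L"
        using subgroup.m_inv_closed[OF H(1) h] subgroup.m_inv_closed[OF L l] by auto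
      have "conjugate l H = H" using l HY by (simp add: L_def)
      then have "l \<otimes> inv h \<otimes> inv l \<in> H" using ih by (auto simp: conjugate_def)
      then have 1: "h \<otimes> (l \<otimes> inv h \<otimes> inv l) \<in> H" by (rule subgroup.m_closed[OF H(1) h])
      have 2: "(h \<otimes> l \<otimes> inv h) \<otimes> inv l \<in> L" using subgroup.m_closed[OF L Ln[OF hC l] il] .
      have "h \<otimes> (l \<otimes> inv h \<otimes> inv l) = (h \<otimes> l \<otimes> inv h) \<otimes> inv l" using hC lC by (simp add: m_assoc)
      then have e: "h \<otimes> l \<otimes> inv h \<otimes> inv l = \<one>" using 1 2 HL by auto
      have "h \<otimes> l = (h \<otimes> l \<otimes> inv h \<otimes> inv l) \<otimes> (l \<otimes> h)"
        using hC lC by (simp add: m_assoc) (simp add: m_assoc[symmetric])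
      then show ?thesis using e hC lC by simp
    qed
    then show ?thesis using hC by (simp add: M_def)
  qed
  then have HM: "H \<subseteq> M" by blast
  have MintL: "M \<inter> L = {\<one>}"
  proof (rule triv)
    have s: "subgroup (M \<inter> L) G" using M L by (rule subgroups_Inter_pair)
    show "M \<inter> L \<lhd> G"
      by (rule normal_conjI[OF s]) (auto simp: conjugate_def Mn Ln)
    interpret Z: group "G\<lparr>carrier := M \<inter> L\<rparr>" by (rule subgroup_imp_group[OF s])
    have "x \<otimes> y = y \<otimes> x" if "x \<in> M" "y \<in> L" for x y
      using that by (simp add: M_def)
    then have "Z.amen (carrier (G\<lparr>carrier := M \<inter> L\<rparr>))"
      by (intro Z.abelian_amen) simp
    then have "amenable_group (G\<lparr>carrier := M \<inter> L\<rparr>)"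
      using Z.amen_imp_amenable_group[OF Z.subgroup_self] by simp
    then show "amen (M \<inter> L)" by (rule amenable_group_imp_amen[OF s])
  qed
  \<comment> \<open>Two elements of \<open>M\<close> with the same action on \<open>Y\<close> differ
    by an element of \<open>M \<inter> L\<close>, which is trivial, so \<open>M\<close> embeds into
    the self-maps of \<open>Y\<close>.\<close>
  have "finite M"
  proof (rule finite_imageD)
    show "finite ((\<lambda>g. restrict (conjugate g) Y) ` M)"
    proof (rule finite_subset)
      show "(\<lambda>g. restrict (conjugate g) Y) ` M \<subseteq> Y \<rightarrow>\<^sub>E Y" using Yconj MC by auto
      show "finite (Y \<rightarrow>\<^sub>E Y)" using fin by (intro finite_PiE) (auto simp: Y_def)
    qed
    show "inj_on (\<lambda>g. restrict (conjugate g) Y) M"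
    proof (rule inj_onI)
      fix g h assume gh: "g \<in> M" "h \<in> M" and eq: "restrict (conjugate g) Y = restrict (conjugate h) Y"
      have c: "g \<in> carrier G" "h \<in> carrier G" using gh MC by auto
      have "conjugate (inv g \<otimes> h) K = K" if K: "K \<in> Y" for K
      proof -
        have "conjugate h K = conjugate g K" using fun_cong[OF eq, of K] K by simp
        then have "conjugate (inv g \<otimes> h) K = conjugate (inv g) (conjugate g K)"
          using c YC[OF K] by (simp add: conj_conj[symmetric])
        also have "\<dots> = K" using c YC[OF K] by (simp add: conj_conj conj_one)
        finally show ?thesis .
      qed
      then have "inv g \<otimes> h \<in> L" using c by (simp add: L_def)
      moreover have "inv g \<otimes> h \<in> M" using gh M by (auto intro: subgroup.m_closed subgroup.m_inv_closed)
      ultimately have "inv g \<otimes> h = \<one>" using MintL by blast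
      then have "g \<otimes> (inv g \<otimes> h) = g" using c by simp
      then show "g = h" using c by (simp add: m_assoc[symmetric])
    qed
  qed
  then have "amen M" by (rule finite_amen[OF M])
  moreover have "M \<lhd> G" by (rule normal_conjI[OF M]) (auto simp: conjugate_def Mn)
  ultimately have "M = {\<one>}" using triv by blast
  then show ?thesis using HM subgroup.one_closed[OF H(1)] by blast
qed

end

section \<open>Amenable normal subgroups give ideals\<close>

definition fin_supp :: "('i \<Rightarrow> real) set" where
  "fin_supp = {v. finite {z. v z \<noteq> 0}}"

definition l1norm :: "('i \<Rightarrow> real) \<Rightarrow> real" where
  "l1norm v = (\<Sum>z | v z \<noteq> 0. \<bar>v z\<bar>)"

lemma l1norm_eq:
  assumes "finite B" "\<And>z. v z \<noteq> 0 \<Longrightarrow> z \<in> B"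
  shows "l1norm v = (\<Sum>z\<in>B. \<bar>v z\<bar>)"
  unfolding l1norm_def by (rule sum.mono_neutral_left) (use assms in auto)

lemma fin_suppI: "finite B \<Longrightarrow> (\<And>z. v z \<noteq> 0 \<Longrightarrow> z \<in> B) \<Longrightarrow> v \<in> fin_supp"
  unfolding fin_supp_def by (auto intro: finite_subset)

lemma fin_supp_plus: "v \<in> fin_supp \<Longrightarrow> w \<in> fin_supp \<Longrightarrow> v + w \<in> fin_supp"
  by (rule fin_suppI[of "{z. v z \<noteq> 0} \<union> {z. w z \<noteq> 0}"]) (auto simp: fin_supp_def)

lemma subspace_fin_supp: "subspace fin_supp"
  unfolding subspace_def
proof (intro conjI ballI allI)
  show "c *\<^sub>R v \<in> fin_supp" if "v \<in> fin_supp" for v :: "'i \<Rightarrow> real" and c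
    using that by (intro fin_suppI[of "{z. v z \<noteq> 0}"]) (auto simp: fin_supp_def)
qed (simp_all only: fin_supp_plus, simp add: fin_supp_def)

lemma sublinear_l1norm: "sublinear_on fin_supp l1norm"
proof (rule sublinear_onI[OF subspace_fin_supp])
  fix v w :: "'i \<Rightarrow> real" assume "v \<in> fin_supp" "w \<in> fin_supp"
  then have fin: "finite ({z. v z \<noteq> 0} \<union> {z. w z \<noteq> 0})" by (simp add: fin_supp_def)
  show "l1norm (v + w) \<le> l1norm v + l1norm w"
    using l1norm_eq[OF fin, of "v + w"] l1norm_eq[OF fin, of v] l1norm_eq[OF fin, of w]
    by (auto simp: sum.distrib[symmetric] intro!: sum_mono)
next
  fix v :: "'i \<Rightarrow> real" and c :: real assume "v \<in> fin_supp" and c: "c > 0"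
  then have fin: "finite {z. v z \<noteq> 0}" by (simp add: fin_supp_def)
  show "l1norm (c *\<^sub>R v) \<le> c * l1norm v"
    using l1norm_eq[OF fin, of "c *\<^sub>R v"] l1norm_eq[OF fin, of v] c
    by (simp add: abs_mult sum_distrib_left)
qed (simp add: l1norm_def)

context group
begin

section \<open>From an invariant mean to almost invariant vectors\<close>

definition finite_prob :: "('a \<Rightarrow> real) set" where
  "finite_prob = {p. (\<forall>x. 0 \<le> p x) \<and> (\<exists>F. finite F \<and> F \<subseteq> carrier G \<and> (\<forall>x. x \<notin> F \<longrightarrow> p x = 0) \<and> sum p F = 1)}"

lemma finite_prob_support:
  "p \<in> finite_prob \<Longrightarrow> \<exists>F. finite F \<and> F \<subseteq> carrier G \<and> (\<forall>x. x \<notin> F \<longrightarrow> p x = 0) \<and> sum p F = 1"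
  by (simp add: finite_prob_def)

lemma finite_prob_nonneg: "p \<in> finite_prob \<Longrightarrow> 0 \<le> p x"
  unfolding finite_prob_def by blast

text \<open>Day's argument: if there were no such \<open>p\<close>, separating the convex set of all \<open>(s \<cdot> p - p)\<^sub>s\<close>
  from \<open>0\<close> would give bounded functions \<open>f\<^sub>s\<close> with \<open>(\<Sum>s\<in>S. f\<^sub>s (s \<otimes> x) - f\<^sub>s x) \<ge> \<epsilon>\<close> for all \<open>x\<close>,
  contradicting the invariance of the mean.\<close>

lemma reiter:
  assumes m: "m \<in> means G" and S: "finite S" "S \<subseteq> stab m" and \<epsilon>: "\<epsilon> > 0"
  shows "\<exists>p\<in>finite_prob. \<forall>s\<in>S. \<forall>B. finite B \<longrightarrow> B \<subseteq> carrier G \<longrightarrow>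
    (\<Sum>x\<in>B. \<bar>p (inv s \<otimes> x) - p x\<bar>) < \<epsilon>"
proof -
  have SC: "S \<subseteq> carrier G" using S by (auto simp: stab_def)
  \<comment> \<open>The differences for all \<open>s \<in> S\<close> are collected in one vector
    indexed by pairs, so a single separation treats all of \<open>S\<close> simultaneously.\<close>
  define c where "c p = (\<lambda>(s, x). if s \<in> S \<and> x \<in> carrier G then p (inv s \<otimes> x) - p x else 0)" for p :: "'a \<Rightarrow> real"
  have supp: "\<exists>B. finite B \<and> (\<forall>z. c p z \<noteq> 0 \<longrightarrow> z \<in> B)" if p: "p \<in> finite_prob" for p
  proof -
    obtain F where F: "finite F" "F \<subseteq> carrier G" "\<forall>x. x \<notin> F \<longrightarrow> p x = 0"
      using finite_prob_support[OF p] by auto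
    let ?B = "S \<times> (F \<union> (\<lambda>(s, x). s \<otimes> x) ` (S \<times> F))"
    have "z \<in> ?B" if "c p z \<noteq> 0" for z
    proof -
      obtain s x where z: "z = (s, x)" by (cases z)
      with that have s: "s \<in> S" "x \<in> carrier G" "p (inv s \<otimes> x) \<noteq> 0 \<or> p x \<noteq> 0"
        by (auto simp: c_def split: if_splits)
      then have "inv s \<otimes> x \<in> F \<or> x \<in> F" using F(3) by blast
      moreover have "x = s \<otimes> (inv s \<otimes> x)" using s SC by (auto simp: m_assoc[symmetric])
      ultimately show ?thesis using s(1) unfolding z by (auto simp: image_iff)
    qed
    moreover have "finite ?B" using F S by auto
    ultimately show ?thesis by blast
  qed
  define C where "C = c ` finite_prob"
  have CE: "C \<subseteq> fin_supp"
  proof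
    fix v assume "v \<in> C"
    then obtain p where p: "p \<in> finite_prob" "v = c p" by (auto simp: C_def)
    then obtain B where "finite B" "\<forall>z. c p z \<noteq> 0 \<longrightarrow> z \<in> B" using supp by blast
    then show "v \<in> fin_supp" unfolding p(2) by (intro fin_suppI[of B]) blast+
  qed
  have conv: "u *\<^sub>R p + v *\<^sub>R q \<in> finite_prob"
    if p: "p \<in> finite_prob" and q: "q \<in> finite_prob" and uv: "0 \<le> u" "0 \<le> v" "u + v = 1" for p q and u v :: real
  proof -
    obtain F where F: "finite F" "F \<subseteq> carrier G" "\<forall>x. x \<notin> F \<longrightarrow> p x = 0" "sum p F = 1"
      using finite_prob_support[OF p] by auto
    obtain F' where F': "finite F'" "F' \<subseteq> carrier G" "\<forall>x. x \<notin> F' \<longrightarrow> q x = 0" "sum q F' = 1"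
      using finite_prob_support[OF q] by auto
    have "sum p (F \<union> F') = 1" "sum q (F \<union> F') = 1"
      using F F' sum.mono_neutral_right[of "F \<union> F'" F p] sum.mono_neutral_right[of "F \<union> F'" F' q] by auto
    then have "sum (u *\<^sub>R p + v *\<^sub>R q) (F \<union> F') = 1"
      using uv by (simp add: sum.distrib sum_distrib_left[symmetric])
    moreover have "\<forall>x. 0 \<le> (u *\<^sub>R p + v *\<^sub>R q) x"
      using finite_prob_nonneg[OF p] finite_prob_nonneg[OF q] uv by simp
    ultimately show ?thesis
      using F F' unfolding finite_prob_def by (intro CollectI conjI exI[of _ "F \<union> F'"]) auto
  qed
  have convC: "convex C"
    unfolding C_def
  proof (rule convexI)
    fix x y and u v :: real assume "x \<in> c ` finite_prob" "y \<in> c ` finite_prob" and uv: "0 \<le> u" "0 \<le> v" "u + v = 1"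
    then obtain p q where pq: "p \<in> finite_prob" "q \<in> finite_prob" "x = c p" "y = c q" by blast
    have "u *\<^sub>R x + v *\<^sub>R y = c (u *\<^sub>R p + v *\<^sub>R q)"
      by (auto simp: pq c_def fun_eq_iff algebra_simps)
    then show "u *\<^sub>R x + v *\<^sub>R y \<in> c ` finite_prob" using conv[OF pq(1,2) uv] by blast
  qed
  define e where "e z = (\<lambda>w. if w = z then 1 else (0::real))" for z :: "'a \<times> 'a"
  have dp: "(\<lambda>y. if y = x then 1 else 0) \<in> finite_prob" if "x \<in> carrier G" for x
    using that by (auto simp: finite_prob_def intro!: exI[of _ "{x}"])
  have "\<exists>p\<in>finite_prob. l1norm (c p) < \<epsilon>"
  proof (rule ccontr)
    assume "\<not> ?thesis"
    then have ge: "\<epsilon> \<le> l1norm v" if "v \<in> C" for v using that by (auto simp: C_def not_less)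
    have "C \<noteq> {}" using dp[OF one_closed] by (auto simp: C_def)
    then obtain L where L: "L \<in> dominated fin_supp l1norm" and Lc: "\<And>v. v \<in> C \<Longrightarrow> \<epsilon> \<le> L v"
      using dominated_separate[OF subspace_fin_supp sublinear_l1norm CE convC _ ge] by metis
    have eE: "e z \<in> fin_supp" for z by (rule fin_suppI[of "{z}"]) (auto simp: e_def split: if_splits)
    \<comment> \<open>The dual of the \<open>l1\<close> norm is the sup norm: a functional below
      \<open>l1norm\<close> has coefficients bounded by 1, and these are the functions
      \<open>f s\<close>.\<close>
    have le1: "\<bar>L (e z)\<bar> \<le> 1" for z
    proof -
      have "l1norm (e z) = (\<Sum>y\<in>{z}. \<bar>e z y\<bar>)" "l1norm (- e z) = (\<Sum>y\<in>{z}. \<bar>(- e z) y\<bar>)"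
        by (rule l1norm_eq; simp add: e_def split: if_splits)+
      then have "l1norm (e z) = 1" "l1norm (- e z) = 1" by (simp_all add: e_def)
      moreover have "L (e z) \<le> l1norm (e z)" by (rule dominatedD(3)[OF L eE])
      moreover have "L (- e z) \<le> l1norm (- e z)"
        by (rule dominatedD(3)[OF L subspace_neg[OF subspace_fin_supp eE]])
      ultimately show ?thesis using dominated_minus[OF L subspace_fin_supp eE, of z] by simp
    qed
    define f where "f s x = L (e (s, x))" for s x
    have fb: "f s \<in> bdd_fun G" for s
      by (rule bdd_funI[of _ _ 1]) (simp add: f_def le1)
    \<comment> \<open>The separation is tested on the point mass at \<open>x\<close>, whose
      difference vector has the entries 1 at \<open>(s, s \<otimes> x)\<close> and -1 at
      \<open>(s, x)\<close>, added up over \<open>s \<in> S\<close>.\<close>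
    have fx: "\<epsilon> \<le> (\<Sum>s\<in>S. f s (s \<otimes> x) - f s x)" if x: "x \<in> carrier G" for x
    proof -
      let ?p = "\<lambda>y. if y = x then 1 else (0::real)"
      have "c ?p = (\<Sum>s\<in>S. e (s, s \<otimes> x) - e (s, x))"
      proof
        fix z :: "'a \<times> 'a"
        obtain t y where z: "z = (t, y)" by (cases z)
        have iff: "inv t \<otimes> y = x \<longleftrightarrow> y = t \<otimes> x" if "t \<in> S" "y \<in> carrier G"
          using that SC x by (metis inv_closed inv_solve_left subsetD)
        have "(\<Sum>s\<in>S. e (s, s \<otimes> x) - e (s, x)) z = (\<Sum>s\<in>S. e (s, s \<otimes> x) z - e (s, x) z)"
          by (induction S rule: infinite_finite_induct) auto
        also have "\<dots> = (\<Sum>s\<in>S. if s = t then (e (t, t \<otimes> x) z - e (t, x) z) else 0)"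
          by (rule sum.cong) (auto simp: e_def z)
        also have "\<dots> = (if t \<in> S then (e (t, t \<otimes> x) z - e (t, x) z) else 0)"
          using S(1) by simp
        also have "\<dots> = c ?p z"
          using iff x SC by (auto simp: c_def z e_def)
        finally show "c ?p z = (\<Sum>s\<in>S. e (s, s \<otimes> x) - e (s, x)) z" by simp
      qed
      moreover have "L (\<Sum>s\<in>S. e (s, s \<otimes> x) - e (s, x)) = (\<Sum>s\<in>S. f s (s \<otimes> x) - f s x)"
        using dominated_sum[OF L subspace_fin_supp, of S "\<lambda>s. e (s, s \<otimes> x) - e (s, x)"]
          subspace_diff[OF subspace_fin_supp eE eE] dominated_diff[OF L subspace_fin_supp eE eE]
        by (simp add: f_def)
      moreover have "c ?p \<in> C" using dp[OF x] by (simp add: C_def)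
      ultimately show ?thesis using Lc by metis
    qed
    have b1: "(\<lambda>x. f s (s \<otimes> x) - f s x) \<in> bdd_fun G" if "s \<in> S" for s
      using that SC by (intro bdd_fun_diff bdd_fun_translate fb) auto
    have "(\<lambda>x. \<Sum>s\<in>S. f s (s \<otimes> x) - f s x) = (\<Sum>s\<in>S. (\<lambda>x. f s (s \<otimes> x) - f s x))"
      by (induction S rule: infinite_finite_induct) (auto simp: fun_eq_iff)
    then have b2: "(\<lambda>x. \<Sum>s\<in>S. f s (s \<otimes> x) - f s x) \<in> bdd_fun G"
      using subspace_sum[OF subspace_bdd_fun b1] by simp
    have "\<epsilon> \<le> m (\<lambda>x. \<Sum>s\<in>S. f s (s \<otimes> x) - f s x)"
      by (rule mean_ge[OF m b2 fx])
    also have "\<dots> = (\<Sum>s\<in>S. m (\<lambda>x. f s (s \<otimes> x) - f s x))"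
      by (rule mean_sum[OF m b1])
    also have "\<dots> = 0"
    proof (rule sum.neutral, rule ballI)
      fix s assume s: "s \<in> S"
      then have "m (\<lambda>x. f s (s \<otimes> x)) = m (f s)"
        using stab_iff[OF m, of s] S(2) SC fb by blast
      then show "m (\<lambda>x. f s (s \<otimes> x) - f s x) = 0"
        using mean_diff[OF m bdd_fun_translate[OF fb] fb] s SC by auto
    qed
    finally show False using \<epsilon> by simp
  qed
  then obtain p where p: "p \<in> finite_prob" "l1norm (c p) < \<epsilon>" by blast
  obtain B where B: "finite B" "\<And>z. c p z \<noteq> 0 \<Longrightarrow> z \<in> B" using supp[OF p(1)] by blast
  have "(\<Sum>x\<in>A. \<bar>p (inv s \<otimes> x) - p x\<bar>) < \<epsilon>" if s: "s \<in> S" and A: "finite A" "A \<subseteq> carrier G" for s A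
  proof -
    have "(\<Sum>x\<in>A. \<bar>p (inv s \<otimes> x) - p x\<bar>) = (\<Sum>x\<in>A. \<bar>c p (s, x)\<bar>)"
      using s A by (intro sum.cong) (auto simp: c_def)
    also have "\<dots> = (\<Sum>z\<in>{s} \<times> A. \<bar>c p z\<bar>)"
      by (rule sym, rule sum.reindex_cong[of "Pair s" A]) (auto simp: inj_on_def)
    also have "\<dots> \<le> (\<Sum>z\<in>{s} \<times> A \<union> B. \<bar>c p z\<bar>)"
      using A B by (intro sum_mono2) auto
    also have "\<dots> = l1norm (c p)"
      using A B by (intro l1norm_eq[symmetric]) auto
    finally show ?thesis using p(2) by simp
  qed
  with p(1) show ?thesis by (intro bexI[of _ p]) simp_all
qed

text \<open>Namioka's passage from \<open>l1\<close> to \<open>l2\<close>: take the square root of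
  an almost invariant probability and use
  \<open>(sqrt a - sqrt b)\<^sup>2 \<le> \<bar>a - b\<bar>\<close>.\<close>

lemma almost_invariant_vector:
  assumes m: "m \<in> means G" and S: "finite S" "S \<subseteq> stab m" and \<delta>: "\<delta> > 0"
  obtains \<xi> where "\<xi> \<in> l2 G" "l2norm G \<xi> = 1" "\<And>s. s \<in> S \<Longrightarrow> l2norm G (\<lambda>x. left_reg G s \<xi> x - \<xi> x) < \<delta>"
proof -
  have SC: "S \<subseteq> carrier G" using S by (auto simp: stab_def)
  have "(\<delta> / 2)\<^sup>2 > 0" using \<delta> by simp
  \<comment> \<open>An \<open>l1\<close> error below \<open>(\<delta> / 2)\<^sup>2\<close> gives an
    \<open>l2\<close> error of at most \<open>\<delta> / 2\<close>; the factor 2 restores strictness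
    after passing from finite sets to the full norm.\<close>
  from reiter[OF m S this] obtain p where p: "p \<in> finite_prob"
    and small: "\<forall>s\<in>S. \<forall>B. finite B \<longrightarrow> B \<subseteq> carrier G \<longrightarrow> (\<Sum>x\<in>B. \<bar>p (inv s \<otimes> x) - p x\<bar>) < (\<delta> / 2)\<^sup>2"
    by (elim bexE)
  obtain F where F: "finite F" "F \<subseteq> carrier G" "\<forall>x. x \<notin> F \<longrightarrow> p x = 0" "sum p F = 1"
    using finite_prob_support[OF p] by auto
  have pn: "0 \<le> p x" for x using p by (rule finite_prob_nonneg)
  define \<xi> where "\<xi> x = complex_of_real (sqrt (p x))" for x
  have \<xi>: "\<xi> \<in> l2 G" "(l2norm G \<xi>)\<^sup>2 = (\<Sum>x\<in>F. (cmod (\<xi> x))\<^sup>2)"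
    using l2_finite_support[OF F(1,2), of \<xi>] F(3) by (auto simp: \<xi>_def)
  have "(l2norm G \<xi>)\<^sup>2 = 1" unfolding \<xi>(2) using pn F(4) by (simp add: \<xi>_def)
  then have n1: "l2norm G \<xi> = 1" by (smt (verit) l2norm_nonneg power2_eq_1_iff)
  have sq: "(sqrt a - sqrt b)\<^sup>2 \<le> \<bar>a - b\<bar>" if "0 \<le> a" "0 \<le> b" for a b :: real
  proof -
    have "\<bar>sqrt a - sqrt b\<bar> \<le> sqrt a + sqrt b"
      using real_sqrt_ge_zero[OF that(1)] real_sqrt_ge_zero[OF that(2)] by linarith
    then have "\<bar>sqrt a - sqrt b\<bar> * \<bar>sqrt a - sqrt b\<bar> \<le> \<bar>sqrt a - sqrt b\<bar> * \<bar>sqrt a + sqrt b\<bar>"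
      by (intro mult_left_mono) auto
    also have "\<dots> = \<bar>(sqrt a - sqrt b) * (sqrt a + sqrt b)\<bar>" by (simp only: abs_mult)
    also have "(sqrt a - sqrt b) * (sqrt a + sqrt b) = a - b"
      using that by (simp add: algebra_simps)
    also have "\<bar>sqrt a - sqrt b\<bar> * \<bar>sqrt a - sqrt b\<bar> = (sqrt a - sqrt b)\<^sup>2"
      by (simp add: power2_eq_square)
    finally show ?thesis .
  qed
  have "l2norm G (\<lambda>x. left_reg G s \<xi> x - \<xi> x) < \<delta>" if s: "s \<in> S" for s
  proof -
    have "L2_set (\<lambda>x. cmod (left_reg G s \<xi> x - \<xi> x)) B \<le> \<delta> / 2" if B: "finite B" "B \<subseteq> carrier G" for B
    proof -
      have "(cmod (left_reg G s \<xi> x - \<xi> x))\<^sup>2 \<le> \<bar>p (inv s \<otimes> x) - p x\<bar>" if "x \<in> B" for x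
      proof -
        have "left_reg G s \<xi> x - \<xi> x = complex_of_real (sqrt (p (inv s \<otimes> x)) - sqrt (p x))"
          using that B left_reg_apply[OF \<xi>(1)] by (auto simp: \<xi>_def)
        then have "(cmod (left_reg G s \<xi> x - \<xi> x))\<^sup>2 = (sqrt (p (inv s \<otimes> x)) - sqrt (p x))\<^sup>2"
          by (simp only: norm_of_real power2_abs)
        then show ?thesis using sq[OF pn pn] by simp
      qed
      then have "(\<Sum>x\<in>B. (cmod (left_reg G s \<xi> x - \<xi> x))\<^sup>2) \<le> (\<Sum>x\<in>B. \<bar>p (inv s \<otimes> x) - p x\<bar>)"
        by (rule sum_mono)
      also have "\<dots> < (\<delta> / 2)\<^sup>2" using small s B by simp
      finally have "sqrt (\<Sum>x\<in>B. (cmod (left_reg G s \<xi> x - \<xi> x))\<^sup>2) \<le> sqrt ((\<delta> / 2)\<^sup>2)"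
        by (intro real_sqrt_le_mono less_imp_le)
      then show ?thesis
        unfolding L2_set_def using \<delta> by simp
    qed
    then have "l2norm G (\<lambda>x. left_reg G s \<xi> x - \<xi> x) \<le> \<delta> / 2"
      using \<xi>(1) by (intro l2I(2)) (auto simp: left_reg_def l2_outside)
    then show ?thesis using \<delta> by simp
  qed
  with \<xi>(1) n1 that show ?thesis by blast
qed

section \<open>Operators that vanish on almost invariant vectors\<close>

definition almost_inv :: "'a set \<Rightarrow> 'a set \<Rightarrow> real \<Rightarrow> ('a \<Rightarrow> complex) set" where
  "almost_inv N S \<delta> = {\<xi> \<in> l2 G. l2norm G \<xi> = 1 \<and> (\<forall>s\<in>S. l2norm G (\<lambda>x. left_reg G s \<xi> x - \<xi> x) < \<delta>)}"

text \<open>The filter stands in for a net of almost invariant unit vectors, so that limits become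
  \<open>eventually\<close> statements. It is proper exactly when all the sets
  \<open>almost_inv N S \<delta>\<close> with finite \<open>S \<subseteq> N\<close> and
  \<open>\<delta> > 0\<close> are nonempty, which is where amenability of \<open>N\<close> will
  enter.\<close>

definition almost_inv_filter :: "'a set \<Rightarrow> ('a \<Rightarrow> complex) filter" where
  "almost_inv_filter N =
     (INF x\<in>{S. finite S \<and> S \<subseteq> N} \<times> {0<..}. principal (almost_inv N (fst x) (snd x)))"

lemma eventually_almost_inv_filter:
  "eventually Q (almost_inv_filter N) \<longleftrightarrow>
     (\<exists>S \<delta>. finite S \<and> S \<subseteq> N \<and> 0 < \<delta> \<and> (\<forall>\<xi>\<in>almost_inv N S \<delta>. Q \<xi>))"
proof -
  let ?B = "{S. finite S \<and> S \<subseteq> N} \<times> {0::real<..}"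
  have "eventually Q (almost_inv_filter N) \<longleftrightarrow>
     (\<exists>b\<in>?B. eventually Q (principal (almost_inv N (fst b) (snd b))))"
    unfolding almost_inv_filter_def
  proof (rule eventually_INF_base)
    have "({}, 1) \<in> ?B" by simp
    then show "?B \<noteq> {}" by blast
    fix a b assume a: "a \<in> ?B" and b: "b \<in> ?B"
    then have mem: "(fst a \<union> fst b, min (snd a) (snd b)) \<in> ?B" by auto
    have le: "principal (almost_inv N (fst a \<union> fst b) (min (snd a) (snd b)))
        \<le> inf (principal (almost_inv N (fst a) (snd a))) (principal (almost_inv N (fst b) (snd b)))"
      by (auto simp: almost_inv_def)
    show "\<exists>x\<in>?B. principal (almost_inv N (fst x) (snd x))
        \<le> inf (principal (almost_inv N (fst a) (snd a))) (principal (almost_inv N (fst b) (snd b)))"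
      by (rule bexI[OF _ mem]) (use le in \<open>simp only: fst_conv snd_conv\<close>)
  qed
  then show ?thesis by (auto simp: eventually_principal)
qed

lemma eventually_almost_invE:
  assumes "eventually Q (almost_inv_filter N)"
  obtains S \<delta> where "finite S" "S \<subseteq> N" "0 < \<delta>" "\<And>\<xi>. \<xi> \<in> almost_inv N S \<delta> \<Longrightarrow> Q \<xi>"
  using assms unfolding eventually_almost_inv_filter by auto

definition vanishing :: "'a set \<Rightarrow> 'a op \<Rightarrow> bool" where
  "vanishing N T \<longleftrightarrow> (\<forall>\<epsilon>>0. eventually (\<lambda>\<xi>. l2norm G (T \<xi>) < \<epsilon>) (almost_inv_filter N))"

lemma eventually_unit: "eventually (\<lambda>\<xi>. \<xi> \<in> l2 G \<and> l2norm G \<xi> = 1) (almost_inv_filter N)"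
  unfolding eventually_almost_inv_filter
  by (intro exI[of _ "{}"] exI[of _ 1]) (auto simp: almost_inv_def)

lemma vanishing_leI:
  assumes T: "vanishing N T" and c: "0 \<le> c"
    and le: "\<And>\<xi>. \<xi> \<in> l2 G \<Longrightarrow> l2norm G \<xi> = 1 \<Longrightarrow> l2norm G (S \<xi>) \<le> c * l2norm G (T \<xi>)"
  shows "vanishing N S"
  unfolding vanishing_def
proof (intro allI impI)
  fix \<epsilon> :: real assume \<epsilon>: "\<epsilon> > 0"
  \<comment> \<open>Dividing by \<open>c + 1\<close> covers the case \<open>c = 0\<close>.\<close>
  have "\<epsilon> / (c + 1) > 0" using \<epsilon> c by simp
  then have "eventually (\<lambda>\<xi>. l2norm G (T \<xi>) < \<epsilon> / (c + 1)) (almost_inv_filter N)"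
    using T by (simp add: vanishing_def)
  then show "eventually (\<lambda>\<xi>. l2norm G (S \<xi>) < \<epsilon>) (almost_inv_filter N)"
    using eventually_unit
  proof eventually_elim
    case (elim \<xi>)
    have "l2norm G (S \<xi>) \<le> c * l2norm G (T \<xi>)" using le elim by blast
    also have "\<dots> \<le> (c + 1) * l2norm G (T \<xi>)" by (rule mult_right_mono) auto
    also have "\<dots> < \<epsilon>" using elim(1) c by (simp add: field_simps)
    finally show ?case .
  qed
qed

lemma vanishing_plus:
  assumes "vanishing N S" "vanishing N T" "S \<in> bounded_ops G" "T \<in> bounded_ops G"
  shows "vanishing N (\<lambda>f x. S f x + T f x)"
  unfolding vanishing_def
proof (intro allI impI)
  fix \<epsilon> :: real assume \<epsilon>: "\<epsilon> > 0"
  then have "\<epsilon> / 2 > 0" by simp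
  then have "eventually (\<lambda>\<xi>. l2norm G (S \<xi>) < \<epsilon> / 2) (almost_inv_filter N)"
    "eventually (\<lambda>\<xi>. l2norm G (T \<xi>) < \<epsilon> / 2) (almost_inv_filter N)"
    by (rule assms(1)[unfolded vanishing_def, rule_format], rule assms(2)[unfolded vanishing_def, rule_format])
  then show "eventually (\<lambda>\<xi>. l2norm G (\<lambda>x. S \<xi> x + T \<xi> x) < \<epsilon>) (almost_inv_filter N)"
    using eventually_unit
  proof eventually_elim
    case (elim \<xi>)
    then show ?case
      using l2norm_triangle[OF bounded_ops_l2[OF assms(3), of \<xi>] bounded_ops_l2[OF assms(4), of \<xi>]] by simp
  qed
qed

lemma vanishing_approx:
  assumes T: "T \<in> bounded_ops G"
    and approx: "\<And>\<epsilon>. \<epsilon> > 0 \<Longrightarrow> \<exists>S. S \<in> bounded_ops G \<and> vanishing N S \<and> opnorm G (\<lambda>f x. T f x - S f x) < \<epsilon>"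
  shows "vanishing N T"
  unfolding vanishing_def
proof (intro allI impI)
  fix \<epsilon> :: real assume \<epsilon>: "\<epsilon> > 0"
  then obtain S where S: "S \<in> bounded_ops G" "vanishing N S" "opnorm G (\<lambda>f x. T f x - S f x) < \<epsilon> / 2"
    using approx[of "\<epsilon> / 2"] by auto
  have "eventually (\<lambda>\<xi>. l2norm G (S \<xi>) < \<epsilon> / 2) (almost_inv_filter N)"
  proof -
    have "\<epsilon> / 2 > 0" using \<epsilon> by simp
    then show ?thesis by (rule S(2)[unfolded vanishing_def, rule_format])
  qed
  then show "eventually (\<lambda>\<xi>. l2norm G (T \<xi>) < \<epsilon>) (almost_inv_filter N)"
    using eventually_unit
  proof eventually_elim
    case (elim \<xi>)
    have TS: "T \<xi> \<in> l2 G" "S \<xi> \<in> l2 G"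
      using bounded_ops_l2[OF T] bounded_ops_l2[OF S(1)] elim by simp_all
    have "l2norm G (\<lambda>x. (T \<xi> x - S \<xi> x) + S \<xi> x) \<le> l2norm G (\<lambda>x. T \<xi> x - S \<xi> x) + l2norm G (S \<xi>)"
      by (rule l2norm_triangle[OF l2_diff[OF TS] TS(2)])
    moreover have "l2norm G (\<lambda>x. T \<xi> x - S \<xi> x) \<le> opnorm G (\<lambda>f x. T f x - S f x)"
      using opnorm_bound[OF bounded_ops_minus[OF T S(1)], of \<xi>] elim by simp
    ultimately show ?case using S(3) elim(1) by simp
  qed
qed

text \<open>Normality makes the filter invariant under \<open>left_reg G g\<close>: from
  \<open>s \<otimes> g = g \<otimes> (inv g \<otimes> s \<otimes> g)\<close>, a vector almost fixed
  by the conjugates of \<open>A\<close> is moved to one almost fixed by \<open>A\<close>.\<close>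

lemma vanishing_left_reg:
  assumes N: "N \<lhd> G" and S: "vanishing N S" and g: "g \<in> carrier G"
  shows "vanishing N (S \<circ> left_reg G g)"
  unfolding vanishing_def
proof (intro allI impI)
  fix \<epsilon> :: real assume \<epsilon>: "\<epsilon> > 0"
  have NC: "N \<subseteq> carrier G" by (rule subgroup.subset[OF normal_imp_subgroup[OF N]])
  have "eventually (\<lambda>\<xi>. l2norm G (S \<xi>) < \<epsilon>) (almost_inv_filter N)"
    using S \<epsilon> by (simp add: vanishing_def)
  then obtain A \<delta> where A: "finite A" "A \<subseteq> N" "0 < \<delta>" "\<And>\<xi>. \<xi> \<in> almost_inv N A \<delta> \<Longrightarrow> l2norm G (S \<xi>) < \<epsilon>"
    by (rule eventually_almost_invE) metis
  let ?B = "(\<lambda>n. inv g \<otimes> n \<otimes> g) ` A"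
  have B: "finite ?B" "?B \<subseteq> N" using A g normal.inv_op_closed1[OF N] by auto
  have "left_reg G g \<xi> \<in> almost_inv N A \<delta>" if \<xi>: "\<xi> \<in> almost_inv N ?B \<delta>" for \<xi>
  proof -
    have \<xi>2: "\<xi> \<in> l2 G" "l2norm G \<xi> = 1" using \<xi> by (auto simp: almost_inv_def)
    have "l2norm G (\<lambda>x. left_reg G s (left_reg G g \<xi>) x - left_reg G g \<xi> x) < \<delta>" if s: "s \<in> A" for s
    proof -
      have sC: "s \<in> carrier G" using s A NC by blast
      let ?t = "inv g \<otimes> s \<otimes> g"
      have t: "?t \<in> carrier G" using g sC by simp
      have "s \<otimes> g = g \<otimes> ?t" using g sC by (simp add: m_assoc[symmetric])
      then have "left_reg G s (left_reg G g \<xi>) = left_reg G g (left_reg G ?t \<xi>)"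
        using fun_cong[OF left_reg_mult[OF sC g], of \<xi>] fun_cong[OF left_reg_mult[OF g t], of \<xi>] by simp
      then have "(\<lambda>x. left_reg G s (left_reg G g \<xi>) x - left_reg G g \<xi> x) =
          left_reg G g (\<lambda>x. left_reg G ?t \<xi> x - \<xi> x)"
        using bounded_ops_diff[OF left_reg_bounded[OF g] left_reg_l2(1)[OF t \<xi>2(1)] \<xi>2(1)] by simp
      then have "l2norm G (\<lambda>x. left_reg G s (left_reg G g \<xi>) x - left_reg G g \<xi> x) =
          l2norm G (\<lambda>x. left_reg G ?t \<xi> x - \<xi> x)"
        using left_reg_isometry[OF g l2_diff[OF left_reg_l2(1)[OF t \<xi>2(1)] \<xi>2(1)]] by simp
      also have "\<dots> < \<delta>" using \<xi> s by (auto simp: almost_inv_def)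
      finally show ?thesis .
    qed
    then show ?thesis
      using \<xi>2 g by (simp add: almost_inv_def left_reg_l2 left_reg_isometry)
  qed
  with A(4) have "\<forall>\<xi>\<in>almost_inv N ?B \<delta>. l2norm G ((S \<circ> left_reg G g) \<xi>) < \<epsilon>" by simp
  with B A(3) show "eventually (\<lambda>\<xi>. l2norm G ((S \<circ> left_reg G g) \<xi>) < \<epsilon>) (almost_inv_filter N)"
    unfolding eventually_almost_inv_filter by blast
qed

text \<open>For a left factor boundedness is enough, but a right factor moves the vectors
  themselves. Invariance of the filter handles single group elements; linearity and norm
  approximation handle the rest.\<close>

lemma vanishing_compose_right:
  assumes N: "N \<lhd> G" and S: "vanishing N S" "S \<in> bounded_ops G" and T: "T \<in> reduced_cstar G"
  shows "vanishing N (S \<circ> T)"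
proof (rule vanishing_approx)
  have bT: "T \<in> bounded_ops G" by (rule reduced_cstar_bounded[OF T])
  show "S \<circ> T \<in> bounded_ops G" by (rule bounded_ops_compose[OF S(2) bT])
  fix \<epsilon> :: real assume \<epsilon>: "\<epsilon> > 0"
  define K where "K = opnorm G S + 1"
  have K: "K > 0" using opnorm_nonneg[OF S(2)] by (simp add: K_def)
  obtain R where R: "R \<in> algebraic_ops" "opnorm G (\<lambda>f x. T f x - R f x) < \<epsilon> / K"
    using reduced_cstarE[OF T, of "\<epsilon> / K"] \<epsilon> K by auto
  have bR: "R \<in> bounded_ops G" by (rule algebraic_ops_bounded[OF R(1)])
  have "vanishing N (S \<circ> R)"
    using R(1)
  proof (induction rule: algebraic_ops_induct)
    case zero
    then show ?case using bounded_ops_zero[OF S(2)] by (simp add: vanishing_def)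
  next
    case (plus A B)
    have bA: "A \<in> bounded_ops G" and bB: "B \<in> bounded_ops G" using plus algebraic_ops_bounded by auto
    have "vanishing N (\<lambda>f x. (S \<circ> A) f x + (S \<circ> B) f x)"
      by (rule vanishing_plus[OF plus.IH bounded_ops_compose[OF S(2) bA] bounded_ops_compose[OF S(2) bB]])
    then show ?case
    proof (rule vanishing_leI[where c=1])
      fix \<xi> assume "\<xi> \<in> l2 G"
      then show "l2norm G ((S \<circ> (\<lambda>f x. A f x + B f x)) \<xi>) \<le> 1 * l2norm G (\<lambda>x. (S \<circ> A) \<xi> x + (S \<circ> B) \<xi> x)"
        using bounded_ops_add[OF S(2) bounded_ops_l2[OF bA] bounded_ops_l2[OF bB]] by simp
    qed simp
  next
    case (left_reg g c)
    have "vanishing N (S \<circ> left_reg G g)" by (rule vanishing_left_reg[OF N S(1) left_reg])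
    then show ?case
    proof (rule vanishing_leI[where c="cmod c"])
      fix \<xi> assume "\<xi> \<in> l2 G"
      then show "l2norm G ((S \<circ> (\<lambda>f x. c * left_reg G g f x)) \<xi>) \<le> cmod c * l2norm G ((S \<circ> left_reg G g) \<xi>)"
        using bounded_ops_scale[OF S(2) left_reg_l2(1)[OF left_reg]] by (simp add: l2norm_scale)
    qed simp
  qed
  moreover have "opnorm G (\<lambda>f x. (S \<circ> T) f x - (S \<circ> R) f x) < \<epsilon>"
  proof -
    have eq: "(\<lambda>f x. (S \<circ> T) f x - (S \<circ> R) f x) = S \<circ> (\<lambda>f x. T f x - R f x)"
    proof
      fix f show "(\<lambda>x. (S \<circ> T) f x - (S \<circ> R) f x) = (S \<circ> (\<lambda>f x. T f x - R f x)) f"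
      proof (cases "f \<in> l2 G")
        case True
        then show ?thesis using bounded_ops_diff[OF S(2) bounded_ops_l2[OF bT] bounded_ops_l2[OF bR]] by simp
      next
        case False
        then show ?thesis
          using bounded_ops_outside[OF bT] bounded_ops_outside[OF bR] bounded_ops_zero[OF S(2)] by simp
      qed
    qed
    have "opnorm G (\<lambda>f x. (S \<circ> T) f x - (S \<circ> R) f x) \<le> opnorm G S * opnorm G (\<lambda>f x. T f x - R f x)"
      unfolding eq by (rule opnorm_compose[OF S(2) bounded_ops_minus[OF bT bR]])
    also have "\<dots> \<le> K * opnorm G (\<lambda>f x. T f x - R f x)"
      using opnorm_nonneg[OF bounded_ops_minus[OF bT bR]] by (intro mult_right_mono) (auto simp: K_def)
    also have "\<dots> < \<epsilon>" using R(2) K by (simp add: field_simps)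
    finally show ?thesis .
  qed
  ultimately show "\<exists>R. R \<in> bounded_ops G \<and> vanishing N R \<and> opnorm G (\<lambda>f x. (S \<circ> T) f x - R f x) < \<epsilon>"
    using bounded_ops_compose[OF S(2) bR] by blast
qed

text \<open>The vanishing operators form a closed ideal that contains
  \<open>left_reg G n - left_reg G \<one>\<close> for \<open>n \<in> N\<close> but not the identity,
  because almost invariant unit vectors exist. Simplicity makes all these differences zero.\<close>

lemma cstar_simple_imp_trivial:
  assumes simple: "cstar_simple G" and N: "N \<lhd> G" "amen N"
  shows "N = {\<one>}"
proof -
  have NC: "N \<subseteq> carrier G" by (rule subgroup.subset[OF normal_imp_subgroup[OF N(1)]])
  define I where "I = {T \<in> reduced_cstar G. vanishing N T}"
  have "closed_ideal G (reduced_cstar G) I"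
    unfolding closed_ideal_def
  proof (intro conjI ballI allI impI)
    show "I \<subseteq> reduced_cstar G" by (auto simp: I_def)
    show "(\<lambda>_ _. 0) \<in> I" by (simp add: I_def vanishing_def algebraic_ops_subset algebraic_ops_0)
    show "(\<lambda>f x. S f x + T f x) \<in> I" if "S \<in> I" "T \<in> I" for S T
      using that by (auto simp: I_def reduced_cstar_plus reduced_cstar_bounded intro!: vanishing_plus)
    show "(\<lambda>f x. a * S f x) \<in> I" if "S \<in> I" for S a
      using that by (auto simp: I_def reduced_cstar_cscale l2norm_scale intro: vanishing_leI[where c="cmod a"])
    show "T \<circ> S \<in> I" if "S \<in> I" "T \<in> reduced_cstar G" for S T
    proof -
      have "vanishing N (T \<circ> S)"
      proof (rule vanishing_leI[of N S])
        show "0 \<le> opnorm G T" using that by (simp add: opnorm_nonneg reduced_cstar_bounded)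
        show "l2norm G ((T \<circ> S) \<xi>) \<le> opnorm G T * l2norm G (S \<xi>)" if "\<xi> \<in> l2 G" for \<xi>
          using opnorm_bound[OF reduced_cstar_bounded[OF \<open>T \<in> _\<close>] bounded_ops_l2[OF _ that]] \<open>S \<in> I\<close>
          by (simp add: I_def reduced_cstar_bounded)
      qed (use that in \<open>simp add: I_def\<close>)
      then show ?thesis using that by (simp add: I_def reduced_cstar_compose)
    qed
    show "S \<circ> T \<in> I" if "S \<in> I" "T \<in> reduced_cstar G" for S T
      using that by (auto simp: I_def reduced_cstar_compose reduced_cstar_bounded intro: vanishing_compose_right[OF N(1)])
    show "T \<in> I" if "T \<in> reduced_cstar G" "\<forall>\<epsilon>>0. \<exists>S\<in>I. opnorm G (\<lambda>f x. T f x - S f x) < \<epsilon>" for T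
    proof -
      have "vanishing N T"
        by (rule vanishing_approx)
          (use that reduced_cstar_bounded in \<open>auto simp: I_def Bex_def\<close>)
      then show ?thesis using that by (simp add: I_def)
    qed
  qed
  then have cases: "I = {\<lambda>_ _. 0} \<or> I = reduced_cstar G"
    using simple by (simp add: cstar_simple_def)
  have "left_reg G \<one> \<notin> I"
  proof
    assume "left_reg G \<one> \<in> I"
    then have "eventually (\<lambda>\<xi>. l2norm G (left_reg G \<one> \<xi>) < 1) (almost_inv_filter N)"
      by (simp add: I_def vanishing_def)
    then obtain S \<delta> where S: "finite S" "S \<subseteq> N" "0 < \<delta>"
        "\<And>\<xi>. \<xi> \<in> almost_inv N S \<delta> \<Longrightarrow> l2norm G (left_reg G \<one> \<xi>) < 1"
      by (rule eventually_almost_invE) metis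
    obtain m where m: "m \<in> means G" "N \<subseteq> stab m" using N(2) by (auto simp: amen_def)
    obtain \<xi> where \<xi>: "\<xi> \<in> l2 G" "l2norm G \<xi> = 1" "\<And>s. s \<in> S \<Longrightarrow> l2norm G (\<lambda>x. left_reg G s \<xi> x - \<xi> x) < \<delta>"
      using almost_invariant_vector[OF m(1) S(1) _ S(3)] S(2) m(2) by (metis subset_trans)
    then have "\<xi> \<in> almost_inv N S \<delta>" by (simp add: almost_inv_def)
    from S(4)[OF this] \<xi> show False by (simp add: left_reg_one)
  qed
  then have I0: "I = {\<lambda>_ _. 0}" using cases left_reg_reduced[OF one_closed] by auto
  have "n = \<one>" if n: "n \<in> N" for n
  proof -
    have nC: "n \<in> carrier G" using n NC by blast
    define T where "T = (\<lambda>f x. left_reg G n f x + (-1) * left_reg G \<one> f x)"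
    have "T \<in> reduced_cstar G"
      unfolding T_def by (intro reduced_cstar_plus reduced_cstar_cscale left_reg_reduced nC one_closed)
    moreover have "vanishing N T"
      unfolding vanishing_def eventually_almost_inv_filter
    proof (intro allI impI)
      fix \<epsilon> :: real assume "\<epsilon> > 0"
      then show "\<exists>S \<delta>. finite S \<and> S \<subseteq> N \<and> 0 < \<delta> \<and> (\<forall>\<xi>\<in>almost_inv N S \<delta>. l2norm G (T \<xi>) < \<epsilon>)"
        using n by (intro exI[of _ "{n}"] exI[of _ \<epsilon>]) (auto simp: almost_inv_def T_def left_reg_one)
    qed
    ultimately have "T \<in> I" by (simp add: I_def)
    \<comment> \<open>The value at \<open>n\<close> of \<open>delta n - delta \<one>\<close> is 1
      unless \<open>n = \<one>\<close>.\<close>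
    then have "T (delta \<one>) n = 0" using I0 by auto
    then show "n = \<one>"
      using nC left_reg_delta[OF nC one_closed] left_reg_one[OF delta_l2[OF one_closed]]
      by (auto simp: T_def delta_def split: if_splits)
  qed
  then show ?thesis using subgroup.one_closed[OF normal_imp_subgroup[OF N(1)]] by blast
qed

end

section \<open>States vanishing on an ideal\<close>

text \<open>Near \<open>t = 0\<close> the right side is \<open>1\<close> plus a quadratic term,
  which cannot dominate a nonzero linear term.\<close>

lemma sqrt_bound_zero:
  fixes s k :: real
  assumes k: "0 \<le> k" and le: "\<And>t. 1 + t * s \<le> sqrt (1 + t\<^sup>2 * k)"
  shows "s = 0"
proof (rule ccontr)
  assume s: "s \<noteq> 0"
  \<comment> \<open>With this \<open>t\<close> the linear term \<open>t * s\<close> is positive and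
    the quadratic term \<open>t\<^sup>2 * k\<close> is at most \<open>t * s\<close>, whereas
    squaring would require it to be at least \<open>2 * (t * s)\<close>.\<close>
  define t where "t = s / (k + 1)"
  have k1: "k + 1 > 0" using k by simp
  have ts: "t * s = s\<^sup>2 / (k + 1)" by (simp add: t_def power2_eq_square)
  then have pos: "t * s > 0" using s k1 by simp
  have "(1 + t * s)\<^sup>2 \<le> (sqrt (1 + t\<^sup>2 * k))\<^sup>2"
    using le[of t] pos by (intro power_mono) auto
  also have "\<dots> = 1 + t\<^sup>2 * k" using k by simp
  finally have "1 + 2 * (t * s) + (t * s)\<^sup>2 \<le> 1 + t\<^sup>2 * k"
    by (simp add: power2_sum)
  then have "2 * (t * s) \<le> t\<^sup>2 * k"
    using zero_le_power2[of "t * s"] by linarith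
  also have "t\<^sup>2 * k = (t * s) * (k / (k + 1))" by (simp add: t_def power2_eq_square)
  also have "\<dots> \<le> (t * s) * 1" using pos k k1 by (intro mult_left_mono) auto
  finally show False using pos by linarith
qed

lemma cauchy_schwarz_pair:
  fixes a b c :: real
  assumes "0 \<le> a" "0 \<le> b"
  shows "a + c * b \<le> sqrt (1 + c\<^sup>2) * sqrt (a\<^sup>2 + b\<^sup>2)"
proof -
  have "(a + c * b)\<^sup>2 \<le> (1 + c\<^sup>2) * (a\<^sup>2 + b\<^sup>2)"
    using zero_le_power2[of "c * a - b"] by (simp add: power2_eq_square algebra_simps)
  then have "sqrt ((a + c * b)\<^sup>2) \<le> sqrt ((1 + c\<^sup>2) * (a\<^sup>2 + b\<^sup>2))" by (rule real_sqrt_le_mono)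
  then show ?thesis by (simp add: real_sqrt_mult)
qed

context group
begin

text \<open>A unital functional of norm one is a state, and \<open>u\<close> is its real part; the
  imaginary part at \<open>T\<close> is \<open>- u\<close> of the operator \<open>\<i> * T\<close>.
  As an ideal is closed under complex multiples, vanishing of \<open>u\<close> on \<open>I\<close>
  means vanishing of the state.\<close>

definition ideal_states :: "'a op set \<Rightarrow> ('a op \<Rightarrow> real) set" where
  "ideal_states I = {u \<in> dominated (bounded_ops G) (opnorm G). u (left_reg G \<one>) = 1 \<and> (\<forall>T\<in>I. u T = 0)}"

text \<open>A Neumann series argument: if \<open>1 + x\<close> had norm \<open>d < 1\<close>, then
  \<open>(1 + x) ^ n\<close> would lie in the coset \<open>1 + I\<close> and tend to 0. So the
  identity would belong to the closed ideal \<open>I\<close>, which would be everything.\<close>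

lemma ideal_distance:
  assumes I: "closed_ideal G (reduced_cstar G) I" "I \<noteq> reduced_cstar G" and x: "x \<in> I"
  shows "1 \<le> opnorm G (\<lambda>f z. left_reg G \<one> f z + x f z)"
proof (rule ccontr)
  define d where "d = opnorm G (\<lambda>f z. left_reg G \<one> f z + x f z)"
  assume "\<not> 1 \<le> opnorm G (\<lambda>f z. left_reg G \<one> f z + x f z)"
  then have d: "d < 1" by (simp add: d_def)
  have IA: "T \<in> reduced_cstar G" if "T \<in> I" for T using I that by (auto simp: closed_ideal_def)
  have IB: "T \<in> bounded_ops G" if "T \<in> I" for T using IA[OF that] by (rule reduced_cstar_bounded)
  have b1: "left_reg G \<one> \<in> bounded_ops G" by (rule left_reg_bounded) simp
  have bx: "x \<in> bounded_ops G" using IB x .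
  have b1x: "(\<lambda>f z. left_reg G \<one> f z + x f z) \<in> bounded_ops G" by (rule bounded_ops_plus[OF b1 bx])
  have d0: "0 \<le> d" unfolding d_def by (rule opnorm_nonneg[OF b1x])
  have plus: "(\<lambda>f z. S f z + T f z) \<in> I" if "S \<in> I" "T \<in> I" for S T
    using I that by (auto simp: closed_ideal_def)
  have scale: "(\<lambda>f z. a * S f z) \<in> I" if "S \<in> I" for S a
    using I that by (auto simp: closed_ideal_def)
  have comp: "T \<circ> S \<in> I" if "S \<in> I" "T \<in> reduced_cstar G" for S T
    using I that unfolding closed_ideal_def by blast
  have step: "\<exists>w\<in>I. opnorm G (\<lambda>f z. left_reg G \<one> f z - w f z) \<le> d ^ n" for n
  proof (induction n)
    case 0
    have "(\<lambda>_ _. 0) \<in> I" using I by (simp add: closed_ideal_def)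
    then show ?case using opnorm_left_reg_le[of \<one>] by (intro bexI[of _ "\<lambda>_ _. 0"]) simp_all
  next
    case (Suc n)
    then obtain w where w: "w \<in> I" "opnorm G (\<lambda>f z. left_reg G \<one> f z - w f z) \<le> d ^ n" by blast
    have bw: "w \<in> bounded_ops G" using IB w(1) .
    \<comment> \<open>Solves \<open>1 - v = (1 + x) (1 - w)\<close> for \<open>v\<close>.\<close>
    define v where "v = (\<lambda>f z. w f z + (-1 * x f z + (x \<circ> w) f z))"
    have vI: "v \<in> I"
      unfolding v_def by (rule plus[OF w(1) plus[OF scale[OF x] comp[OF w(1) IA[OF x]]]])
    have eq: "(\<lambda>f z. left_reg G \<one> f z - v f z) =
        (\<lambda>f z. left_reg G \<one> f z + x f z) \<circ> (\<lambda>f z. left_reg G \<one> f z - w f z)"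
    proof
      fix f
      show "(\<lambda>z. left_reg G \<one> f z - v f z) =
        ((\<lambda>f z. left_reg G \<one> f z + x f z) \<circ> (\<lambda>f z. left_reg G \<one> f z - w f z)) f"
      proof (cases "f \<in> l2 G")
        case True
        have wf: "w f \<in> l2 G" by (rule bounded_ops_l2[OF bw True])
        have xd: "x (\<lambda>z. f z - w f z) = (\<lambda>z. x f z - x (w f) z)"
          by (rule bounded_ops_diff[OF bx True wf])
        show ?thesis
          using left_reg_one[OF l2_diff[OF True wf]] by (simp add: left_reg_one[OF True] v_def xd) (simp add: algebra_simps)
      next
        case False
        then have "w f = (\<lambda>_. 0)" "x f = (\<lambda>_. 0)" "left_reg G \<one> f = (\<lambda>_. 0)"
          using bounded_ops_outside[OF bw] bounded_ops_outside[OF bx] bounded_ops_outside[OF b1] by auto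
        then show ?thesis by (simp add: v_def bounded_ops_zero[OF bx] bounded_ops_zero[OF b1])
      qed
    qed
    have "opnorm G (\<lambda>f z. left_reg G \<one> f z - v f z) \<le> d * opnorm G (\<lambda>f z. left_reg G \<one> f z - w f z)"
      unfolding eq d_def by (rule opnorm_compose[OF b1x bounded_ops_minus[OF b1 bw]])
    also have "\<dots> \<le> d * d ^ n" using w(2) d0 by (rule mult_left_mono)
    finally show ?case using vI by auto
  qed
  have "left_reg G \<one> \<in> I"
  proof -
    have "\<exists>S\<in>I. opnorm G (\<lambda>f z. left_reg G \<one> f z - S f z) < \<epsilon>" if e: "\<epsilon> > 0" for \<epsilon>
    proof -
      obtain n where "d ^ n < \<epsilon>" using real_arch_pow_inv[OF e d] by blast
      then show ?thesis using step[of n] by force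
    qed
    then show ?thesis using I(1) left_reg_reduced[OF one_closed] unfolding closed_ideal_def by blast
  qed
  then have "T \<in> I" if "T \<in> reduced_cstar G" for T
    using comp[OF _ that] compose_left_reg_one(1)[OF reduced_cstar_bounded[OF that]] by metis
  then show False using I(2) IA by blast
qed

text \<open>Hahn-Banach separates the affine subspace \<open>1 + I\<close> from the open unit ball.
  A functional bounded below on an affine subspace is constant there, so it vanishes on
  \<open>I\<close>, and its value at the identity is squeezed to 1.\<close>

lemma ideal_states_nonempty:
  assumes I: "closed_ideal G (reduced_cstar G) I" "I \<noteq> reduced_cstar G"
  shows "ideal_states I \<noteq> {}"
proof -
  let ?C = "(\<lambda>x. left_reg G \<one> + x) ` I"
  have IB: "T \<in> bounded_ops G" if "T \<in> I" for T
    using I that reduced_cstar_bounded by (auto simp: closed_ideal_def)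
  have plus: "S + T \<in> I" if "S \<in> I" "T \<in> I" for S T
    using I that unfolding closed_ideal_def plus_op by blast
  have scale: "a *\<^sub>R S \<in> I" if "S \<in> I" for S a
    using I that unfolding closed_ideal_def scaleR_op by blast
  have zero: "0 \<in> I" using I unfolding closed_ideal_def zero_op by blast
  have b1: "left_reg G \<one> \<in> bounded_ops G" by (rule left_reg_bounded) simp
  obtain L where L: "L \<in> dominated (bounded_ops G) (opnorm G)" "\<And>c. c \<in> ?C \<Longrightarrow> 1 \<le> L c"
  proof (rule dominated_separate[OF subspace_bounded_ops sublinear_opnorm, where C="?C" and \<epsilon>=1])
    show "?C \<subseteq> bounded_ops G" using IB b1 subspace_add[OF subspace_bounded_ops] by blast
    show "convex ?C"
    proof (rule convexI)
      fix x y and p q :: real assume "x \<in> ?C" "y \<in> ?C" and pq: "0 \<le> p" "0 \<le> q" "p + q = 1"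
      then obtain a b where ab: "a \<in> I" "b \<in> I" "x = left_reg G \<one> + a" "y = left_reg G \<one> + b" by blast
      have "p *\<^sub>R x + q *\<^sub>R y = (p + q) *\<^sub>R left_reg G \<one> + (p *\<^sub>R a + q *\<^sub>R b)"
        unfolding ab by (simp add: scaleR_add_right scaleR_add_left del: scaleR_fun_apply)
      then show "p *\<^sub>R x + q *\<^sub>R y \<in> ?C"
        using plus[OF scale[OF ab(1)] scale[OF ab(2)]] pq by auto
    qed
    show "?C \<noteq> {}" using zero by blast
    show "1 \<le> opnorm G c" if "c \<in> ?C" for c
      using that ideal_distance[OF I] by (auto simp: plus_op)
  qed blast
  have Lx: "1 \<le> L (left_reg G \<one>) + t * L x" if "x \<in> I" for x t
    using L(2)[of "left_reg G \<one> + t *\<^sub>R x"] scale[OF that, of t] dominatedD(2)[OF L(1) IB[OF that]]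
      dominatedD(1)[OF L(1) b1 IB[OF scale[OF that]], of t] by auto
  have "L x = 0" if x: "x \<in> I" for x
  proof (rule ccontr)
    assume "L x \<noteq> 0"
    \<comment> \<open>This multiple of \<open>x\<close> makes the functional vanish at a point of
      \<open>1 + I\<close>, where it should be at least 1.\<close>
    then show False using Lx[OF x, of "- L (left_reg G \<one>) / L x"] by simp
  qed
  moreover have "L (left_reg G \<one>) = 1"
    using Lx[OF zero, of 0] dominatedD(3)[OF L(1) b1] opnorm_left_reg_le[OF one_closed] by simp
  ultimately show ?thesis using L(1) unfolding ideal_states_def by blast
qed

lemma compact_ideal_states: "compact (ideal_states I)"
proof -
  have "ideal_states I = dominated (bounded_ops G) (opnorm G) \<inter>
      ({u. u (left_reg G \<one>) = 1} \<inter> (\<Inter>T\<in>I. {u. u T = 0}))"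
    by (auto simp: ideal_states_def)
  moreover have "closed ({u. u (left_reg G \<one>) = 1} \<inter> (\<Inter>T\<in>I. {u. u T = (0::real)}))"
    by (intro closed_Int closed_INT ballI closed_Collect_eq continuous_on_eval continuous_on_const)
  ultimately show ?thesis using compact_dominated[OF subspace_bounded_ops] by (metis compact_Int_closed)
qed

lemma ideal_states_abs_le:
  assumes "u \<in> ideal_states I" "T \<in> bounded_ops G"
  shows "\<bar>u T\<bar> \<le> opnorm G T"
proof -
  have u: "u \<in> dominated (bounded_ops G) (opnorm G)" using assms(1) by (simp add: ideal_states_def)
  have "opnorm G (- T) \<le> opnorm G T"
    using opnorm_cscale_le[OF assms(2), of "-1"] by (simp add: fun_Compl_def)
  then show ?thesis
    using dominatedD(3)[OF u assms(2)] dominatedD(3)[OF u subspace_neg[OF subspace_bounded_ops assms(2)]]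
      dominated_minus[OF u subspace_bounded_ops assms(2)] by simp
qed

section \<open>The action of means on states and its diagonal part\<close>

definition conj_op :: "'a \<Rightarrow> 'a op \<Rightarrow> 'a op" where
  "conj_op x T = left_reg G (inv x) \<circ> T \<circ> left_reg G x"

lemma conj_op_bounded: "x \<in> carrier G \<Longrightarrow> T \<in> bounded_ops G \<Longrightarrow> conj_op x T \<in> bounded_ops G"
  unfolding conj_op_def by (intro bounded_ops_compose left_reg_bounded) auto

lemma opnorm_conj_op_le:
  assumes x: "x \<in> carrier G" and T: "T \<in> bounded_ops G"
  shows "opnorm G (conj_op x T) \<le> opnorm G T"
proof (rule opnorm_leI)
  fix f assume f: "f \<in> l2 G"
  have xf: "left_reg G x f \<in> l2 G" by (rule left_reg_l2(1)[OF x f])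
  have "l2norm G (conj_op x T f) = l2norm G (T (left_reg G x f))"
    unfolding conj_op_def comp_apply using x by (intro left_reg_isometry bounded_ops_l2[OF T xf]) simp
  also have "\<dots> \<le> opnorm G T * l2norm G f"
    using opnorm_bound[OF T xf] by (simp add: left_reg_isometry[OF x f])
  finally show "l2norm G (conj_op x T f) \<le> opnorm G T * l2norm G f" .
qed (rule opnorm_nonneg[OF T])

lemma conj_op_plus:
  assumes x: "x \<in> carrier G" and S: "S \<in> bounded_ops G" and T: "T \<in> bounded_ops G"
  shows "conj_op x (S + T) = conj_op x S + conj_op x T"
proof
  fix f
  have ix: "left_reg G (inv x) \<in> bounded_ops G" using x by (intro left_reg_bounded) simp
  show "conj_op x (S + T) f = (conj_op x S + conj_op x T) f"
  proof (cases "f \<in> l2 G")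
    case True
    have xf: "left_reg G x f \<in> l2 G" by (rule left_reg_l2(1)[OF x True])
    show ?thesis
      using bounded_ops_add[OF ix bounded_ops_l2[OF S xf] bounded_ops_l2[OF T xf]]
      by (simp add: conj_op_def plus_fun_def)
  next
    case False
    then have "left_reg G x f = (\<lambda>_. 0)" by (simp add: left_reg_def)
    then show ?thesis using bounded_ops_zero[OF S] bounded_ops_zero[OF T] bounded_ops_zero[OF ix]
      by (simp add: conj_op_def plus_fun_def)
  qed
qed

lemma conj_op_cscale:
  assumes x: "x \<in> carrier G" and T: "T \<in> bounded_ops G"
  shows "conj_op x (\<lambda>f z. a * T f z) = (\<lambda>f z. a * conj_op x T f z)"
proof
  fix f
  have ix: "left_reg G (inv x) \<in> bounded_ops G" using x by (intro left_reg_bounded) simp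
  show "conj_op x (\<lambda>f z. a * T f z) f = (\<lambda>z. a * conj_op x T f z)"
  proof (cases "f \<in> l2 G")
    case True
    have xf: "left_reg G x f \<in> l2 G" by (rule left_reg_l2(1)[OF x True])
    show ?thesis using bounded_ops_scale[OF ix bounded_ops_l2[OF T xf]] by (simp add: conj_op_def)
  next
    case False
    then have "left_reg G x f = (\<lambda>_. 0)" by (simp add: left_reg_def)
    then show ?thesis using bounded_ops_zero[OF T] bounded_ops_zero[OF ix] by (simp add: conj_op_def)
  qed
qed

lemma conj_op_left_reg:
  assumes "x \<in> carrier G" "h \<in> carrier G"
  shows "conj_op x (left_reg G h) = left_reg G (inv x \<otimes> h \<otimes> x)"
  using assms by (simp add: conj_op_def left_reg_mult m_assoc)

lemma conj_op_mult_op: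
  assumes x: "x \<in> carrier G" and \<phi>: "\<phi> \<in> bdd_fun G"
  shows "conj_op x (mult_op G \<phi>) = mult_op G (\<lambda>y. \<phi> (x \<otimes> y))"
proof -
  have "conj_op x (mult_op G \<phi>) = left_reg G (inv x) \<circ> (left_reg G x \<circ> mult_op G (\<lambda>y. \<phi> (x \<otimes> y)))"
    unfolding conj_op_def comp_assoc left_reg_mult_op[OF x \<phi>] ..
  also have "\<dots> = left_reg G \<one> \<circ> mult_op G (\<lambda>y. \<phi> (x \<otimes> y))"
    using x by (simp add: comp_assoc[symmetric] left_reg_mult)
  also have "\<dots> = mult_op G (\<lambda>y. \<phi> (x \<otimes> y))"
    by (rule compose_left_reg_one(2)[OF mult_op_bounded[OF bdd_fun_translate[OF \<phi> x]]])
  finally show ?thesis .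
qed

text \<open>The barycentre under \<open>m\<close> of the translates of \<open>u\<close>; for
  \<open>m = dirac g\<close> it is the single translate by \<open>g\<close>.\<close>

definition act :: "(('a \<Rightarrow> real) \<Rightarrow> real) \<Rightarrow> ('a op \<Rightarrow> real) \<Rightarrow> 'a op \<Rightarrow> real" where
  "act m u T = (if T \<in> bounded_ops G then m (\<lambda>x. u (conj_op x T)) else 0)"

lemma act_ideal_states:
  assumes I: "closed_ideal G (reduced_cstar G) I" and m: "m \<in> means G" and u: "u \<in> ideal_states I"
  shows "act m u \<in> ideal_states I"
proof -
  have ud: "u \<in> dominated (bounded_ops G) (opnorm G)" using u by (simp add: ideal_states_def)
  have bd: "\<bar>u (conj_op x T)\<bar> \<le> opnorm G T" if "x \<in> carrier G" "T \<in> bounded_ops G" for x T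
    using ideal_states_abs_le[OF u conj_op_bounded[OF that]] opnorm_conj_op_le[OF that] by simp
  have bf: "(\<lambda>x. u (conj_op x T)) \<in> bdd_fun G" if "T \<in> bounded_ops G" for T
    by (rule bdd_funI) (rule bd[OF _ that])
  have "act m u \<in> dominated (bounded_ops G) (opnorm G)"
    unfolding dominated_def
  proof (intro CollectI conjI ballI allI impI)
    fix S T assume ST: "S \<in> bounded_ops G" "T \<in> bounded_ops G"
    have "act m u (S + T) = m (\<lambda>x. u (conj_op x (S + T)))"
      using subspace_add[OF subspace_bounded_ops ST] by (simp add: act_def)
    also have "\<dots> = m (\<lambda>x. u (conj_op x S) + u (conj_op x T))"
      by (rule mean_cong[OF m]) (simp add: conj_op_plus ST dominatedD(1)[OF ud] conj_op_bounded)
    also have "\<dots> = act m u S + act m u T"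
      using mean_add[OF m bf[OF ST(1)] bf[OF ST(2)]] ST by (simp add: act_def)
    finally show "act m u (S + T) = act m u S + act m u T" .
  next
    fix T and c :: real assume T: "T \<in> bounded_ops G"
    have "act m u (c *\<^sub>R T) = m (\<lambda>x. u (conj_op x (c *\<^sub>R T)))"
      using subspace_scale[OF subspace_bounded_ops T] by (simp add: act_def)
    also have "\<dots> = m (\<lambda>x. c * u (conj_op x T))"
    proof (rule mean_cong[OF m])
      fix x assume x: "x \<in> carrier G"
      have "conj_op x (c *\<^sub>R T) = c *\<^sub>R conj_op x T"
        unfolding scaleR_op by (rule conj_op_cscale[OF x T])
      then show "u (conj_op x (c *\<^sub>R T)) = c * u (conj_op x T)"
        using dominatedD(2)[OF ud conj_op_bounded[OF x T]] by simp
    qed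
    also have "\<dots> = c * act m u T"
      using mean_cmult[OF m bf[OF T]] T by (simp add: act_def)
    finally show "act m u (c *\<^sub>R T) = c * act m u T" .
  next
    fix T assume T: "T \<in> bounded_ops G"
    have "m (\<lambda>x. u (conj_op x T)) \<le> opnorm G T"
    proof (rule mean_le[OF m bf[OF T]])
      fix x assume "x \<in> carrier G"
      from bd[OF this T] show "u (conj_op x T) \<le> opnorm G T" by simp
    qed
    then show "act m u T \<le> opnorm G T" using T by (simp add: act_def)
  qed (simp add: act_def)
  moreover have "act m u (left_reg G \<one>) = 1"
  proof -
    have "act m u (left_reg G \<one>) = m (\<lambda>x. u (conj_op x (left_reg G \<one>)))"
      by (simp add: act_def left_reg_bounded)
    also have "\<dots> = m (\<lambda>_. 1)"
      using u by (intro mean_cong[OF m]) (simp add: conj_op_left_reg ideal_states_def)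
    finally show ?thesis using mean_const[OF m] by simp
  qed
  moreover have "act m u T = 0" if T: "T \<in> I" for T
  proof -
    have "conj_op x T \<in> I" if x: "x \<in> carrier G" for x
    proof -
      have "left_reg G (inv x) \<in> reduced_cstar G" "left_reg G x \<in> reduced_cstar G"
        using x by (auto intro: left_reg_reduced)
      then show ?thesis using I T unfolding closed_ideal_def conj_op_def by blast
    qed
    then have "m (\<lambda>x. u (conj_op x T)) = m (\<lambda>_. 0)"
      using u by (intro mean_cong[OF m]) (simp add: ideal_states_def)
    then show ?thesis using mean_const[OF m] by (simp add: act_def)
  qed
  ultimately show ?thesis by (simp add: ideal_states_def)
qed

definition diag_mean :: "('a op \<Rightarrow> real) \<Rightarrow> ('a \<Rightarrow> real) \<Rightarrow> real" where
  "diag_mean u \<phi> = (if \<phi> \<in> bdd_fun G then u (mult_op G \<phi>) else 0)"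

text \<open>Positivity on the diagonal has to come out of a norm bound. A function bounded above by
  \<open>c\<close> is shifted until its absolute values are at most \<open>k\<close> and its upper
  bound is exactly \<open>k\<close>; then the norm estimate is the wanted one-sided
  estimate.\<close>

lemma diag_mean_means:
  assumes u: "u \<in> ideal_states I"
  shows "diag_mean u \<in> means G"
proof (rule meansI)
  have ud: "u \<in> dominated (bounded_ops G) (opnorm G)" and u1: "u (mult_op G (\<lambda>_. 1)) = 1"
    using u by (auto simp: ideal_states_def mult_op_one)
  show add: "diag_mean u (\<lambda>x. \<phi> x + \<psi> x) = diag_mean u \<phi> + diag_mean u \<psi>"
    if "\<phi> \<in> bdd_fun G" "\<psi> \<in> bdd_fun G" for \<phi> \<psi>
    using that bdd_fun_add[OF that] dominatedD(1)[OF ud] by (simp add: diag_mean_def mult_op_plus mult_op_bounded)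
  show scale: "diag_mean u (\<lambda>x. a * \<phi> x) = a * diag_mean u \<phi>" if "\<phi> \<in> bdd_fun G" for \<phi> a
    using that bdd_fun_cmult[OF that] dominatedD(2)[OF ud] by (simp add: diag_mean_def mult_op_scaleR mult_op_bounded)
  have const: "diag_mean u (\<lambda>_. c) = c" for c
    using scale[OF bdd_fun_const[of 1], of c] u1 bdd_fun_const[of 1 G] by (simp add: diag_mean_def)
  fix \<phi> c assume \<phi>: "\<phi> \<in> bdd_fun G" and le: "\<And>x. x \<in> carrier G \<Longrightarrow> \<phi> x \<le> c"
  obtain b where b: "0 \<le> b" "\<And>x. x \<in> carrier G \<Longrightarrow> \<bar>\<phi> x\<bar> \<le> b"
    by (rule bdd_funE[OF \<phi>], rule that)
  \<comment> \<open>Then \<open>\<phi> x + (k - c) \<le> k\<close> follows from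
    \<open>\<phi> x \<le> c\<close>, and the lower bound \<open>- k\<close> follows from
    \<open>\<bar>\<phi> x\<bar> \<le> b\<close>.\<close>
  define k where "k = b + \<bar>c\<bar>"
  have k: "0 \<le> k" using b by (simp add: k_def)
  have k2: "\<bar>\<phi> x + (k - c)\<bar> \<le> k" if "x \<in> carrier G" for x
    using b(1) b(2)[OF that] le[OF that] unfolding k_def by linarith
  have "u (mult_op G (\<lambda>x. \<phi> x + (k - c))) \<le> k"
    using dominatedD(3)[OF ud mult_op_bounded[OF bdd_fun_add[OF \<phi> bdd_fun_const]], of "k - c"]
      opnorm_mult_op_le[OF k, of G "\<lambda>x. \<phi> x + (k - c)"] k2 by simp
  then have "diag_mean u (\<lambda>x. \<phi> x + (k - c)) \<le> k"
    using bdd_fun_add[OF \<phi> bdd_fun_const] by (simp add: diag_mean_def)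
  then show "diag_mean u \<phi> \<le> c"
    using add[OF \<phi> bdd_fun_const, of "k - c"] const[of "k - c"] by simp
qed (simp add: diag_mean_def)

lemma diag_mean_act:
  assumes u: "u \<in> ideal_states I" and m: "m \<in> means G"
  shows "diag_mean (act m u) = conv m (diag_mean u)"
proof
  fix \<phi>
  show "diag_mean (act m u) \<phi> = conv m (diag_mean u) \<phi>"
  proof (cases "\<phi> \<in> bdd_fun G")
    case True
    have "m (\<lambda>x. u (conj_op x (mult_op G \<phi>))) = m (\<lambda>x. diag_mean u (\<lambda>y. \<phi> (x \<otimes> y)))"
      by (rule mean_cong[OF m]) (simp add: conj_op_mult_op True diag_mean_def bdd_fun_translate)
    then show ?thesis using True by (simp add: diag_mean_def act_def conv_def mult_op_bounded)
  qed (simp add: diag_mean_def conv_def)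
qed

text \<open>The map \<open>diag_mean\<close> intertwines \<open>act\<close> with
  \<open>conv\<close>. This lets the defining property of \<open>extreme_mean\<close> be applied to
  states: some state in the set has a diagonal mean fixing \<open>w\<close>.\<close>

lemma diag_mean_closed_left_ideal:
  assumes I: "closed_ideal G (reduced_cstar G) I" "I \<noteq> reduced_cstar G"
  shows "closed_left_ideal (diag_mean ` ideal_states I)"
  unfolding closed_left_ideal_def
proof (intro conjI ballI)
  have "continuous_on (ideal_states I) diag_mean"
  proof (rule continuous_on_coordinatewise_then_product)
    fix \<phi> show "continuous_on (ideal_states I) (\<lambda>u. diag_mean u \<phi>)"
      by (cases "\<phi> \<in> bdd_fun G") (simp_all add: diag_mean_def continuous_on_eval)
  qed
  then show "closed (diag_mean ` ideal_states I)"
    by (intro compact_imp_closed compact_continuous_image compact_ideal_states)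
  show "diag_mean ` ideal_states I \<noteq> {}" using ideal_states_nonempty[OF I] by simp
  show "diag_mean ` ideal_states I \<subseteq> means G" using diag_mean_means by blast
  fix m j assume m: "m \<in> means G" and "j \<in> diag_mean ` ideal_states I"
  then obtain u where u: "u \<in> ideal_states I" "j = diag_mean u" by blast
  then show "conv m j \<in> diag_mean ` ideal_states I"
    using diag_mean_act[OF u(1) m] act_ideal_states[OF I(1) m u(1)] by (metis imageI)
qed

section \<open>Means that fix an extreme point are concentrated near it\<close>

lemma mean_indicat_mult_abs_le:
  assumes m: "m \<in> means G" and F: "F \<in> bdd_fun G" "\<And>x. x \<in> carrier G \<Longrightarrow> \<bar>F x\<bar> \<le> c"
  shows "\<bar>m (\<lambda>x. indicat_real E x * F x)\<bar> \<le> c * m (indicat_real E)"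
proof -
  have b: "(\<lambda>x. indicat_real E x * F x) \<in> bdd_fun G" "(\<lambda>x. c * indicat_real E x) \<in> bdd_fun G"
    "(\<lambda>x. - c * indicat_real E x) \<in> bdd_fun G"
    by (intro bdd_fun_mult bdd_fun_indicat F bdd_fun_cmult)+
  have "m (\<lambda>x. indicat_real E x * F x) \<le> m (\<lambda>x. c * indicat_real E x)"
    using F(2) by (intro mean_mono[OF m b(1,2)]) (auto simp: indicator_def abs_le_iff)
  moreover have "m (\<lambda>x. - c * indicat_real E x) \<le> m (\<lambda>x. indicat_real E x * F x)"
    using F(2) by (intro mean_mono[OF m b(3,1)]) (force simp: indicator_def abs_le_iff)
  ultimately show ?thesis
    using mean_cmult[OF m bdd_fun_indicat, of c E] mean_cmult[OF m bdd_fun_indicat, of "- c" E] by simp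
qed

lemma conditional_mean:
  assumes m: "m \<in> means G" and pos: "0 < m (indicat_real E)"
  defines "n \<equiv> \<lambda>\<phi>. if \<phi> \<in> bdd_fun G then m (\<lambda>x. indicat_real E x * \<phi> x) / m (indicat_real E) else 0"
  shows "n \<in> means G"
proof (rule meansI)
  have b: "(\<lambda>x. indicat_real E x * \<phi> x) \<in> bdd_fun G" if "\<phi> \<in> bdd_fun G" for \<phi>
    using that by (intro bdd_fun_mult bdd_fun_indicat)
  show "n (\<lambda>x. \<phi> x + \<psi> x) = n \<phi> + n \<psi>" if "\<phi> \<in> bdd_fun G" "\<psi> \<in> bdd_fun G" for \<phi> \<psi>
    using that mean_add[OF m b[OF that(1)] b[OF that(2)]] bdd_fun_add[OF that]
    by (simp add: n_def distrib_left add_divide_distrib)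
  show "n (\<lambda>x. a * \<phi> x) = a * n \<phi>" if "\<phi> \<in> bdd_fun G" for \<phi> a
    using that mean_cmult[OF m b[OF that], of a] bdd_fun_cmult[OF that, of a]
    by (simp add: n_def mult.left_commute)
  show "n \<phi> \<le> c" if \<phi>: "\<phi> \<in> bdd_fun G" "\<And>x. x \<in> carrier G \<Longrightarrow> \<phi> x \<le> c" for \<phi> c
  proof -
    have "m (\<lambda>x. indicat_real E x * \<phi> x) \<le> m (\<lambda>x. c * indicat_real E x)"
      using \<phi> by (intro mean_mono[OF m b] bdd_fun_cmult bdd_fun_indicat) (auto simp: indicator_def)
    also have "\<dots> = c * m (indicat_real E)" by (rule mean_cmult[OF m bdd_fun_indicat])
    finally show ?thesis using \<phi> pos by (simp add: n_def field_simps)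
  qed
qed (simp add: n_def)

text \<open>Conditioning the mean \<open>m\<close> on \<open>E\<close> writes the extreme point \<open>w\<close> as a convex combination,
  so \<open>m\<close> behaves like a point mass at \<open>w\<close>.\<close>

lemma extreme_mean_multiplicative:
  assumes w: "extreme_mean w" and m: "m \<in> means G" and mw: "conv m w = w" and \<phi>: "\<phi> \<in> bdd_fun G"
  shows "m (\<lambda>x. indicat_real E x * w (\<lambda>y. \<phi> (x \<otimes> y))) = m (indicat_real E) * w \<phi>"
proof -
  have wm: "w \<in> means G" using w by (simp add: extreme_mean_def)
  define F where "F x = w (\<lambda>y. \<phi> (x \<otimes> y))" for x
  have F: "F \<in> bdd_fun G" unfolding F_def by (rule bdd_fun_orbit[OF \<phi> wm])
  obtain c where c: "0 \<le> c" "\<And>x. x \<in> carrier G \<Longrightarrow> \<bar>F x\<bar> \<le> c"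
    by (rule bdd_funE[OF F], rule that)
  have mF: "m F = w \<phi>"
    using fun_cong[OF mw, of \<phi>] \<phi> by (simp add: conv_def F_def[abs_def])
  have bi: "(\<lambda>x. indicat_real A x * \<psi> x) \<in> bdd_fun G" if "\<psi> \<in> bdd_fun G" for A \<psi>
    by (intro bdd_fun_mult bdd_fun_indicat that)
  have split: "m (\<lambda>x. indicat_real E x * \<psi> x) + m (\<lambda>x. indicat_real (- E) x * \<psi> x) = m \<psi>"
    if "\<psi> \<in> bdd_fun G" for \<psi>
  proof -
    have "m \<psi> = m (\<lambda>x. indicat_real E x * \<psi> x + indicat_real (- E) x * \<psi> x)"
      by (rule mean_cong[OF m]) (auto simp: indicator_def)
    then show ?thesis using mean_add[OF m bi[OF that] bi[OF that]] by simp
  qed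
  have s1: "m (indicat_real E) + m (indicat_real (- E)) = 1"
    using split[OF bdd_fun_const[of 1]] mean_const[OF m] by simp
  have nn: "0 \<le> m (indicat_real A)" for A
    by (rule mean_ge[OF m bdd_fun_indicat]) simp
  have zero: "m (\<lambda>x. indicat_real A x * F x) = 0" if "m (indicat_real A) = 0" for A
    using mean_indicat_mult_abs_le[OF m F c(2), of A] that by simp
  have "m (\<lambda>x. indicat_real E x * F x) = m (indicat_real E) * w \<phi>"
  \<comment> \<open>Conditioning requires both \<open>E\<close> and its complement to have positive
    measure; if one of them is null, its contribution vanishes and the other carries the whole
    mean.\<close>
  proof (cases "m (indicat_real E) = 0 \<or> m (indicat_real (- E)) = 0")
    case True
    then show ?thesis using zero[of E] zero[of "- E"] split[OF F] s1 mF by auto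
  next
    case False
    define a where "a = m (indicat_real E)"
    have a: "0 < a" "a < 1" "m (indicat_real (- E)) = 1 - a"
      using False nn[of E] nn[of "- E"] s1 by (auto simp: a_def)
    define n where "n A \<psi> = (if \<psi> \<in> bdd_fun G then m (\<lambda>x. indicat_real A x * \<psi> x) / m (indicat_real A) else 0)"
      for A \<psi>
    have n: "n E \<in> means G" "n (- E) \<in> means G"
      unfolding n_def using a by (intro conditional_mean m; simp add: a_def)+
    have "w = a *\<^sub>R conv (n E) w + (1 - a) *\<^sub>R conv (n (- E)) w"
    proof
      fix \<psi>
      show "w \<psi> = (a *\<^sub>R conv (n E) w + (1 - a) *\<^sub>R conv (n (- E)) w) \<psi>"
      proof (cases "\<psi> \<in> bdd_fun G")
        case True
        have o: "(\<lambda>x. w (\<lambda>y. \<psi> (x \<otimes> y))) \<in> bdd_fun G" by (rule bdd_fun_orbit[OF True wm])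
        have "w \<psi> = m (\<lambda>x. w (\<lambda>y. \<psi> (x \<otimes> y)))"
          using fun_cong[OF mw, of \<psi>] True by (simp add: conv_def)
        then show ?thesis
          using split[OF o] True o a by (simp add: conv_def n_def a_def[symmetric])
      qed (simp add: conv_def mean_outside[OF wm])
    qed
    then have "conv (n E) w = w" using w n a(1,2) unfolding extreme_mean_def by blast
    from fun_cong[OF this, of \<phi>] have "n E F = w \<phi>" using \<phi> by (simp add: conv_def F_def[abs_def])
    then show ?thesis using F a by (simp add: n_def a_def[symmetric] field_simps)
  qed
  then show ?thesis by (simp add: F_def)
qed

text \<open>On the set where the translate of \<open>w\<close> exceeds \<open>w \<psi>\<close> by
  \<open>\<epsilon>\<close>, the average would still have to be \<open>w \<psi>\<close>, so the set
  is null. Taking \<open>\<psi> = \<phi>\<close> and \<open>\<psi> = - \<phi>\<close> covers both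
  sides.\<close>

lemma extreme_mean_concentrated:
  assumes w: "extreme_mean w" and m: "m \<in> means G" and mw: "conv m w = w" and \<phi>: "\<phi> \<in> bdd_fun G"
    and \<epsilon>: "\<epsilon> > 0"
  shows "m (indicat_real {x. \<bar>w (\<lambda>y. \<phi> (x \<otimes> y)) - w \<phi>\<bar> < \<epsilon>}) = 1"
proof -
  have wm: "w \<in> means G" using w by (simp add: extreme_mean_def)
  have null: "m (indicat_real {x. w (\<lambda>y. \<psi> (x \<otimes> y)) \<ge> w \<psi> + \<epsilon>}) = 0" if \<psi>: "\<psi> \<in> bdd_fun G" for \<psi>
  proof -
    define E where "E = {x. w (\<lambda>y. \<psi> (x \<otimes> y)) \<ge> w \<psi> + \<epsilon>}"
    have o: "(\<lambda>x. w (\<lambda>y. \<psi> (x \<otimes> y))) \<in> bdd_fun G" by (rule bdd_fun_orbit[OF \<psi> wm])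
    have "m (\<lambda>x. (w \<psi> + \<epsilon>) * indicat_real E x) \<le> m (\<lambda>x. indicat_real E x * w (\<lambda>y. \<psi> (x \<otimes> y)))"
      by (intro mean_mono[OF m] bdd_fun_cmult bdd_fun_mult bdd_fun_indicat o) (auto simp: indicator_def E_def)
    then have "(w \<psi> + \<epsilon>) * m (indicat_real E) \<le> m (indicat_real E) * w \<psi>"
      using mean_cmult[OF m bdd_fun_indicat, of "w \<psi> + \<epsilon>" E] extreme_mean_multiplicative[OF w m mw \<psi>, of E] by simp
    then have "\<epsilon> * m (indicat_real E) \<le> 0" by (simp add: algebra_simps)
    moreover have "0 \<le> m (indicat_real E)" by (rule mean_ge[OF m bdd_fun_indicat]) simp
    ultimately have "m (indicat_real E) = 0" using \<epsilon> by (simp add: mult_le_0_iff)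
    then show ?thesis by (simp add: E_def)
  qed
  let ?E = "{x. \<bar>w (\<lambda>y. \<phi> (x \<otimes> y)) - w \<phi>\<bar> < \<epsilon>}"
  let ?D1 = "{x. w (\<lambda>y. \<phi> (x \<otimes> y)) \<ge> w \<phi> + \<epsilon>}"
  let ?D2 = "{x. w (\<lambda>y. -1 * \<phi> (x \<otimes> y)) \<ge> w (\<lambda>y. -1 * \<phi> y) + \<epsilon>}"
  have neg: "w (\<lambda>y. -1 * \<phi> (x \<otimes> y)) = - w (\<lambda>y. \<phi> (x \<otimes> y))" if "x \<in> carrier G" for x
    using mean_cmult[OF wm bdd_fun_translate[OF \<phi> that], of "-1"] by simp
  have neg1: "w (\<lambda>y. -1 * \<phi> y) = - w \<phi>" using mean_cmult[OF wm \<phi>, of "-1"] by simp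
  have "m (\<lambda>_. 1) \<le> m (\<lambda>x. indicat_real ?E x + (indicat_real ?D1 x + indicat_real ?D2 x))"
  proof (rule mean_mono[OF m])
    fix x assume x: "x \<in> carrier G"
    have "x \<in> ?E \<or> x \<in> ?D1 \<or> x \<in> ?D2"
      unfolding mem_Collect_eq neg[OF x] neg1 by linarith
    then show "1 \<le> indicat_real ?E x + (indicat_real ?D1 x + indicat_real ?D2 x)"
      by (elim disjE) (simp_all add: indicator_def del: mem_Collect_eq)
  qed (intro bdd_fun_const bdd_fun_add bdd_fun_indicat)+
  also have "\<dots> = m (indicat_real ?E) + (m (indicat_real ?D1) + m (indicat_real ?D2))"
    by (simp only: mean_add[OF m bdd_fun_indicat bdd_fun_add[OF bdd_fun_indicat bdd_fun_indicat]]
        mean_add[OF m bdd_fun_indicat bdd_fun_indicat])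
  also have "\<dots> = m (indicat_real ?E)"
    using null[OF \<phi>] null[OF bdd_fun_cmult[OF \<phi>, of "-1"]] by simp
  finally have "1 \<le> m (indicat_real ?E)" using mean_const[OF m] by simp
  moreover have "m (indicat_real ?E) \<le> 1"
    by (rule mean_le[OF m bdd_fun_indicat]) (simp add: indicator_def)
  ultimately show ?thesis by simp
qed

section \<open>Cutting operators by diagonal projections\<close>

lemma mult_op_indicat_apply:
  "f \<in> l2 G \<Longrightarrow> mult_op G (indicat_real E) f = (\<lambda>x. if x \<in> E then f x else 0)"
  by (auto simp: mult_op_def indicator_def)

lemma mult_op_indicat_bounded: "mult_op G (indicat_real E) \<in> bounded_ops G"
  by (rule mult_op_bounded[OF bdd_fun_indicat])

lemma mult_op_indicat_split:
  assumes f: "f \<in> l2 G"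
  shows "(l2norm G f)\<^sup>2 =
    (l2norm G (mult_op G (indicat_real E) f))\<^sup>2 + (l2norm G (mult_op G (indicat_real (- E)) f))\<^sup>2"
proof -
  have "(\<lambda>x. if x \<in> - E then f x else 0) = (\<lambda>x. if x \<in> E then 0 else f x)" by auto
  then show ?thesis using l2norm_split[OF f, of E] by (simp add: mult_op_indicat_apply[OF f])
qed

lemma mult_op_indicat_add:
  assumes T: "T \<in> bounded_ops G"
  shows "(mult_op G (indicat_real E) \<circ> T) + (mult_op G (indicat_real (- E)) \<circ> T) = T"
    and "(T \<circ> mult_op G (indicat_real E)) + (T \<circ> mult_op G (indicat_real (- E))) = T"
proof -
  have "((mult_op G (indicat_real E) \<circ> T) + (mult_op G (indicat_real (- E)) \<circ> T)) f x = T f x" for f x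
    by (cases "f \<in> l2 G") (auto simp: mult_op_indicat_apply bounded_ops_l2[OF T] bounded_ops_outside[OF T])
  then show "(mult_op G (indicat_real E) \<circ> T) + (mult_op G (indicat_real (- E)) \<circ> T) = T" by (simp add: fun_eq_iff)
  have "((T \<circ> mult_op G (indicat_real E)) + (T \<circ> mult_op G (indicat_real (- E)))) f = T f" for f
  proof (cases "f \<in> l2 G")
    case True
    have "T f = T (\<lambda>x. mult_op G (indicat_real E) f x + mult_op G (indicat_real (- E)) f x)"
      by (rule arg_cong[where f=T]) (auto simp: mult_op_indicat_apply[OF True])
    also have "\<dots> = (\<lambda>x. T (mult_op G (indicat_real E) f) x + T (mult_op G (indicat_real (- E)) f) x)"
      by (intro bounded_ops_add[OF T] bounded_ops_l2[OF mult_op_indicat_bounded True])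
    finally show ?thesis by (simp add: plus_fun_def)
  next
    case False
    then show ?thesis by (simp add: mult_op_def bounded_ops_outside[OF T] bounded_ops_zero[OF T] plus_fun_def)
  qed
  then show "(T \<circ> mult_op G (indicat_real E)) + (T \<circ> mult_op G (indicat_real (- E))) = T" by blast
qed

text \<open>Cauchy-Schwarz for a state, in terms of norms only: if \<open>u\<close> sees all of the projection \<open>P\<close>
  and \<open>Q = 1 - P\<close>, then \<open>1 + t * u (Q \<circ> T) = u (P + t Q T)\<close>, while \<open>P + t Q T\<close> has norm
  at most \<open>sqrt (1 + t\<^sup>2 * \<parallel>T\<parallel>\<^sup>2)\<close>.\<close>

lemma ideal_state_project:
  assumes u: "u \<in> ideal_states I" and E: "u (mult_op G (indicat_real E)) = 1" and T: "T \<in> bounded_ops G"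
  shows "u (mult_op G (indicat_real (- E)) \<circ> T) = 0" and "u (T \<circ> mult_op G (indicat_real (- E))) = 0"
proof -
  define P where "P = mult_op G (indicat_real E)"
  define Q where "Q = mult_op G (indicat_real (- E))"
  define c where "c = opnorm G T"
  have ud: "u \<in> dominated (bounded_ops G) (opnorm G)" using u by (simp add: ideal_states_def)
  have bP: "P \<in> bounded_ops G" and bQ: "Q \<in> bounded_ops G" by (simp_all add: P_def Q_def mult_op_indicat_bounded)
  have split: "(l2norm G f)\<^sup>2 = (l2norm G (P f))\<^sup>2 + (l2norm G (Q f))\<^sup>2" if "f \<in> l2 G" for f
    unfolding P_def Q_def by (rule mult_op_indicat_split[OF that])
  have c0: "0 \<le> c" unfolding c_def by (rule opnorm_nonneg[OF T])
  \<comment> \<open>The first-order argument, common to multiplication by \<open>Q\<close> on either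
    side; only the bound for the norm of \<open>P + t S\<close> differs.\<close>
  have main: "u S = 0"
    if S: "S \<in> bounded_ops G"
      and b: "\<And>t f. f \<in> l2 G \<Longrightarrow> l2norm G ((P + t *\<^sub>R S) f) \<le> sqrt (1 + t\<^sup>2 * c\<^sup>2) * l2norm G f" for S
  proof (rule sqrt_bound_zero[of "c\<^sup>2"])
    fix t
    have tS: "t *\<^sub>R S \<in> bounded_ops G" by (rule subspace_scale[OF subspace_bounded_ops S])
    have "u (P + t *\<^sub>R S) \<le> opnorm G (P + t *\<^sub>R S)"
      by (rule dominatedD(3)[OF ud subspace_add[OF subspace_bounded_ops bP tS]])
    also have "\<dots> \<le> sqrt (1 + t\<^sup>2 * c\<^sup>2)" by (rule opnorm_leI[OF b]) auto
    finally show "1 + t * u S \<le> sqrt (1 + t\<^sup>2 * c\<^sup>2)"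
      using dominatedD(1)[OF ud bP tS] dominatedD(2)[OF ud S] E by (simp add: P_def)
  qed simp
  have "u (Q \<circ> T) = 0"
  proof (rule main[OF bounded_ops_compose[OF bQ T]])
    fix t f assume f: "f \<in> l2 G"
    have Tf: "T f \<in> l2 G" by (rule bounded_ops_l2[OF T f])
    define h where "h = (P + t *\<^sub>R (Q \<circ> T)) f"
    have h: "h x = (if x \<in> E then f x else of_real t * T f x)" for x
      using f Tf by (simp add: h_def P_def Q_def mult_op_indicat_apply scaleR_conv_of_real)
    have hl: "h \<in> l2 G"
      unfolding h_def
      by (intro bounded_ops_l2[OF _ f] subspace_add[OF subspace_bounded_ops] subspace_scale[OF subspace_bounded_ops]
          bP bounded_ops_compose[OF bQ T])
    have "P h = P f" "Q h = (\<lambda>x. of_real t * Q (T f) x)"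
      unfolding P_def Q_def mult_op_indicat_apply[OF hl] mult_op_indicat_apply[OF f] mult_op_indicat_apply[OF Tf]
      by (auto simp: h)
    then have "(l2norm G h)\<^sup>2 = (l2norm G (P f))\<^sup>2 + t\<^sup>2 * (l2norm G (Q (T f)))\<^sup>2"
      using split[OF hl] by (simp add: l2norm_scale power_mult_distrib)
    also have "\<dots> \<le> (l2norm G f)\<^sup>2 + t\<^sup>2 * (c * l2norm G f)\<^sup>2"
    proof (intro add_mono mult_left_mono)
      show "(l2norm G (P f))\<^sup>2 \<le> (l2norm G f)\<^sup>2" using split[OF f] by simp
      have "(l2norm G (Q (T f)))\<^sup>2 \<le> (l2norm G (T f))\<^sup>2" using split[OF Tf] by simp
      also have "\<dots> \<le> (c * l2norm G f)\<^sup>2"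
        unfolding c_def by (intro power_mono opnorm_bound[OF T f] l2norm_nonneg)
      finally show "(l2norm G (Q (T f)))\<^sup>2 \<le> (c * l2norm G f)\<^sup>2" .
    qed simp
    also have "\<dots> = (sqrt (1 + t\<^sup>2 * c\<^sup>2) * l2norm G f)\<^sup>2"
      by (simp add: power_mult_distrib algebra_simps)
    finally show "l2norm G ((P + t *\<^sub>R (Q \<circ> T)) f) \<le> sqrt (1 + t\<^sup>2 * c\<^sup>2) * l2norm G f"
      unfolding h_def[symmetric] by (rule power2_le_imp_le) simp
  qed
  then show "u (mult_op G (indicat_real (- E)) \<circ> T) = 0" by (simp add: Q_def)
  \<comment> \<open>Here \<open>P f\<close> and \<open>T (Q f)\<close> need not be orthogonal.
    Instead \<open>f\<close> splits orthogonally, and Cauchy-Schwarz in the plane is applied to the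
    triangle inequality.\<close>
  have "u (T \<circ> Q) = 0"
  proof (rule main[OF bounded_ops_compose[OF T bQ]])
    fix t f assume f: "f \<in> l2 G"
    have Pf: "P f \<in> l2 G" and Qf: "Q f \<in> l2 G" using bounded_ops_l2 bP bQ f by blast+
    have TQf: "(\<lambda>x. of_real t * T (Q f) x) \<in> l2 G" by (rule l2_scale[OF bounded_ops_l2[OF T Qf]])
    have "(P + t *\<^sub>R (T \<circ> Q)) f = (\<lambda>x. P f x + of_real t * T (Q f) x)"
      by (simp add: fun_eq_iff scaleR_conv_of_real)
    then have "l2norm G ((P + t *\<^sub>R (T \<circ> Q)) f) \<le> l2norm G (P f) + \<bar>t\<bar> * l2norm G (T (Q f))"
      using l2norm_triangle[OF Pf TQf] by (simp add: l2norm_scale)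
    also have "\<dots> \<le> l2norm G (P f) + \<bar>t\<bar> * (c * l2norm G (Q f))"
      using opnorm_bound[OF T Qf] by (intro add_left_mono mult_left_mono) (auto simp: c_def)
    also have "\<dots> = l2norm G (P f) + (\<bar>t\<bar> * c) * l2norm G (Q f)" by simp
    also have "\<dots> \<le> sqrt (1 + (\<bar>t\<bar> * c)\<^sup>2) * sqrt ((l2norm G (P f))\<^sup>2 + (l2norm G (Q f))\<^sup>2)"
      by (rule cauchy_schwarz_pair) simp_all
    also have "\<dots> = sqrt (1 + t\<^sup>2 * c\<^sup>2) * l2norm G f"
      using split[OF f, symmetric] by (simp add: power_mult_distrib)
    finally show "l2norm G ((P + t *\<^sub>R (T \<circ> Q)) f) \<le> sqrt (1 + t\<^sup>2 * c\<^sup>2) * l2norm G f" .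
  qed
  then show "u (T \<circ> mult_op G (indicat_real (- E))) = 0" by (simp add: Q_def)
qed

text \<open>The quantifier over \<open>c\<close> is needed to express that the complex state
  vanishes at \<open>left_reg G h\<close>, because \<open>u\<close> is only its real part.\<close>

definition supported_on :: "('a op \<Rightarrow> real) \<Rightarrow> 'a set \<Rightarrow> bool" where
  "supported_on u H \<longleftrightarrow> (\<forall>h\<in>carrier G - H. \<forall>c. u (\<lambda>f x. c * left_reg G h f x) = 0)"

text \<open>Take a state whose diagonal mean fixes an extreme \<open>w\<close>. If \<open>h\<close>
  moves \<open>w\<close>, the mean lives on an \<open>E\<close> of points keeping \<open>w\<close>
  near itself, and on an \<open>E'\<close> with \<open>h E'\<close> keeping it near
  \<open>h w\<close>, so \<open>h E'\<close> misses \<open>E\<close>. The projections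
  \<open>P\<close>, \<open>P'\<close> both have value 1, hence the state at
  \<open>left_reg G h\<close> equals its value at
  \<open>P \<circ> left_reg G h \<circ> P' = 0\<close>.\<close>

lemma supported_on_amenable:
  assumes I: "closed_ideal G (reduced_cstar G) I" "I \<noteq> reduced_cstar G"
  shows "\<exists>u\<in>ideal_states I. \<exists>w\<in>means G. supported_on u (stab w)"
proof -
  obtain w where w: "extreme_mean w" using extreme_mean_exists by blast
  then have wm: "w \<in> means G" by (simp add: extreme_mean_def)
  obtain u where u: "u \<in> ideal_states I" and uw: "conv (diag_mean u) w = w"
    using w diag_mean_closed_left_ideal[OF I] unfolding extreme_mean_def by blast
  have ud: "u \<in> dominated (bounded_ops G) (opnorm G)" using u by (simp add: ideal_states_def)
  have m: "diag_mean u \<in> means G" by (rule diag_mean_means[OF u])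
  have ind: "u (mult_op G (indicat_real E)) = diag_mean u (indicat_real E)" for E
    using bdd_fun_indicat[of E G] by (simp add: diag_mean_def)
  have "u (\<lambda>f x. c * left_reg G h f x) = 0" if h: "h \<in> carrier G" "h \<notin> stab w" for h c
  proof -
    obtain \<phi> where \<phi>: "\<phi> \<in> bdd_fun G" "w (\<lambda>y. \<phi> (h \<otimes> y)) \<noteq> w \<phi>"
      using stab_iff[OF wm h(1)] h(2) by blast
    define \<psi> where "\<psi> = (\<lambda>y. \<phi> (h \<otimes> y))"
    have \<psi>: "\<psi> \<in> bdd_fun G" unfolding \<psi>_def by (rule bdd_fun_translate[OF \<phi>(1) h(1)])
    \<comment> \<open>Half the distance of the two values keeps the two neighbourhoods
      disjoint.\<close>
    define \<epsilon> where "\<epsilon> = \<bar>w \<psi> - w \<phi>\<bar> / 2"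
    have \<epsilon>: "\<epsilon> > 0" using \<phi>(2) by (simp add: \<epsilon>_def \<psi>_def)
    define E where "E = {x. \<bar>w (\<lambda>y. \<phi> (x \<otimes> y)) - w \<phi>\<bar> < \<epsilon>}"
    define E' where "E' = {x. \<bar>w (\<lambda>y. \<psi> (x \<otimes> y)) - w \<psi>\<bar> < \<epsilon>}"
    have uE: "u (mult_op G (indicat_real E)) = 1" "u (mult_op G (indicat_real E')) = 1"
      unfolding ind E_def E'_def by (rule extreme_mean_concentrated[OF w m uw _ \<epsilon>], rule \<phi> \<psi>)+
    have disj: "h \<otimes> x \<notin> E" if x: "x \<in> carrier G" "x \<in> E'" for x
    proof
      assume "h \<otimes> x \<in> E"
      then have "\<bar>w (\<lambda>y. \<phi> (h \<otimes> x \<otimes> y)) - w \<phi>\<bar> < \<epsilon>" by (simp add: E_def)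
      moreover have "w (\<lambda>y. \<phi> (h \<otimes> x \<otimes> y)) = w (\<lambda>y. \<psi> (x \<otimes> y))"
        using h x by (intro mean_cong[OF wm]) (simp add: \<psi>_def m_assoc)
      moreover have "\<bar>w (\<lambda>y. \<psi> (x \<otimes> y)) - w \<psi>\<bar> < \<epsilon>" using x by (simp add: E'_def)
      ultimately have "\<bar>w \<psi> - w \<phi>\<bar> < 2 * \<epsilon>" by linarith
      then show False by (simp add: \<epsilon>_def)
    qed
    define T where "T = (\<lambda>f x. c * left_reg G h f x)"
    have bT: "T \<in> bounded_ops G" unfolding T_def by (rule bounded_ops_cscale[OF left_reg_bounded[OF h(1)]])
    define P where "P = mult_op G (indicat_real E)"
    define P' where "P' = mult_op G (indicat_real E')"
    have bPT: "P \<circ> T \<in> bounded_ops G"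
      unfolding P_def by (rule bounded_ops_compose[OF mult_op_indicat_bounded bT])
    have "P \<circ> T \<circ> P' = (\<lambda>_ _. 0)"
    proof (intro ext)
      fix f x
      show "(P \<circ> T \<circ> P') f x = 0"
      proof (cases "f \<in> l2 G")
        case True
        have P'f: "P' f \<in> l2 G" unfolding P'_def by (rule bounded_ops_l2[OF mult_op_indicat_bounded True])
        have "(P \<circ> T \<circ> P') f x = (if x \<in> E then c * left_reg G h (P' f) x else 0)"
          using mult_op_indicat_apply[OF bounded_ops_l2[OF bT P'f]] by (simp add: P_def T_def)
        also have "\<dots> = 0"
        proof (cases "x \<in> carrier G \<and> x \<in> E")
          case x: True
          have "h \<otimes> (inv h \<otimes> x) = x" using h x by (simp add: m_assoc[symmetric])
          then have "inv h \<otimes> x \<notin> E'" using disj[of "inv h \<otimes> x"] x h by auto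
          then show ?thesis
            using x by (simp add: left_reg_apply[OF P'f]) (simp add: P'_def mult_op_indicat_apply[OF True])
        next
          case False
          then show ?thesis using P'f by (auto simp: left_reg_def)
        qed
        finally show ?thesis .
      next
        case False
        then show ?thesis
          by (simp add: P'_def mult_op_def bounded_ops_zero[OF bT] P_def)
      qed
    qed
    then have z1: "u (P \<circ> T \<circ> P') = 0" using dominated_0[OF ud subspace_bounded_ops] by (simp add: zero_op)
    have z2: "u (P \<circ> T \<circ> mult_op G (indicat_real (- E'))) = 0"
      by (rule ideal_state_project(2)[OF u uE(2) bPT])
    have z3: "u (mult_op G (indicat_real (- E)) \<circ> T) = 0"
      by (rule ideal_state_project(1)[OF u uE(1) bT])
    \<comment> \<open>The pieces with a complementary projection contribute nothing by
      \<open>ideal_state_project\<close>, so first \<open>P'\<close> is inserted on the right, and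
      then \<open>P\<close> on the left.\<close>
    have "u (P \<circ> T) = u ((P \<circ> T \<circ> P') + (P \<circ> T \<circ> mult_op G (indicat_real (- E'))))"
      unfolding P'_def mult_op_indicat_add(2)[OF bPT] ..
    also have "\<dots> = 0"
      using dominatedD(1)[OF ud bounded_ops_compose[OF bPT mult_op_indicat_bounded]
          bounded_ops_compose[OF bPT mult_op_indicat_bounded], of E' "- E'"] z1 z2
      by (simp add: P'_def)
    finally have "u (P \<circ> T) = 0" .
    moreover have "u T = u ((P \<circ> T) + (mult_op G (indicat_real (- E)) \<circ> T))"
      unfolding P_def mult_op_indicat_add(1)[OF bT] ..
    ultimately have "u T = 0"
      using dominatedD(1)[OF ud bPT bounded_ops_compose[OF mult_op_indicat_bounded bT], of "- E"] z3 by simp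
    then show ?thesis by (simp add: T_def)
  qed
  then have "supported_on u (stab w)" by (simp add: supported_on_def)
  with u wm show ?thesis by blast
qed

lemma supported_on_conjugate:
  assumes u: "supported_on u H" and g: "g \<in> carrier G" and H: "H \<subseteq> carrier G"
  shows "supported_on (act (dirac g) u) (conjugate g H)"
  unfolding supported_on_def
proof (intro ballI allI)
  fix h c assume h: "h \<in> carrier G - conjugate g H"
  have hC: "h \<in> carrier G" and hg: "inv g \<otimes> h \<otimes> g \<notin> H" using h mem_conj_iff[OF g H] by auto
  let ?T = "\<lambda>f x. c * left_reg G h f x"
  have bT: "?T \<in> bounded_ops G" by (rule bounded_ops_cscale[OF left_reg_bounded[OF hC]])
  have eq: "conj_op g ?T = (\<lambda>f x. c * left_reg G (inv g \<otimes> h \<otimes> g) f x)"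
    using conj_op_cscale[OF g left_reg_bounded[OF hC]] by (simp add: conj_op_left_reg[OF g hC])
  have "u (conj_op g ?T) = 0"
    unfolding eq using u hg hC g by (simp add: supported_on_def)
  then show "act (dirac g) u ?T = 0" using bT by (simp add: act_def dirac_def)
qed

text \<open>A state supported on the trivial subgroup is the canonical trace on the reduced algebra,
  which is faithful.\<close>

lemma trace_state_imp_zero_ideal:
  assumes I: "closed_ideal G (reduced_cstar G) I"
    and u: "u \<in> ideal_states I" and supp: "supported_on u {\<one>}"
  shows "I = {\<lambda>_ _. 0}"
proof -
  have ud: "u \<in> dominated (bounded_ops G) (opnorm G)" and u1: "u (left_reg G \<one>) = 1"
    and uI: "\<And>T. T \<in> I \<Longrightarrow> u T = 0"
    using u by (auto simp: ideal_states_def)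
  have IA: "T \<in> reduced_cstar G" if "T \<in> I" for T using I that by (auto simp: closed_ideal_def)
  have b1: "left_reg G \<one> \<in> bounded_ops G" by (rule left_reg_bounded) simp
  \<comment> \<open>A state is real at the identity: \<open>1 + t * \<i>\<close> has modulus
    \<open>sqrt (1 + t\<^sup>2)\<close>, so the first-order argument applies.\<close>
  have i0: "u (\<lambda>f x. \<i> * left_reg G \<one> f x) = 0"
  proof (rule sqrt_bound_zero[of 1])
    fix t
    let ?T = "\<lambda>f x. \<i> * left_reg G \<one> f x"
    have bT: "?T \<in> bounded_ops G" by (rule bounded_ops_cscale[OF b1])
    have eq: "left_reg G \<one> + t *\<^sub>R ?T = (\<lambda>f x. (1 + of_real t * \<i>) * left_reg G \<one> f x)"
      by (simp add: fun_eq_iff scaleR_conv_of_real algebra_simps)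
    have "u (left_reg G \<one> + t *\<^sub>R ?T) \<le> opnorm G (left_reg G \<one> + t *\<^sub>R ?T)"
      by (intro dominatedD(3)[OF ud] subspace_add[OF subspace_bounded_ops] subspace_scale[OF subspace_bounded_ops] b1 bT)
    also have "\<dots> \<le> cmod (1 + of_real t * \<i>) * opnorm G (left_reg G \<one>)"
      unfolding eq by (rule opnorm_cscale_le[OF b1])
    also have "\<dots> \<le> cmod (1 + of_real t * \<i>) * 1"
      using opnorm_left_reg_le[OF one_closed] by (intro mult_left_mono) auto
    also have "\<dots> = sqrt (1 + t\<^sup>2 * 1)" by (simp add: cmod_def)
    finally show "1 + t * u ?T \<le> sqrt (1 + t\<^sup>2 * 1)"
      using dominatedD(1)[OF ud b1 subspace_scale[OF subspace_bounded_ops bT]] dominatedD(2)[OF ud bT] u1 by simp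
  qed simp
  have uc: "u (\<lambda>f x. c * left_reg G \<one> f x) = Re c" for c
  proof -
    have "(\<lambda>f x. c * left_reg G \<one> f x) = Re c *\<^sub>R left_reg G \<one> + Im c *\<^sub>R (\<lambda>f x. \<i> * left_reg G \<one> f x)"
    proof (intro ext)
      fix f x
      show "c * left_reg G \<one> f x = (Re c *\<^sub>R left_reg G \<one> + Im c *\<^sub>R (\<lambda>f x. \<i> * left_reg G \<one> f x)) f x"
        by (subst complex_eq[of c]) (simp add: scaleR_conv_of_real algebra_simps)
    qed
    then show ?thesis
      using dominatedD(1)[OF ud subspace_scale[OF subspace_bounded_ops b1]
          subspace_scale[OF subspace_bounded_ops bounded_ops_cscale[OF b1]], of "Re c" "Im c" \<i>]
        dominatedD(2)[OF ud b1, of "Re c"] dominatedD(2)[OF ud bounded_ops_cscale[OF b1], of "Im c" \<i>] u1 i0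
      by simp
  qed
  have trace_alg: "u T = Re (T (delta \<one>) \<one>)" if "T \<in> algebraic_ops" for T
    using that
  proof (induction rule: algebraic_ops_induct)
    case zero
    then show ?case using dominated_0[OF ud subspace_bounded_ops] by (simp add: zero_op)
  next
    case (plus S T)
    then show ?case
      using dominatedD(1)[OF ud algebraic_ops_bounded[OF plus.hyps(1)] algebraic_ops_bounded[OF plus.hyps(2)]]
      by (simp add: plus_op)
  next
    case (left_reg g c)
    have d: "left_reg G g (delta \<one>) \<one> = delta g \<one>" using left_reg_delta[OF left_reg one_closed] left_reg by simp
    show ?case
    proof (cases "g = \<one>")
      case True
      then show ?thesis using uc d by (simp add: delta_def)
    next
      case False
      then have "u (\<lambda>f x. c * left_reg G g f x) = 0" using supp left_reg by (simp add: supported_on_def)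
      then show ?thesis using d False by (simp add: delta_def)
    qed
  qed
  have trace: "u T = Re (T (delta \<one>) \<one>)" if T: "T \<in> reduced_cstar G" for T
  proof -
    have bT: "T \<in> bounded_ops G" by (rule reduced_cstar_bounded[OF T])
    have "\<bar>u T - Re (T (delta \<one>) \<one>)\<bar> \<le> \<epsilon>" if e: "\<epsilon> > 0" for \<epsilon>
    proof -
      obtain S where S: "S \<in> algebraic_ops" "opnorm G (\<lambda>f x. T f x - S f x) < \<epsilon> / 2"
        using reduced_cstarE[OF T, of "\<epsilon> / 2"] e by auto
      have bS: "S \<in> bounded_ops G" by (rule algebraic_ops_bounded[OF S(1)])
      have bd: "(\<lambda>f x. T f x - S f x) \<in> bounded_ops G" by (rule bounded_ops_minus[OF bT bS])
      have "\<bar>u T - u S\<bar> \<le> opnorm G (\<lambda>f x. T f x - S f x)"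
        using ideal_states_abs_le[OF u bd] dominated_diff[OF ud subspace_bounded_ops bT bS] by (simp add: minus_op)
      moreover have "\<bar>Re (T (delta \<one>) \<one>) - Re (S (delta \<one>) \<one>)\<bar> \<le> opnorm G (\<lambda>f x. T f x - S f x)"
      proof -
        have d: "delta \<one> \<in> l2 G" "l2norm G (delta \<one>) = 1" by (simp_all add: delta_l2 l2norm_delta)
        have "\<bar>Re (T (delta \<one>) \<one> - S (delta \<one>) \<one>)\<bar> \<le> cmod (T (delta \<one>) \<one> - S (delta \<one>) \<one>)"
          by (rule abs_Re_le_cmod)
        also have "\<dots> \<le> l2norm G (\<lambda>x. T (delta \<one>) x - S (delta \<one>) x)"
          using cmod_le_l2norm[OF bounded_ops_l2[OF bd d(1)], of \<one>] by simp
        also have "\<dots> \<le> opnorm G (\<lambda>f x. T f x - S f x)"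
          using opnorm_bound[OF bd d(1)] d(2) by simp
        finally show ?thesis by simp
      qed
      ultimately show ?thesis using trace_alg[OF S(1)] S(2) by linarith
    qed
    then have "\<bar>u T - Re (T (delta \<one>) \<one>)\<bar> \<le> 0" by (rule field_le_epsilon) simp
    then show ?thesis by simp
  qed
  have "T = (\<lambda>_ _. 0)" if T: "T \<in> I" for T
  proof -
    have bT: "T \<in> bounded_ops G" by (rule reduced_cstar_bounded[OF IA[OF T]])
    \<comment> \<open>Since \<open>I\<close> is two-sided, every matrix coefficient of
      \<open>T\<close> can be moved to the corner \<open>(\<one>, \<one>)\<close>, where the trace
      reads it off. The multiples \<open>c = 1\<close> and \<open>c = - \<i>\<close> give real and
      imaginary part.\<close>
    have coef: "T (delta h) g = 0" if g: "g \<in> carrier G" and h: "h \<in> carrier G" for g h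
    proof -
      define S where "S = left_reg G (inv g) \<circ> (T \<circ> left_reg G h)"
      have SI: "S \<in> I"
        using I T left_reg_reduced[of "inv g"] left_reg_reduced[OF h] g
        unfolding closed_ideal_def S_def by (metis inv_closed)
      have S1: "S (delta \<one>) \<one> = T (delta h) g"
        using g h left_reg_delta[OF h one_closed] left_reg_apply[OF bounded_ops_l2[OF bT delta_l2[OF h]] one_closed]
        by (simp add: S_def)
      have "Re (c * T (delta h) g) = 0" for c
      proof -
        have cS: "(\<lambda>f x. c * S f x) \<in> I" using I SI unfolding closed_ideal_def by blast
        show ?thesis using trace[OF IA[OF cS]] uI[OF cS] S1 by simp
      qed
      from this[of 1] this[of "- \<i>"] show ?thesis by (simp add: complex_eq_iff)
    qed
    have Td: "T (delta h) = (\<lambda>_. 0)" if h: "h \<in> carrier G" for h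
    proof
      fix g show "T (delta h) g = 0"
        using coef[OF _ h] l2_outside[OF bounded_ops_l2[OF bT delta_l2[OF h]]] by (cases "g \<in> carrier G") auto
    qed
    have Tfin: "T (\<lambda>x. \<Sum>h\<in>F. f h * delta h x) = (\<lambda>_. 0) \<and> (\<lambda>x. \<Sum>h\<in>F. f h * delta h x) \<in> l2 G"
      if "finite F" "F \<subseteq> carrier G" for F f
      using that
    proof (induction F rule: finite_induct)
      case empty
      then show ?case using bounded_ops_zero[OF bT] by simp
    next
      case (insert h F)
      have h: "delta h \<in> l2 G" using insert.prems by (intro delta_l2) simp
      have IH: "T (\<lambda>x. \<Sum>h\<in>F. f h * delta h x) = (\<lambda>_. 0)" "(\<lambda>x. \<Sum>h\<in>F. f h * delta h x) \<in> l2 G"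
        using insert by auto
      show ?case
        using bounded_ops_linear[OF bT h IH(2), of "f h"] IH Td[of h] insert.prems insert.hyps
          l2_add[OF l2_scale[OF h, of "f h"] IH(2)] by simp
    qed
    \<comment> \<open>Finitely supported functions are dense, and \<open>T\<close> kills
      them.\<close>
    have "T f = (\<lambda>_. 0)" if f: "f \<in> l2 G" for f
    proof -
      have "l2norm G (T f) \<le> \<epsilon>" if e: "\<epsilon> > 0" for \<epsilon>
      proof -
        define K where "K = opnorm G T + 1"
        have K: "K > 0" "opnorm G T \<le> K" using opnorm_nonneg[OF bT] by (simp_all add: K_def)
        have "\<epsilon> / K > 0" using e K by simp
        then obtain F where F: "finite F" "F \<subseteq> carrier G" "l2norm G (\<lambda>x. if x \<in> F then 0 else f x) < \<epsilon> / K"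
          by (rule l2_tail[OF f])
        define h where "h = (\<lambda>x. \<Sum>y\<in>F. f y * delta y x)"
        have h: "h \<in> l2 G" "T h = (\<lambda>_. 0)" using Tfin[OF F(1,2), of f] by (auto simp: h_def)
        have "h x = (if x \<in> F then f x else 0)" for x
          using F(1) by (simp add: h_def delta_def if_distrib sum.delta cong: if_cong)
        then have "(\<lambda>x. f x - h x) = (\<lambda>x. if x \<in> F then 0 else f x)" by auto
        moreover have "T (\<lambda>x. f x - h x) = T f" using bounded_ops_diff[OF bT f h(1)] h(2) by simp
        ultimately have "l2norm G (T f) \<le> opnorm G T * l2norm G (\<lambda>x. if x \<in> F then 0 else f x)"
          using opnorm_bound[OF bT l2_diff[OF f h(1)]] by simp
        also have "\<dots> \<le> K * (\<epsilon> / K)" using K F(3) by (intro mult_mono) auto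
        finally show ?thesis using K by simp
      qed
      then have "l2norm G (T f) \<le> 0" by (rule field_le_epsilon[where y=0]) simp
      then show ?thesis using l2norm_zero_iff[OF bounded_ops_l2[OF bT f]] by (simp add: order_antisym)
    qed
    then show ?thesis using bounded_ops_outside[OF bT] by (intro ext) metis
  qed
  moreover have "(\<lambda>_ _. 0) \<in> I" using I by (simp add: closed_ideal_def)
  ultimately show ?thesis by blast
qed

end

section \<open>Limits of conjugates\<close>

text \<open>By Baire a nonempty compact Hausdorff space is not a countable union of closed sets with
  empty interior, so some singleton is open.\<close>

lemma isolated_point_of_countable_compact:
  fixes Y :: "'t::t2_space set"
  assumes Y: "compact Y" "countable Y" "Y \<noteq> {}"
  obtains x W where "x \<in> Y" "open W" "W \<inter> Y = {x}"
proof -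
  let ?X = "top_of_set Y"
  have cs: "compact_space ?X" using Y(1) by (simp add: compact_space_subtopology)
  have hs: "Hausdorff_space ?X" by (intro Hausdorff_space_subtopology) (metis Hausdorff_space_def disjnt_def hausdorff open_openin)
  have "\<exists>x\<in>Y. ?X interior_of {x} \<noteq> {}"
  proof (rule ccontr)
    assume "\<not> ?thesis"
    then have empty: "?X interior_of {x} = {}" if "x \<in> Y" for x using that by blast
    have "?X interior_of \<Union>((\<lambda>x. {x}) ` Y) = {}"
    proof (rule Baire_category_alt)
      show "completely_metrizable_space ?X \<or> locally_compact_space ?X \<and> regular_space ?X"
        using cs hs by (simp add: compact_imp_locally_compact_space compact_Hausdorff_imp_regular_space)
      show "countable ((\<lambda>x. {x}) ` Y)" using Y(2) by simp
      show "closedin ?X T \<and> ?X interior_of T = {}" if "T \<in> (\<lambda>x. {x}) ` Y" for T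
        using that empty by (auto intro: closed_subset)
    qed
    moreover have "\<Union>((\<lambda>x. {x}) ` Y) = Y" by auto
    ultimately show False using Y(3) interior_of_topspace[of ?X] by simp
  qed
  then obtain x where x: "x \<in> Y" "?X interior_of {x} \<noteq> {}" by blast
  then have "?X interior_of {x} = {x}" using interior_of_subset[of ?X "{x}"] by blast
  then have "openin ?X {x}" by (metis openin_interior_of)
  then obtain W where "open W" "{x} = Y \<inter> W" by (auto simp: openin_open)
  with x(1) show ?thesis by (intro that[of x W]) auto
qed

context group
begin

text \<open>Subgroups are identified with their indicator functions, so that the Chabauty topology
  becomes the product topology.\<close>

definition small_subgroups :: "'a op set \<Rightarrow> 'a set set" where
  "small_subgroups I = {H. subgroup H G \<and> amen H \<and> (\<exists>u\<in>ideal_states I. supported_on u H)}"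

text \<open>The witnesses, a state \<open>u\<close> and an invariant mean \<open>m\<close>, are
  carried along as coordinates and projected away at the end. On 0-1 valued functions an implication
  with premise "x in H" becomes a disjunction of equations, so every requirement is a closed
  condition on triples.\<close>

lemma compact_small_subgroups:
  "compact ((indicat_real :: 'a set \<Rightarrow> _) ` small_subgroups I)"
proof -
  let ?B = "{\<eta> :: 'a \<Rightarrow> real. \<forall>x. \<eta> x \<in> {0, 1}}"
  define C :: "(('a \<Rightarrow> real) \<times> ('a op \<Rightarrow> real) \<times> (('a \<Rightarrow> real) \<Rightarrow> real)) set" where
    "C = (\<Inter>x\<in>-carrier G. {z. fst z x = 0}) \<inter> {z. fst z \<one> = 1} \<inter>
      (\<Inter>x\<in>carrier G. \<Inter>y\<in>carrier G. {z. fst z x = 0 \<or> fst z y = 0 \<or> fst z (x \<otimes> y) = 1}) \<inter>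
      (\<Inter>x\<in>carrier G. {z. fst z x = 0 \<or> fst z (inv x) = 1}) \<inter>
      (\<Inter>h\<in>carrier G. \<Inter>c. {z. fst z h = 1 \<or> fst (snd z) (\<lambda>f x. c * left_reg G h f x) = 0}) \<inter>
      (\<Inter>h\<in>carrier G. \<Inter>\<phi>\<in>bdd_fun G. {z. fst z h = 0 \<or> snd (snd z) (\<lambda>y. \<phi> (h \<otimes> y)) = snd (snd z) \<phi>})"
  have c1: "continuous_on UNIV (\<lambda>z :: ('a \<Rightarrow> real) \<times> ('a op \<Rightarrow> real) \<times> (('a \<Rightarrow> real) \<Rightarrow> real). fst z x)" for x
    by (rule continuous_on_product_then_coordinatewise[OF continuous_on_fst[OF continuous_on_id]])
  have c2: "continuous_on UNIV (\<lambda>z :: ('a \<Rightarrow> real) \<times> ('a op \<Rightarrow> real) \<times> (('a \<Rightarrow> real) \<Rightarrow> real). fst (snd z) T)" for T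
    by (rule continuous_on_product_then_coordinatewise[OF continuous_on_fst[OF continuous_on_snd[OF continuous_on_id]]])
  have c3: "continuous_on UNIV (\<lambda>z :: ('a \<Rightarrow> real) \<times> ('a op \<Rightarrow> real) \<times> (('a \<Rightarrow> real) \<Rightarrow> real). snd (snd z) \<phi>)" for \<phi>
    by (rule continuous_on_product_then_coordinatewise[OF continuous_on_snd[OF continuous_on_snd[OF continuous_on_id]]])
  have "closed C"
    unfolding C_def
    by (intro closed_Int closed_INT ballI closed_Collect_disj closed_Collect_eq c1 c2 c3 continuous_on_const)
  moreover have "compact (?B \<times> ideal_states I \<times> means G)"
    by (intro compact_Times compact_ideal_states compact_means compact_PiE_real) simp
  ultimately have cK: "compact ((?B \<times> ideal_states I \<times> means G) \<inter> C)" by (rule compact_Int_closed[rotated])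
  have "indicat_real ` small_subgroups I = fst ` ((?B \<times> ideal_states I \<times> means G) \<inter> C)"
  proof (intro equalityI subsetI)
    fix \<eta> assume "\<eta> \<in> indicat_real ` small_subgroups I"
    then obtain H where H: "subgroup H G" "amen H" "\<eta> = indicat_real H" and "\<exists>u\<in>ideal_states I. supported_on u H"
      unfolding small_subgroups_def by blast
    then obtain u where u: "u \<in> ideal_states I" "supported_on u H" by blast
    obtain m where m: "m \<in> means G" "H \<subseteq> stab m" using H(2) by (auto simp: amen_def)
    have "(\<eta>, u, m) \<in> C"
      unfolding C_def H(3)
      using subgroup.subset[OF H(1)] subgroup.one_closed[OF H(1)] subgroup.m_closed[OF H(1)]
        subgroup.m_inv_closed[OF H(1)] u(2) stab_iff[OF m(1)] m(2)
      by (auto simp: indicator_def supported_on_def)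
    moreover have "\<eta> \<in> ?B" by (auto simp: H(3) indicator_def)
    ultimately show "\<eta> \<in> fst ` ((?B \<times> ideal_states I \<times> means G) \<inter> C)"
      using u(1) m(1) by (intro image_eqI[of _ _ "(\<eta>, u, m)"]) auto
  next
    fix \<eta> assume "\<eta> \<in> fst ` ((?B \<times> ideal_states I \<times> means G) \<inter> C)"
    then obtain u m where um: "\<eta> \<in> ?B" "u \<in> ideal_states I" "m \<in> means G" "(\<eta>, u, m) \<in> C" by auto
    define H where "H = {x. \<eta> x = 1}"
    have v: "\<eta> x = 1 \<or> \<eta> x = 0" for x using um(1) by auto
    have \<eta>: "\<eta> = indicat_real H" using v by (auto simp: H_def indicator_def fun_eq_iff)
    have C: "\<And>x. x \<notin> carrier G \<Longrightarrow> \<eta> x = 0" "\<eta> \<one> = 1"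
      "\<And>x y. x \<in> carrier G \<Longrightarrow> y \<in> carrier G \<Longrightarrow> \<eta> x = 0 \<or> \<eta> y = 0 \<or> \<eta> (x \<otimes> y) = 1"
      "\<And>x. x \<in> carrier G \<Longrightarrow> \<eta> x = 0 \<or> \<eta> (inv x) = 1"
      "\<And>h c. h \<in> carrier G \<Longrightarrow> \<eta> h = 1 \<or> u (\<lambda>f x. c * left_reg G h f x) = 0"
      "\<And>h \<phi>. h \<in> carrier G \<Longrightarrow> \<phi> \<in> bdd_fun G \<Longrightarrow> \<eta> h = 0 \<or> m (\<lambda>y. \<phi> (h \<otimes> y)) = m \<phi>"
      using um(4) unfolding C_def by auto
    have HC: "H \<subseteq> carrier G" using C(1) by (force simp: H_def)
    have "subgroup H G"
    proof (rule subgroupI[OF HC])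
      show "H \<noteq> {}" using C(2) by (auto simp: H_def)
      show "inv x \<in> H" if "x \<in> H" for x using C(4)[of x] that HC by (auto simp: H_def)
      show "x \<otimes> y \<in> H" if "x \<in> H" "y \<in> H" for x y using C(3)[of x y] that HC by (auto simp: H_def)
    qed
    moreover have "H \<subseteq> stab m"
    proof
      fix h assume h: "h \<in> H"
      then have "\<eta> h = 1" "h \<in> carrier G" using HC by (auto simp: H_def)
      then show "h \<in> stab m" using stab_iff[OF um(3), of h] C(6)[of h] by auto
    qed
    moreover have "supported_on u H" using C(5) by (auto simp: supported_on_def H_def)
    ultimately have "H \<in> small_subgroups I" using um(2,3) by (auto simp: small_subgroups_def amen_def)
    then show "\<eta> \<in> indicat_real ` small_subgroups I" unfolding \<eta> by (rule imageI)
  qed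
  moreover have "compact (fst ` ((?B \<times> ideal_states I \<times> means G) \<inter> C))"
    by (rule compact_continuous_image[OF _ cK]) (intro continuous_intros)
  ultimately show ?thesis by simp
qed

lemma small_subgroups_conjugate:
  assumes I: "closed_ideal G (reduced_cstar G) I" and H: "H \<in> small_subgroups I" and g: "g \<in> carrier G"
  shows "conjugate g H \<in> small_subgroups I"
proof -
  obtain u where u: "u \<in> ideal_states I" "supported_on u H" and sH: "subgroup H G" "amen H"
    using H unfolding small_subgroups_def by blast
  have HC: "H \<subseteq> carrier G" by (rule subgroup.subset[OF sH(1)])
  have "act (dirac g) u \<in> ideal_states I" by (rule act_ideal_states[OF I dirac_means[OF g] u(1)])
  moreover have "supported_on (act (dirac g) u) (conjugate g H)"
    by (rule supported_on_conjugate[OF u(2) g HC])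
  ultimately show ?thesis
    using subgroup_conj[OF g sH(1)] amen_conj[OF g HC sH(2)] unfolding small_subgroups_def by blast
qed

section \<open>Minimal conjugation invariant sets of subgroups\<close>

definition translate :: "'a \<Rightarrow> ('a \<Rightarrow> real) \<Rightarrow> 'a \<Rightarrow> real" where
  "translate g \<eta> x = (if x \<in> carrier G then \<eta> (inv g \<otimes> x \<otimes> g) else 0)"

lemma translate_indicat:
  assumes "g \<in> carrier G" "H \<subseteq> carrier G"
  shows "translate g (indicat_real H) = indicat_real (conjugate g H)"
proof
  fix x show "translate g (indicat_real H) x = indicat_real (conjugate g H) x"
    using mem_conj_iff[OF assms, of x] conj_subset[OF assms]
    by (cases "x \<in> carrier G") (auto simp: translate_def indicator_def)
qed

lemma continuous_on_translate: "continuous_on S (translate g)"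
proof (rule continuous_on_coordinatewise_then_product)
  fix x show "continuous_on S (\<lambda>\<eta>. translate g \<eta> x)"
    by (cases "x \<in> carrier G") (simp_all add: translate_def continuous_on_eval)
qed

text \<open>In a minimal closed invariant set every orbit is dense, so it meets the neighbourhood
  that isolates one point \<open>\<eta>\<close>. Thus all points are conjugates of
  \<open>\<eta>\<close>, and compactness reduces to finitely many conjugators.\<close>

lemma finite_conjugacy_class_exists:
  assumes I: "closed_ideal G (reduced_cstar G) I" and ne: "small_subgroups I \<noteq> {}"
    and count: "countable (small_subgroups I)"
  obtains H where "H \<in> small_subgroups I" "finite {conjugate g H | g. g \<in> carrier G}"
proof -
  let ?Y = "indicat_real ` small_subgroups I"
  have sC: "H \<subseteq> carrier G" if "H \<in> small_subgroups I" for H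
    using that subgroup.subset by (auto simp: small_subgroups_def)
  have tr: "translate g \<eta> \<in> ?Y" if \<eta>: "\<eta> \<in> ?Y" and g: "g \<in> carrier G" for g \<eta>
    using \<eta> small_subgroups_conjugate[OF I _ g] translate_indicat[OF g sC] by fastforce
  have tt: "translate g (translate h \<eta>) = translate (g \<otimes> h) \<eta>"
    if \<eta>: "\<eta> \<in> ?Y" and gh: "g \<in> carrier G" "h \<in> carrier G" for g h \<eta>
    using \<eta> gh sC by (auto simp: translate_indicat conj_subset conj_conj)
  have t1: "translate \<one> \<eta> = \<eta>" if \<eta>: "\<eta> \<in> ?Y" for \<eta>
    using \<eta> sC by (auto simp: translate_indicat conj_one)
  define Inv where "Inv S \<longleftrightarrow> (\<forall>g\<in>carrier G. \<forall>\<eta>\<in>S. translate g \<eta> \<in> S)" for S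
  obtain S where S: "closed S" "S \<subseteq> ?Y" "S \<noteq> {}" "Inv S"
    and min: "\<And>T. closed T \<Longrightarrow> T \<subseteq> S \<Longrightarrow> T \<noteq> {} \<Longrightarrow> Inv T \<Longrightarrow> T = S"
  proof (rule minimal_compact_subset[of ?Y Inv])
    show "compact ?Y" by (rule compact_small_subgroups)
    show "?Y \<noteq> {}" using ne by simp
    show "Inv ?Y" using tr by (simp add: Inv_def)
    show "Inv (\<Inter>\<A>)" if "\<A> \<noteq> {}" "\<And>S. S \<in> \<A> \<Longrightarrow> closed S \<and> S \<subseteq> ?Y \<and> S \<noteq> {} \<and> Inv S" for \<A>
      using that unfolding Inv_def by blast
  qed (use that in blast)
  have cS: "compact S" using S compact_small_subgroups by (metis compact_Int_closed inf.absorb_iff2)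
  have "countable S" using S(2) count by (meson countable_image countable_subset)
  then obtain \<eta> W where W: "\<eta> \<in> S" "open W" "W \<inter> S = {\<eta>}"
    by (rule isolated_point_of_countable_compact[OF cS _ S(3)])
  define V where "V g = translate g -` W" for g
  have oV: "open (V g)" for g unfolding V_def by (rule open_vimage[OF W(2) continuous_on_translate])
  \<comment> \<open>The points of \<open>S\<close> with no translate in \<open>W\<close> form a
    closed invariant set that omits \<open>\<eta>\<close>; by minimality it is empty.\<close>
  have cover: "S \<subseteq> (\<Union>g\<in>carrier G. V g)"
  proof (rule ccontr)
    assume n: "\<not> ?thesis"
    have "S - (\<Union>g\<in>carrier G. V g) = S"
    proof (rule min)
      show "closed (S - (\<Union>g\<in>carrier G. V g))" using S(1) oV by (intro closed_Diff) auto
      show "S - (\<Union>g\<in>carrier G. V g) \<noteq> {}" using n by blast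
      show "Inv (S - (\<Union>g\<in>carrier G. V g))"
        unfolding Inv_def
      proof (intro ballI)
        fix g \<psi> assume g: "g \<in> carrier G" and \<psi>: "\<psi> \<in> S - (\<Union>g\<in>carrier G. V g)"
        have "translate h (translate g \<psi>) \<notin> W" if h: "h \<in> carrier G" for h
        proof -
          have "\<psi> \<in> ?Y" using \<psi> S(2) by blast
          then have "translate h (translate g \<psi>) = translate (h \<otimes> g) \<psi>" by (rule tt[OF _ h g])
          moreover have "\<psi> \<notin> V (h \<otimes> g)" using \<psi> h g by blast
          ultimately show ?thesis by (simp add: V_def)
        qed
        moreover have "translate g \<psi> \<in> S" using S(4) g \<psi> by (simp add: Inv_def)
        ultimately show "translate g \<psi> \<in> S - (\<Union>g\<in>carrier G. V g)" by (auto simp: V_def)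
      qed
    qed auto
    then have "\<eta> \<notin> V \<one>" using W(1) by blast
    moreover have "\<eta> \<in> ?Y" using W(1) S(2) by blast
    ultimately show False using t1 W by (auto simp: V_def)
  qed
  obtain D where D: "D \<subseteq> carrier G" "finite D" "S \<subseteq> (\<Union>g\<in>D. V g)"
    using compactE_image[OF cS _ cover] oV by metis
  \<comment> \<open>A translate of a point of \<open>S\<close> that falls in \<open>W\<close> must
    be \<open>\<eta>\<close>, the only point of \<open>S\<close> there; undoing the translation
    recovers the point.\<close>
  have "S \<subseteq> (\<lambda>g. translate (inv g) \<eta>) ` D"
  proof
    fix \<psi> assume \<psi>: "\<psi> \<in> S"
    then obtain g where g: "g \<in> D" "translate g \<psi> \<in> W" using D(3) by (auto simp: V_def)
    then have gC: "g \<in> carrier G" using D(1) by blast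
    have "translate g \<psi> \<in> S" using S(4) gC \<psi> by (simp add: Inv_def)
    then have eq: "translate g \<psi> = \<eta>" using g(2) W(3) by blast
    have Y: "\<psi> \<in> ?Y" using \<psi> S(2) by blast
    have "\<psi> = translate (inv g) (translate g \<psi>)" using gC by (simp add: tt[OF Y] t1[OF Y])
    then show "\<psi> \<in> (\<lambda>g. translate (inv g) \<eta>) ` D" using eq g(1) by auto
  qed
  then have fS: "finite S" using D(2) finite_surj by blast
  obtain H where H: "H \<in> small_subgroups I" "\<eta> = indicat_real H" using W(1) S(2) by blast
  have "indicat_real ` {conjugate g H | g. g \<in> carrier G} \<subseteq> S"
  proof
    fix \<psi> assume "\<psi> \<in> indicat_real ` {conjugate g H | g. g \<in> carrier G}"
    then obtain g where g: "g \<in> carrier G" "\<psi> = indicat_real (conjugate g H)" by blast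
    then have "\<psi> = translate g \<eta>" using translate_indicat[OF g(1) sC[OF H(1)]] H(2) by simp
    then show "\<psi> \<in> S" using S(4) g(1) W(1) by (simp add: Inv_def)
  qed
  then have "finite (indicat_real ` {conjugate g H | g. g \<in> carrier G})" using fS by (rule finite_subset)
  moreover have "inj_on (indicat_real :: 'a set \<Rightarrow> _) A" for A
    by (rule inj_onI) (simp add: indicator_def fun_eq_iff set_eq_iff of_bool_eq_iff)
  ultimately have "finite {conjugate g H | g. g \<in> carrier G}" using finite_imageD by blast
  with H(1) show ?thesis by (rule that)
qed

lemma trivial_imp_cstar_simple:
  assumes triv: "\<And>N. N \<lhd> G \<Longrightarrow> amen N \<Longrightarrow> N = {\<one>}"
    and count: "countable (amenable_subgroups G)"
  shows "cstar_simple G"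
  unfolding cstar_simple_def
proof (intro allI impI)
  fix I assume I: "closed_ideal G (reduced_cstar G) I"
  show "I = {\<lambda>_ _. 0} \<or> I = reduced_cstar G"
  proof (cases "I = reduced_cstar G")
    case False
    obtain u w where "u \<in> ideal_states I" "w \<in> means G" "supported_on u (stab w)"
      using supported_on_amenable[OF I False] by blast
    then have "stab w \<in> small_subgroups I"
      using subgroup_stab[of w] unfolding small_subgroups_def amen_def by blast
    then have ne: "small_subgroups I \<noteq> {}" by blast
    have "small_subgroups I \<subseteq> amenable_subgroups G"
      using amen_imp_amenable_group by (auto simp: small_subgroups_def amenable_subgroups_def)
    then have "countable (small_subgroups I)" using count countable_subset by blast
    from finite_conjugacy_class_exists[OF I ne this]
    obtain H where H: "H \<in> small_subgroups I" "finite {conjugate g H | g. g \<in> carrier G}" .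
    have "H = {\<one>}"
      using H by (intro finite_conjugates_trivial[OF triv]) (auto simp: small_subgroups_def)
    then obtain v where "v \<in> ideal_states I" "supported_on v {\<one>}"
      using H(1) by (auto simp: small_subgroups_def)
    then show ?thesis using trace_state_imp_zero_ideal[OF I] by blast
  qed simp
qed

end

theorem theorem3p8:
  fixes G :: "('a, 'b) monoid_scheme"
  assumes "group G"
    and "countable (amenable_subgroups G)"
  shows "cstar_simple G \<longleftrightarrow> amenable_radical G = {\<one>\<^bsub>G\<^esub>}"
proof -
  interpret group G by (rule assms(1))
  show ?thesis
    using cstar_simple_imp_trivial trivial_imp_cstar_simple[OF _ assms(2)]
    unfolding amenable_radical_trivial_iff by blast
qed

end
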